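(* Let $k\ge 2$ be an integer, and let $V_h$, $V_h^0$, $V_h(T)$, $a(\cdot,\cdot)$ and the local solution map $(w_b,w_n)\mapsto w(w_b,w_n,0)$ be as described in the context. Let $\Lambda_h^0=\{(v_b,v_n): \{0,v_b,v_n\}\in V_h^0\}$. Then the global Schur complement system $$a(w_h,v)=0\qquad\text{for all } v=\{0,v_b,v_n\}\in V_h^0,$$ regarded as a system in the unknowns $(w_b,w_n)$ after elimination of $w_0$ through the local systems, i.e. written as $$a(w(w_b,w_n,0),v)=-a(w(0,0,f),v)\qquad\text{for all } v=\{0,v_b,v_n\}\in V_h^0,$$ is symmetric and positive definite. That is, the bilinear form $$B\big((w_b,w_n),(v_b,v_n)\big)=a\big(w(w_b,w_n,0),\{0,v_b,v_n\}\big)$$ on $\Lambda_h^0\times\Lambda_h^0$ is symmetric, and $B\big((v_b,v_n),(v_b,v_n)\big)>0$ for every nonzero $(v_b,v_n)\in\Lambda_h^0$.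
   Context: Setting: $\Omega\subset\mathbb R^d$ ($d=2$ or $3$) is a bounded polygonal/polyhedral domain and $f\in L^2(\Omega)$. $\mathcal T_h$ is a finite partition of $\Omega$ into polygons (2D) or polyhedra (3D); $h_T$ is the diameter of $T\in\mathcal T_h$; $\mathcal E_h$ is the set of all edges (2D) or flat faces (3D) of $\mathcal T_h$. $(\cdot,\cdot)_T$, $\langle\cdot,\cdot\rangle_{\partial T}$ and $(\cdot,\cdot)$ are the $L^2$ inner products on $T$, $\partial T$ and $\Omega$. $P_r(T)$, $P_r(e)$ denote polynomials of degree at most $r$ on $T$, $e$. Shape regularity of $\mathcal T_h$ means that there are positive constants $\rho_v,\rho_e,\kappa,\sigma^*,\gamma_*$ and $\theta_0<\pi/2$ such that, for every $T\in\mathcal T_h$ and every edge/face $e$ of $T$ (with diameter $h_e$): $\rho_v h_T^d\le |T|$ and $\rho_e h_e^{d-1}\le|e|$; $\kappa h_T\le h_e$; $T$ contains a pyramid with base $e$, apex $A_e\in T$ and height at least $\sigma^* h_T$, such that for every $x_e\in e$ the angle between $x_e-A_e$ and the outward normal of $e$ is at most $\theta_0$; and $T$ has a circumscribed shape-regular simplex $S(T)$ of diameter at most $\gamma_* h_T$, each $S(T)$ meeting only a bounded number of other such simplices. $\mathcal T_h$ is assumed shape regular in this sense. For each $e\in\mathcal E_h$ a unit normal $\mathbf n_e$ to $e$ is fixed once and for all. $\mathbf n$ denotes the outward unit normal on $\partial T$. Spaces: $V_h$ is the space of triples $v=\{v_0,v_b,v_n\}$ with $v_0|_T\in P_k(T)$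 for each $T\in\mathcal T_h$ (no continuity between elements), and $v_b|_e\in P_{k-1}(e)$, $v_n|_e\in P_{k-1}(e)$ for each $e\in\mathcal E_h$; $v_b$ and $v_n$ are single valued on each $e$, and $v_n$ plays the role of $\nabla v\cdot\mathbf n_e$. $V_h^0=\{v\in V_h: v_b|_e=0,\ v_n|_e=0 \text{ for all } e\subset\partial\Omega\}$. For $T\in\mathcal T_h$, $V_h(T)=\{v=\{v_0,v_b,v_n\}\in V_h^0: v(\mathbf x)=0 \text{ for } \mathbf x\notin T\}$; in particular its elements of the form $\{v_0,0,0\}$ are those with $v_0\in P_k(T)$ extended by zero outside $T$. Projection: $Q_b$ is the $L^2$ projection onto $P_{k-1}(e)$ on each $e\in\mathcal E_h$. Discrete weak Laplacian: for $v\in V_h$ and $T\in\mathcal T_h$, $\Delta_w v|_T\in P_{k-2}(T)$ is the unique polynomial with $$(\Delta_w v,\varphi)_T=(v_0,\Delta\varphi)_T-\langle v_b,\nabla\varphi\cdot\mathbf n\rangle_{\partial T}+\langle v_n\,\mathbf n_e\cdot\mathbf n,\varphi\rangle_{\partial T}\qquad\forall\varphi\in P_{k-2}(T).$$ Bilinear form: for $v,w\in V_h$, $$s(v,w)=\sum_{T\in\mathcal T_h}h_T^{-1}\langle\nabla v_0\cdot\mathbf n_e-v_n,\ \nabla w_0\cdot\mathbf n_e-w_n\rangle_{\partial T}+\sum_{T\in\mathcal T_h}h_T^{-3}\langle Q_bv_0-v_b,\ Q_bw_0-w_b\rangle_{\partial T},$$ $$a(v,w)=\sum_{T\in\mathcal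 T_h}(\Delta_wv,\Delta_ww)_T+s(v,w).$$ On $\partial T$, $\nabla v_0$ and $v_0$ denote traces taken from inside $T$. Local solution map: for given $w_b,w_n$ (piecewise polynomials of degree at most $k-1$ on $\mathcal E_h$) and $f$, $w(w_b,w_n,f)=\{w_0(w_b,w_n,f),w_b,w_n\}\in V_h$ is the unique triple with the prescribed $w_b,w_n$ satisfying, on each $T\in\mathcal T_h$, the local system $$a(w(w_b,w_n,f),v)=(f,v_0)\qquad\text{for all } v=\{v_0,0,0\}\in V_h(T).$$ By superposition $w(w_b,w_n,f)=w(w_b,w_n,0)+w(0,0,f)$. *)

theory Defs
  imports "HOL-Analysis.Analysis"
begin

section \<open>Polyhedral geometry\<close>

text \<open>A closed, not necessarily convex, \<open>m\<close>-dimensional polyhedral set with connected relative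
  interior.  It serves for polygons and polyhedra (\<open>m = d\<close>) as well as for edges and flat faces
  (\<open>m = d - 1\<close>).\<close>

definition polyhedral_set :: "int \<Rightarrow> (real^'n) set \<Rightarrow> bool" where
  "polyhedral_set m S \<longleftrightarrow>
     (\<exists>P. finite P \<and> (\<forall>p\<in>P. polytope p \<and> aff_dim p = m) \<and> S = \<Union>P) \<and>
     aff_dim S = m \<and> connected (rel_interior S)"

definition polyhedral_domain :: "(real^'n) set \<Rightarrow> bool" where
  "polyhedral_domain \<Omega> \<longleftrightarrow> polyhedral_set (int CARD('n)) (closure \<Omega>) \<and> \<Omega> = interior (closure \<Omega>)"

text \<open>\<open>(d-1)\<close>-dimensional Lebesgue measure on the affine hull \<open>H\<close> of a flat
  \<open>(d-1)\<close>-dimensional set \<open>e\<close>: by Fubini it is the image, under the orthogonal projection onto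
  \<open>H\<close>, of \<open>d\<close>-dimensional Lebesgue measure on the slab of thickness \<open>1\<close> around \<open>H\<close>.\<close>

definition surface :: "(real^'n) set \<Rightarrow> (real^'n) measure" where
  "surface e = distr (restrict_space lborel {x. infdist x (affine hull e) \<le> 1/2}) borel
                 (closest_point (affine hull e))"

definition unit_normal_to :: "(real^'n) set \<Rightarrow> real^'n \<Rightarrow> bool" where
  "unit_normal_to e \<nu> \<longleftrightarrow> norm \<nu> = 1 \<and> (\<forall>x\<in>e. \<forall>y\<in>e. (x - y) \<bullet> \<nu> = 0)"

definition outward_normal :: "(real^'n) set \<Rightarrow> (real^'n) set \<Rightarrow> real^'n" where
  "outward_normal T e = (THE \<nu>. unit_normal_to e \<nu> \<and>
     (\<forall>x\<in>rel_interior e. \<exists>\<delta>>0. \<forall>t\<in>{0<..<\<delta>}. x + t *\<^sub>R \<nu> \<notin> T \<and> x - t *\<^sub>R \<nu> \<in> T))"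

definition angle_between :: "real^'n \<Rightarrow> real^'n \<Rightarrow> real" where
  "angle_between u v = arccos (u \<bullet> v / (norm u * norm v))"

section \<open>Meshes\<close>

record ('n::finite) mesh =
  cells :: "(real^'n) set set"
  faces :: "(real^'n) set set"
  normal :: "(real^'n) set \<Rightarrow> real^'n"

definition cell_faces :: "('n::finite) mesh \<Rightarrow> (real^'n) set \<Rightarrow> (real^'n) set set" where
  "cell_faces M T = {e \<in> faces M. e \<subseteq> frontier T}"

text \<open>Cells are represented by closed sets.  Hanging nodes are allowed in the usual sense: the
  boundary of a cell may be subdivided into several coplanar faces, so that a face is either
  common to two cells or part of the boundary of the domain.  The field \<open>normal\<close> holds the fixed
  unit normals, whose orientation is arbitrary.\<close>

definition polyhedral_mesh :: "(real^'n) set \<Rightarrow> 'n mesh \<Rightarrow> bool" where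
  "polyhedral_mesh \<Omega> M \<longleftrightarrow>
     finite (cells M) \<and>
     (\<forall>T\<in>cells M. polyhedral_set (int CARD('n)) T) \<and>
     \<Union>(cells M) = closure \<Omega> \<and>
     (\<forall>T\<in>cells M. \<forall>T'\<in>cells M. T \<noteq> T' \<longrightarrow> interior T \<inter> interior T' = {}) \<and>
     finite (faces M) \<and>
     (\<forall>e\<in>faces M. polyhedral_set (int CARD('n) - 1) e) \<and>
     (\<forall>e\<in>faces M. \<exists>T\<in>cells M. e \<in> cell_faces M T) \<and>
     (\<forall>T\<in>cells M. frontier T = \<Union>(cell_faces M T)) \<and>
     (\<forall>e\<in>faces M. \<forall>e'\<in>faces M. e \<noteq> e' \<longrightarrow> rel_interior e \<inter> e' = {}) \<and>
     (\<forall>e\<in>faces M. unit_normal_to e (normal M e))"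

text \<open>The pyramid with base \<open>e\<close> and apex \<open>A\<close> is the cone of segments from \<open>A\<close> to \<open>e\<close> (\<open>e\<close> need
  not be convex).  A simplex is \<open>\<rho>\<^sub>S\<close>-shape-regular if it contains a ball of radius \<open>\<rho>\<^sub>S\<close>
  times its diameter.\<close>

definition shape_regular :: "('n::finite) mesh \<Rightarrow> bool" where
  "shape_regular M \<longleftrightarrow>
     (\<exists>\<rho>\<^sub>v>0. \<exists>\<rho>\<^sub>e>0. \<exists>\<kappa>>0. \<exists>\<sigma>>0. \<exists>\<gamma>>0. \<exists>\<theta>\<^sub>0<pi/2. \<exists>\<rho>\<^sub>S>0. \<exists>N::nat. \<exists>S.
       (\<forall>T\<in>cells M.
          \<rho>\<^sub>v * diameter T ^ CARD('n) \<le> measure lebesgue T \<and>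
          (\<forall>e\<in>cell_faces M T.
             \<rho>\<^sub>e * diameter e ^ (CARD('n) - 1) \<le> measure (surface e) e \<and>
             \<kappa> * diameter T \<le> diameter e \<and>
             (\<exists>A\<in>T. (\<Union>x\<in>e. closed_segment A x) \<subseteq> T \<and>
                \<sigma> * diameter T \<le> infdist A (affine hull e) \<and>
                (\<forall>x\<in>e. angle_between (x - A) (outward_normal T e) \<le> \<theta>\<^sub>0))) \<and>
          int CARD('n) simplex S T \<and> T \<subseteq> S T \<and>
          (\<exists>c. ball c (\<rho>\<^sub>S * diameter (S T)) \<subseteq> S T) \<and>
          diameter (S T) \<le> \<gamma> * diameter T \<and>
          card {T' \<in> cells M. T' \<noteq> T \<and> S T' \<inter> S T \<noteq> {}} \<le> N))"

section \<open>Polynomials, differential operators and inner products\<close>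

text \<open>Since a cell has nonempty interior, \<open>P\<^sub>r(T)\<close> is identified with the space of polynomial
  functions of degree at most \<open>r\<close> on the whole space; values and gradients on the boundary of \<open>T\<close>
  are then automatically the traces from inside \<open>T\<close>.\<close>

definition polys :: "nat \<Rightarrow> (real^'n \<Rightarrow> real) set" where
  "polys r = {p. \<exists>c. p = (\<lambda>x. \<Sum>\<alpha> | (\<Sum>i\<in>UNIV. \<alpha> i) \<le> r. c \<alpha> * (\<Prod>i\<in>UNIV. (x $ i) ^ \<alpha> i))}"

text \<open>\<open>P\<^sub>r(e)\<close>: restrictions of polynomials to \<open>e\<close>, represented by their extensions by zero so that
  equality of functions on \<open>e\<close> is equality in HOL.\<close>

definition face_polys :: "nat \<Rightarrow> (real^'n) set \<Rightarrow> (real^'n \<Rightarrow> real) set" where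
  "face_polys r e = {q. \<exists>p\<in>polys r. q = (\<lambda>x. if x \<in> e then p x else 0)}"

definition grad :: "(real^'n \<Rightarrow> real) \<Rightarrow> real^'n \<Rightarrow> real^'n" where
  "grad p x = (THE D. GDERIV p x :> D)"

definition laplacian :: "(real^'n \<Rightarrow> real) \<Rightarrow> real^'n \<Rightarrow> real" where
  "laplacian p x = (\<Sum>i\<in>UNIV. grad (\<lambda>y. grad p y $ i) x $ i)"

definition inner_cell :: "(real^'n) set \<Rightarrow> (real^'n \<Rightarrow> real) \<Rightarrow> (real^'n \<Rightarrow> real) \<Rightarrow> real" where
  "inner_cell T g h = (LINT x:T|lebesgue. g x * h x)"

definition inner_face :: "(real^'n) set \<Rightarrow> (real^'n \<Rightarrow> real) \<Rightarrow> (real^'n \<Rightarrow> real) \<Rightarrow> real" where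
  "inner_face e g h = (LINT x:e|surface e. g x * h x)"

definition square_integrable :: "(real^'n) set \<Rightarrow> (real^'n \<Rightarrow> real) \<Rightarrow> bool" where
  "square_integrable \<Omega> f \<longleftrightarrow>
     set_borel_measurable lebesgue \<Omega> f \<and> set_integrable lebesgue \<Omega> (\<lambda>x. (f x)\<^sup>2)"

definition L2_proj_face :: "nat \<Rightarrow> (real^'n) set \<Rightarrow> (real^'n \<Rightarrow> real) \<Rightarrow> real^'n \<Rightarrow> real" where
  "L2_proj_face r e g =
     (THE q. q \<in> face_polys r e \<and> (\<forall>p\<in>face_polys r e. inner_face e q p = inner_face e g p))"

section \<open>Weak functions\<close>

text \<open>A weak function \<open>{v\<^sub>0, v\<^sub>b, v\<^sub>n}\<close> is a family of functions indexed by the cells and two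
  families indexed by the faces; membership in \<open>Vh\<close> forces all families to be zero at
  irrelevant indices.\<close>

type_synonym 'n family = "(real^'n) set \<Rightarrow> real^'n \<Rightarrow> real"

datatype ('n::finite) weak_fun = WF (wf0: "'n family") (wfb: "'n family") (wfn: "'n family")

abbreviation zero_family :: "('n::finite) family" where
  "zero_family \<equiv> (\<lambda>_ _. 0)"

definition Vh :: "nat \<Rightarrow> ('n::finite) mesh \<Rightarrow> 'n weak_fun set" where
  "Vh k M = {v.
     (\<forall>T\<in>cells M. wf0 v T \<in> polys k) \<and>
     (\<forall>e\<in>faces M. wfb v e \<in> face_polys (k - 1) e \<and> wfn v e \<in> face_polys (k - 1) e) \<and>
     (\<forall>T. T \<notin> cells M \<longrightarrow> wf0 v T = (\<lambda>_. 0)) \<and>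
     (\<forall>e. e \<notin> faces M \<longrightarrow> wfb v e = (\<lambda>_. 0) \<and> wfn v e = (\<lambda>_. 0))}"

definition Vh0 :: "nat \<Rightarrow> (real^'n) set \<Rightarrow> ('n::finite) mesh \<Rightarrow> 'n weak_fun set" where
  "Vh0 k \<Omega> M = {v \<in> Vh k M. \<forall>e\<in>faces M. e \<subseteq> frontier \<Omega> \<longrightarrow> wfb v e = (\<lambda>_. 0) \<and> wfn v e = (\<lambda>_. 0)}"

definition Vh_loc ::
    "nat \<Rightarrow> (real^'n) set \<Rightarrow> ('n::finite) mesh \<Rightarrow> (real^'n) set \<Rightarrow> 'n weak_fun set" where
  "Vh_loc k \<Omega> M T = {v \<in> Vh0 k \<Omega> M. \<forall>x. x \<notin> T \<longrightarrow>
     (\<forall>T'\<in>cells M. x \<in> T' \<longrightarrow> wf0 v T' x = 0) \<and>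
     (\<forall>e\<in>faces M. x \<in> e \<longrightarrow> wfb v e x = 0 \<and> wfn v e x = 0)}"

section \<open>Bilinear form and Schur complement\<close>

definition weak_laplacian ::
    "nat \<Rightarrow> ('n::finite) mesh \<Rightarrow> 'n weak_fun \<Rightarrow> (real^'n) set \<Rightarrow> real^'n \<Rightarrow> real" where
  "weak_laplacian k M v T = (THE p. p \<in> polys (k - 2) \<and> (\<forall>\<phi>\<in>polys (k - 2).
     inner_cell T p \<phi> =
       inner_cell T (wf0 v T) (laplacian \<phi>)
       - (\<Sum>e\<in>cell_faces M T. inner_face e (wfb v e) (\<lambda>x. grad \<phi> x \<bullet> outward_normal T e))
       + (\<Sum>e\<in>cell_faces M T.
            inner_face e (\<lambda>x. wfn v e x * (normal M e \<bullet> outward_normal T e)) \<phi>)))"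

definition s_form :: "nat \<Rightarrow> ('n::finite) mesh \<Rightarrow> 'n weak_fun \<Rightarrow> 'n weak_fun \<Rightarrow> real" where
  "s_form k M v w =
     (\<Sum>T\<in>cells M. inverse (diameter T) * (\<Sum>e\<in>cell_faces M T.
        inner_face e (\<lambda>x. grad (wf0 v T) x \<bullet> normal M e - wfn v e x)
                     (\<lambda>x. grad (wf0 w T) x \<bullet> normal M e - wfn w e x))) +
     (\<Sum>T\<in>cells M. inverse (diameter T ^ 3) * (\<Sum>e\<in>cell_faces M T.
        inner_face e (\<lambda>x. L2_proj_face (k - 1) e (wf0 v T) x - wfb v e x)
                     (\<lambda>x. L2_proj_face (k - 1) e (wf0 w T) x - wfb w e x)))"

definition a_form :: "nat \<Rightarrow> ('n::finite) mesh \<Rightarrow> 'n weak_fun \<Rightarrow> 'n weak_fun \<Rightarrow> real" where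
  "a_form k M v w =
     (\<Sum>T\<in>cells M. inner_cell T (weak_laplacian k M v T) (weak_laplacian k M w T)) + s_form k M v w"

definition local_solution ::
    "nat \<Rightarrow> (real^'n) set \<Rightarrow> ('n::finite) mesh \<Rightarrow> 'n family \<times> 'n family \<Rightarrow> (real^'n \<Rightarrow> real) \<Rightarrow>
     'n weak_fun" where
  "local_solution k \<Omega> M wbn f = (THE w. w \<in> Vh k M \<and> (wfb w, wfn w) = wbn \<and>
     (\<forall>T\<in>cells M. \<forall>v0. WF v0 zero_family zero_family \<in> Vh_loc k \<Omega> M T \<longrightarrow>
        a_form k M w (WF v0 zero_family zero_family) = (\<Sum>T'\<in>cells M. inner_cell T' f (v0 T'))))"

definition skeleton_space ::
    "nat \<Rightarrow> (real^'n) set \<Rightarrow> ('n::finite) mesh \<Rightarrow> ('n family \<times> 'n family) set" where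
  "skeleton_space k \<Omega> M = {(vb, vn). WF zero_family vb vn \<in> Vh0 k \<Omega> M}"

abbreviation skeleton_fun :: "('n::finite) family \<times> 'n family \<Rightarrow> 'n weak_fun" where
  "skeleton_fun \<mu> \<equiv> WF zero_family (fst \<mu>) (snd \<mu>)"

definition schur_form ::
    "nat \<Rightarrow> (real^'n) set \<Rightarrow> ('n::finite) mesh \<Rightarrow> 'n family \<times> 'n family \<Rightarrow> 'n family \<times> 'n family \<Rightarrow>
     real" where
  "schur_form k \<Omega> M l m = a_form k M (local_solution k \<Omega> M l (\<lambda>_. 0)) (skeleton_fun m)"

definition lin_comb ::
    "real \<Rightarrow> ('n::finite) family \<times> 'n family \<Rightarrow> 'n family \<times> 'n family \<Rightarrow> 'n family \<times> 'n family" where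
  "lin_comb c l m = ((\<lambda>e x. c * fst l e x + fst m e x), (\<lambda>e x. c * snd l e x + snd m e x))"

definition bilinear_form_on ::
    "(('n::finite) family \<times> 'n family) set \<Rightarrow>
     ('n family \<times> 'n family \<Rightarrow> 'n family \<times> 'n family \<Rightarrow> real) \<Rightarrow> bool" where
  "bilinear_form_on L B \<longleftrightarrow> (\<forall>c. \<forall>x\<in>L. \<forall>y\<in>L. lin_comb c x y \<in> L \<and>
     (\<forall>z\<in>L. B (lin_comb c x y) z = c * B x z + B y z \<and> B z (lin_comb c x y) = c * B z x + B z y))"

end

theory Submission
  imports Defs "HOL-Library.Function_Algebras"
begin

text \<open>
  The local problems say that a local solution \<open>w(l)\<close> with zero load is \<open>a\<close>-orthogonal to all
  weak functions \<open>{v\<^sub>0, 0, 0}\<close>.  Hence the test function \<open>{0, m}\<close> in the Schur form may be replaced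
  by the local solution \<open>w(m)\<close>, which has the same skeleton component:
  \<open>B(l, m) = a(w(l), {0, m}) = a(w(l), w(m))\<close> (\<open>schur_form_eq\<close>).  So \<open>B\<close> is the pull-back of \<open>a\<close>
  under the linear map \<open>l \<mapsto> w(l)\<close>; it is symmetric and positive semidefinite because \<open>a\<close> is a sum of
  squares, and it is definite as soon as \<open>a\<close> is definite on \<open>V\<^sub>h\<^sup>0\<close> (\<open>a_form_definite\<close>).  The same
  definiteness makes the local problems uniquely solvable, and linearity in the data is the
  superposition principle that splits off the load \<open>f\<close>.

  For the definiteness let \<open>a(v, v) = 0\<close>.  Then \<open>\<Delta>\<^sub>w v = 0\<close>, and on each face \<open>\<nabla>v\<^sub>0 \<bullet> n\<^sub>e = v\<^sub>n\<close> and
  \<open>Q\<^sub>b v\<^sub>0 = v\<^sub>b\<close>.  Inserting this into the definition of \<open>\<Delta>\<^sub>w\<close> and applying Green's identity twice shows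
  that \<open>v\<^sub>0\<close> is harmonic on each cell (\<open>cell_harmonic\<close>).  Green's identity once more turns the Dirichlet
  energy of \<open>v\<^sub>0\<close>, summed over the cells, into a sum of the terms \<open>\<langle>v\<^sub>b, v\<^sub>n n\<^sub>e \<bullet> n\<rangle>\<close>.  These are
  single-valued up to the sign of the normal, so they cancel between neighbours and vanish on the
  boundary of the domain (\<open>flux_cancellation\<close>); thus \<open>v\<^sub>0\<close> is constant on each cell, and \<open>v\<^sub>n = 0\<close>.
  Finally \<open>|T| = \<Sum>\<^sub>e \<integral>\<^sub>e x\<^sub>i n\<^sub>i\<close>, multiplied by the square of the constant on \<open>T\<close> and summed over the
  cells, cancels in the same way, so the constants are zero (\<open>cell_zero\<close>), and so are their traces
  \<open>v\<^sub>b\<close>.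

  This needs the divergence theorem on polyhedra that are not convex, for the surface measure that is
  defined through slabs (\<open>divergence_theorem\<close>).  It is obtained by differentiating the integral over a
  translated cell.  Along almost every line in the direction of the translation the indicator of the
  cell jumps only where the line crosses a face transversally in its relative interior
  (\<open>crossing_formula\<close>), so the cell and its translate differ by signed skew prisms over the faces.
  The volume of such a prism is related to the surface measure by Fubini's theorem
  (\<open>nn_integral_sweep\<close>).  The geometric input is that near a relative interior point of a face the
  cell fills one half ball, on the same side along the whole face (\<open>outward_normal\<close>), and that the
  outward normals of the cells that share an interior face add up to zero (\<open>sum_outward_normals\<close>).
\<close>

section \<open>Functions as vectors and Riesz representation\<close>

text \<open>Pointwise operations make functions, and with them families and tuples of families of functions,
  vectors, so that spans and subspaces can be used for spaces of polynomials and of weak functions.\<close>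

instantiation "fun" :: (type, real_vector) real_vector
begin
definition scaleR_fun :: "real \<Rightarrow> ('a \<Rightarrow> 'b) \<Rightarrow> 'a \<Rightarrow> 'b" where
  "scaleR_fun c f = (\<lambda>x. c *\<^sub>R f x)"
instance
  by standard (auto simp: scaleR_fun_def fun_eq_iff algebra_simps)
end

lemma scaleR_fun_apply [simp]: "(c *\<^sub>R f) x = c *\<^sub>R f x"
  by (simp add: scaleR_fun_def)

lemma sum_fun_apply: "(\<Sum>i\<in>I. F i) x = (\<Sum>i\<in>I. F i x)"
  by (induction I rule: infinite_finite_induct) auto

text \<open>A symmetric positive semidefinite form on a subspace only: the integrals that define the forms
  below are additive on continuous functions but not on all functions.\<close>

locale psd_form =
  fixes V :: "'a::real_vector set" and B :: "'a \<Rightarrow> 'a \<Rightarrow> real"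
  assumes subspace: "subspace V"
    and add_left: "\<lbrakk>x \<in> V; y \<in> V; z \<in> V\<rbrakk> \<Longrightarrow> B (x + y) z = B x z + B y z"
    and scale_left: "\<lbrakk>x \<in> V; z \<in> V\<rbrakk> \<Longrightarrow> B (c *\<^sub>R x) z = c * B x z"
    and sym: "\<lbrakk>x \<in> V; y \<in> V\<rbrakk> \<Longrightarrow> B x y = B y x"
    and nonneg: "x \<in> V \<Longrightarrow> 0 \<le> B x x"
begin

lemma closed [simp]:
  "0 \<in> V" "\<lbrakk>x \<in> V; y \<in> V\<rbrakk> \<Longrightarrow> x + y \<in> V" "x \<in> V \<Longrightarrow> c *\<^sub>R x \<in> V"
  "\<lbrakk>x \<in> V; y \<in> V\<rbrakk> \<Longrightarrow> x - y \<in> V"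
  using subspace by (auto simp: subspace_def subspace_diff)

lemma add_right: "\<lbrakk>x \<in> V; y \<in> V; z \<in> V\<rbrakk> \<Longrightarrow> B z (x + y) = B z x + B z y"
  by (metis add_left sym closed(2))

lemma scale_right: "\<lbrakk>x \<in> V; z \<in> V\<rbrakk> \<Longrightarrow> B z (c *\<^sub>R x) = c * B z x"
  by (metis scale_left sym closed(3))

lemma diff_left: "\<lbrakk>x \<in> V; y \<in> V; z \<in> V\<rbrakk> \<Longrightarrow> B (x - y) z = B x z - B y z"
  using add_left[of x "-1 *\<^sub>R y" z] scale_left[of y z "-1"] closed(3)[of y "-1"] by simp

lemma diff_right: "\<lbrakk>x \<in> V; y \<in> V; z \<in> V\<rbrakk> \<Longrightarrow> B z (x - y) = B z x - B z y"
  by (metis diff_left sym closed(4))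

lemma zero_left: "z \<in> V \<Longrightarrow> B 0 z = 0"
  using scale_left[of 0 z 0] by simp

text \<open>Gram-Schmidt in disguise: a vector \<open>a\<close> is added to the spanning set by solving for the
  component of \<open>a\<close> that is \<open>B\<close>-orthogonal to the old span.  If that component is degenerate, the
  compatibility assumption on \<open>L\<close> says that the old solution already satisfies the new equation.\<close>

lemma riesz_span:
  assumes "finite S" "S \<subseteq> V"
    and "\<And>x y. \<lbrakk>x \<in> V; y \<in> V\<rbrakk> \<Longrightarrow> L (x + y) = L x + L y"
    and "\<And>c x. x \<in> V \<Longrightarrow> L (c *\<^sub>R x) = c * L x"
    and "\<And>x. \<lbrakk>x \<in> V; B x x = 0\<rbrakk> \<Longrightarrow> L x = 0"
  shows "\<exists>p\<in>span S. \<forall>q\<in>span S. B p q = L q"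
  using assms
proof (induction S arbitrary: L rule: finite_induct)
  case empty
  then have "L 0 = 0" by (metis closed(1) zero_left)
  then show ?case by (auto simp: zero_left)
next
  case (insert a S)
  have sV: "x \<in> V" if "x \<in> span S" for x
    using insert.prems(1) that span_minimal[OF _ subspace, of S] by blast
  have aV: "a \<in> V" using insert.prems(1) by auto
  have ldiff: "L (x - y) = L x - L y" if "x \<in> V" "y \<in> V" for x y
    using insert.prems(2)[of x "-1 *\<^sub>R y"] insert.prems(3)[of y "-1"] closed(3)[of y "-1"] that
    by simp
  obtain p where p: "p \<in> span S" "\<And>q. q \<in> span S \<Longrightarrow> B p q = L q"
    using insert.IH[of L] insert.prems by auto
  have degen: "B x a = 0" if "x \<in> V" "B x x = 0" for x
  proof (rule ccontr)
    assume ne: "B x a \<noteq> 0"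
    \<comment> \<open>With this \<open>t\<close> the value of the form at \<open>a + t x\<close> would be \<open>-1\<close>.\<close>
    define t where "t = - (B a a + 1) / (2 * B x a)"
    have "0 \<le> B (a + t *\<^sub>R x) (a + t *\<^sub>R x)"
      using that aV by (intro nonneg) auto
    also have "\<dots> = B a a + 2 * t * B x a"
      using that aV by (simp add: add_left add_right scale_left scale_right sym[of a x])
    also have "\<dots> = -1" using ne by (simp add: t_def field_simps)
    finally show False by simp
  qed
  obtain u where u: "u \<in> span S" "\<And>q. q \<in> span S \<Longrightarrow> B u q = B a q"
    using insert.IH[of "B a"] insert.prems(1) aV degen
    by (auto simp: add_right scale_right sym[of a])
  define z where "z = a - u"
  have zV: "z \<in> V" using aV sV[OF u(1)] by (simp add: z_def)
  have zorth: "B z q = 0" if "q \<in> span S" for q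
    using u that sV aV by (simp add: z_def diff_left)
  have Bza: "B z a = B z z"
    using zorth[OF u(1)] zV aV sV[OF u(1)] by (simp add: z_def diff_right)
  have mem: "q \<in> span (insert a S) \<Longrightarrow> \<exists>k q'. q' \<in> span S \<and> q = k *\<^sub>R a + q'" for q
    by (metis span_breakdown_eq add.commute diff_add_cancel)
  have "\<exists>\<mu>. B (p + \<mu> *\<^sub>R z) a = L a"
  proof (cases "B z z = 0")
    case False
    then show ?thesis using Bza zV aV sV[OF p(1)]
      by (intro exI[of _ "(L a - B p a) / B z z"]) (simp add: add_left scale_left)
  next
    case True
    then have "L z = 0" using insert.prems(4) zV by auto
    then have "L a = L u" using ldiff aV sV[OF u(1)] by (simp add: z_def)
    moreover have "B p a = B p u"
      using zorth[OF p(1)] sV[OF p(1)] sV[OF u(1)] aV zV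
      by (simp add: z_def diff_left diff_right sym[of p])
    ultimately show ?thesis using p(2)[OF u(1)] by (intro exI[of _ 0]) simp
  qed
  then obtain \<mu> where \<mu>: "B (p + \<mu> *\<^sub>R z) a = L a" by blast
  let ?r = "p + \<mu> *\<^sub>R z"
  have rV: "?r \<in> V" using sV[OF p(1)] zV by auto
  have "?r \<in> span (insert a S)"
    using p(1) u(1) unfolding z_def
    by (intro span_add span_scale span_diff) (auto intro: span_base span_mono[THEN subsetD, of S])
  moreover have "B ?r q = L q" if qi: "q \<in> span (insert a S)" for q
  proof -
    obtain k q' where q: "q' \<in> span S" "q = k *\<^sub>R a + q'" using mem[OF qi] by blast
    have "B ?r q' = L q'"
      using p q(1) zorth sV zV by (simp add: add_left scale_left)
    then show ?thesis
      using q \<mu> aV sV[OF q(1)] rV insert.prems(2,3) by (simp add: add_right scale_right)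
  qed
  ultimately show ?case by blast
qed

end

lemma psd_form_subspace:
  assumes "psd_form V B" "subspace W" "W \<subseteq> V"
  shows "psd_form W B"
proof -
  interpret psd_form V B by fact
  show ?thesis
    using assms(2,3) by unfold_locales (auto simp: subset_iff intro: add_left scale_left sym nonneg)
qed

text \<open>All objects that are introduced by a defining variational equation (projections onto polynomials,
  the weak Laplacian, the local solution) exist and are unique by this lemma.\<close>

lemma riesz_unique:
  assumes "psd_form V B" and V: "V = span S" "finite S"
    and definite: "\<And>x. \<lbrakk>x \<in> V; B x x = 0\<rbrakk> \<Longrightarrow> x = 0"
    and "\<And>x y. \<lbrakk>x \<in> V; y \<in> V\<rbrakk> \<Longrightarrow> L (x + y) = L x + L y"
    and "\<And>c x. x \<in> V \<Longrightarrow> L (c *\<^sub>R x) = c * L x"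
  shows "\<exists>!p. p \<in> V \<and> (\<forall>q\<in>V. B p q = L q)"
proof -
  interpret psd_form V B by fact
  have "L 0 = 0" using assms(6)[of 0 0] by simp
  then have compatible: "L x = 0" if "x \<in> V" "B x x = 0" for x
    using definite[OF that] by simp
  have "S \<subseteq> V" using V by (simp add: span_superset)
  then have "\<exists>p\<in>span S. \<forall>q\<in>span S. B p q = L q"
    by (rule riesz_span[OF V(2) _ assms(5,6) compatible])
  moreover have "p = p'" if "p \<in> V" "\<forall>q\<in>V. B p q = L q" "p' \<in> V" "\<forall>q\<in>V. B p' q = L q" for p p'
  proof -
    have "B (p - p') (p - p') = 0" using that by (simp add: diff_left)
    then have "p - p' = 0" by (intro definite) (use that in auto)
    then show ?thesis by simp
  qed
  ultimately show ?thesis using V(1) by blast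
qed

section \<open>Polynomial functions\<close>

definition monomial :: "('n::finite \<Rightarrow> nat) \<Rightarrow> real^'n \<Rightarrow> real" where
  "monomial \<alpha> x = (\<Prod>i\<in>UNIV. (x $ i) ^ \<alpha> i)"

definition exponents :: "nat \<Rightarrow> ('n::finite \<Rightarrow> nat) set" where
  "exponents r = {\<alpha>. (\<Sum>i\<in>UNIV. \<alpha> i) \<le> r}"

lemma finite_exponents [simp]: "finite (exponents r :: ('n::finite \<Rightarrow> nat) set)"
proof (rule finite_subset)
  have "\<alpha> i \<le> r" if "\<alpha> \<in> exponents r" for \<alpha> :: "'n \<Rightarrow> nat" and i
  proof -
    have "\<alpha> i \<le> (\<Sum>j\<in>UNIV. \<alpha> j)" by (rule member_le_sum) auto
    also have "\<dots> \<le> r" using that by (simp add: exponents_def)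
    finally show ?thesis .
  qed
  then show "exponents r \<subseteq> (UNIV :: 'n set) \<rightarrow>\<^sub>E {..r}" by auto
qed (auto intro: finite_PiE)

lemma polys_expand: "p \<in> polys r \<longleftrightarrow> (\<exists>c. p = (\<lambda>x. \<Sum>\<alpha>\<in>exponents r. c \<alpha> * monomial \<alpha> x))"
  by (simp add: polys_def exponents_def monomial_def)

lemma subspace_polys: "subspace (polys r)"
  unfolding subspace_def
proof (intro conjI ballI allI)
  show "0 \<in> polys r" by (auto simp: polys_expand fun_eq_iff intro!: exI[of _ "\<lambda>_. 0"])
next
  fix p q :: "real^'n \<Rightarrow> real" assume "p \<in> polys r" "q \<in> polys r"
  then obtain c d where "p = (\<lambda>x. \<Sum>\<alpha>\<in>exponents r. c \<alpha> * monomial \<alpha> x)"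
    "q = (\<lambda>x. \<Sum>\<alpha>\<in>exponents r. d \<alpha> * monomial \<alpha> x)" by (auto simp: polys_expand)
  then show "p + q \<in> polys r"
    by (auto simp: polys_expand fun_eq_iff distrib_right sum.distrib intro!: exI[of _ "\<lambda>\<alpha>. c \<alpha> + d \<alpha>"])
next
  fix c and p :: "real^'n \<Rightarrow> real" assume "p \<in> polys r"
  then obtain d where "p = (\<lambda>x. \<Sum>\<alpha>\<in>exponents r. d \<alpha> * monomial \<alpha> x)" by (auto simp: polys_expand)
  then show "c *\<^sub>R p \<in> polys r"
    by (auto simp: polys_expand fun_eq_iff sum_distrib_left mult.assoc intro!: exI[of _ "\<lambda>\<alpha>. c * d \<alpha>"])
qed

lemma monomial_in_polys: "\<alpha> \<in> exponents r \<Longrightarrow> monomial \<alpha> \<in> polys r"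
  unfolding polys_expand
proof (intro exI ext)
  fix x assume "\<alpha> \<in> exponents r"
  moreover have "(if \<beta> = \<alpha> then 1 else 0) * monomial \<beta> x = (if \<beta> = \<alpha> then monomial \<beta> x else 0)" for \<beta>
    by simp
  ultimately show "monomial \<alpha> x = (\<Sum>\<beta>\<in>exponents r. (if \<beta> = \<alpha> then 1 else 0) * monomial \<beta> x)"
    by (simp only: sum.delta finite_exponents if_True)
qed

lemma polys_eq_span: "polys r = span (monomial ` exponents r)"
proof
  show "polys r \<subseteq> span (monomial ` exponents r :: (real^'n \<Rightarrow> real) set)"
  proof
    fix p :: "real^'n \<Rightarrow> real" assume "p \<in> polys r"
    then obtain c where "p = (\<Sum>\<alpha>\<in>exponents r. c \<alpha> *\<^sub>R monomial \<alpha>)"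
      by (auto simp: polys_expand fun_eq_iff sum_fun_apply)
    then show "p \<in> span (monomial ` exponents r)"
      by (simp add: span_sum span_scale span_base)
  qed
  show "span (monomial ` exponents r) \<subseteq> (polys r :: (real^'n \<Rightarrow> real) set)"
    by (intro span_minimal subspace_polys) (auto intro: monomial_in_polys)
qed

lemma polys_mono: "r \<le> s \<Longrightarrow> polys r \<subseteq> polys s"
  unfolding polys_eq_span by (intro span_mono image_mono) (auto simp: exponents_def)

lemma polys_add [intro]: "p \<in> polys r \<Longrightarrow> q \<in> polys r \<Longrightarrow> (\<lambda>x. p x + q x) \<in> polys r"
  using subspace_add[OF subspace_polys, of p r q] by (simp add: plus_fun_def)

lemma polys_scale [intro]: "p \<in> polys r \<Longrightarrow> (\<lambda>x. c * p x) \<in> polys r"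
  using subspace_scale[OF subspace_polys, of p r c] by (simp add: scaleR_fun_def)

lemma polys_const [intro]: "(\<lambda>x. c) \<in> polys r"
proof -
  have "(\<lambda>x. c * monomial (\<lambda>_. 0) x) \<in> polys r"
    by (intro polys_scale monomial_in_polys) (simp add: exponents_def)
  then show ?thesis by (simp add: monomial_def)
qed

lemma polys_sum [intro]:
  assumes "\<And>i. i \<in> I \<Longrightarrow> f i \<in> polys r"
  shows "(\<lambda>x. \<Sum>i\<in>I. f i x) \<in> polys r"
  using assms by (induction I rule: infinite_finite_induct) auto

lemma polys_induct [consumes 1, case_names zero add scale monomial]:
  assumes "p \<in> polys r" "P (\<lambda>_. 0)"
    and "\<And>p q. P p \<Longrightarrow> P q \<Longrightarrow> P (\<lambda>x. p x + q x)"
    and "\<And>c p. P p \<Longrightarrow> P (\<lambda>x. c * p x)"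
    and "\<And>\<alpha>. \<alpha> \<in> exponents r \<Longrightarrow> P (monomial \<alpha>)"
  shows "P p"
proof -
  have "p \<in> span (monomial ` exponents r)" using assms(1) polys_eq_span by blast
  then show ?thesis
  proof (induction rule: span_induct_alt)
    case base
    then show ?case using assms(2) by (simp add: zero_fun_def)
  next
    case (step c m q)
    then show ?case using assms(3)[of "\<lambda>x. c * m x" q] assms(4)[of m c] assms(5)
      by (auto simp: plus_fun_def scaleR_fun_def)
  qed
qed

lemma grad_eq: "GDERIV p x :> D \<Longrightarrow> grad p x = D"
  unfolding grad_def gderiv_def
proof (rule the_equality)
  fix E assume "(p has_derivative (\<lambda>h. h \<bullet> D)) (at x)" "(p has_derivative (\<lambda>h. h \<bullet> E)) (at x)"
  then have "h \<bullet> D = h \<bullet> E" for h using has_derivative_unique by (metis (no_types, lifting))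
  then show "E = D" using vector_eq_rdot[of E D] by (simp add: inner_commute)
qed

lemma GDERIV_monomial:
  "GDERIV (monomial \<alpha>) x :> (\<chi> j. real (\<alpha> j) * monomial (\<alpha>(j := \<alpha> j - 1)) x)"
proof -
  have 1: "((\<lambda>x. (x $ i) ^ \<alpha> i) has_derivative (\<lambda>y. real (\<alpha> i) * y $ i * (x $ i) ^ (\<alpha> i - 1))) (at x)" for i
    by (auto intro!: derivative_eq_intros bounded_linear_imp_has_derivative[OF bounded_linear_vec_nth])
  have 2: "(monomial \<alpha> has_derivative
      (\<lambda>y. \<Sum>i\<in>UNIV. real (\<alpha> i) * y $ i * (x $ i) ^ (\<alpha> i - 1) * (\<Prod>j\<in>UNIV - {i}. (x $ j) ^ \<alpha> j))) (at x)"
    unfolding monomial_def[abs_def] by (rule has_derivative_prod) (rule 1)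
  have 3: "monomial (\<alpha>(i := \<alpha> i - 1)) x = (x $ i) ^ (\<alpha> i - 1) * (\<Prod>j\<in>UNIV - {i}. (x $ j) ^ \<alpha> j)" for i
    unfolding monomial_def by (subst prod.remove[of UNIV i]) auto
  show ?thesis
    unfolding gderiv_def by (rule has_derivative_eq_rhs[OF 2])
      (simp add: fun_eq_iff inner_vec_def 3[simplified] mult_ac)
qed

text \<open>Gradients are defined by a description, so their existence has to be carried along with the
  degree bound in one induction.\<close>

lemma polys_gradient_exists:
  assumes "p \<in> polys r"
  shows "\<exists>G. (\<forall>x. GDERIV p x :> G x) \<and> (\<forall>i. (\<lambda>x. G x $ i) \<in> polys (r - 1))"
  using assms
proof (induction rule: polys_induct)
  case zero
  then show ?case by (intro exI[of _ "\<lambda>_. 0"]) (auto simp: gderiv_def)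
next
  case (add p q)
  then obtain G H where "\<forall>x. GDERIV p x :> G x" "\<forall>i. (\<lambda>x. G x $ i) \<in> polys (r - 1)"
    "\<forall>x. GDERIV q x :> H x" "\<forall>i. (\<lambda>x. H x $ i) \<in> polys (r - 1)" by blast
  then show ?case
    by (intro exI[of _ "\<lambda>x. G x + H x"]) (auto intro: GDERIV_add)
next
  case (scale c p)
  then obtain G where "\<forall>x. GDERIV p x :> G x" "\<forall>i. (\<lambda>x. G x $ i) \<in> polys (r - 1)" by blast
  then show ?case
    using GDERIV_mult[OF GDERIV_const, of p _ _ c]
    by (intro exI[of _ "\<lambda>x. c *\<^sub>R G x"]) auto
next
  case (monomial \<alpha>)
  have "(\<lambda>x. real (\<alpha> i) * monomial (\<alpha>(i := \<alpha> i - 1)) x) \<in> polys (r - 1)" for i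
  proof (cases "\<alpha> i")
    case (Suc m)
    then have "(\<Sum>j\<in>UNIV. (\<alpha>(i := \<alpha> i - 1)) j) + 1 = (\<Sum>j\<in>UNIV. \<alpha> j)"
      by (subst (1 2) sum.remove[of UNIV i]) auto
    then show ?thesis using monomial
      by (intro polys_scale monomial_in_polys) (auto simp: exponents_def)
  qed (simp add: polys_const)
  then show ?case using GDERIV_monomial[of \<alpha>] by (intro exI) auto
qed

lemma polys_GDERIV: "p \<in> polys r \<Longrightarrow> GDERIV p x :> grad p x"
  using polys_gradient_exists[of p r] grad_eq by metis

lemma grad_in_polys: "p \<in> polys r \<Longrightarrow> (\<lambda>x. grad p x $ i) \<in> polys (r - 1)"
proof -
  assume "p \<in> polys r"
  then obtain G where "\<forall>x. GDERIV p x :> G x" "\<forall>i. (\<lambda>x. G x $ i) \<in> polys (r - 1)"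
    using polys_gradient_exists by blast
  moreover from this have "grad p = G" by (auto intro: grad_eq)
  ultimately show ?thesis by auto
qed

lemma grad_inner_in_polys: "p \<in> polys r \<Longrightarrow> (\<lambda>x. grad p x \<bullet> v) \<in> polys (r - 1)"
  unfolding inner_vec_def inner_real_def
  by (subst mult.commute) (intro polys_sum polys_scale grad_in_polys)

lemma laplacian_in_polys: "p \<in> polys r \<Longrightarrow> laplacian p \<in> polys (r - 2)"
proof -
  assume "p \<in> polys r"
  then have "(\<lambda>x. grad (\<lambda>y. grad p y $ i) x $ i) \<in> polys (r - 1 - 1)" for i
    by (intro grad_in_polys)
  then show ?thesis
    unfolding laplacian_def[abs_def] by (auto simp: numeral_2_eq_2)
qed

lemma grad_add:
  assumes "p \<in> polys r" "q \<in> polys s"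
  shows "grad (\<lambda>x. p x + q x) x = grad p x + grad q x"
  by (intro grad_eq GDERIV_add polys_GDERIV[OF assms(1)] polys_GDERIV[OF assms(2)])

lemma grad_scale:
  assumes "p \<in> polys r"
  shows "grad (\<lambda>x. c * p x) x = c *\<^sub>R grad p x"
  using GDERIV_mult[OF GDERIV_const polys_GDERIV[OF assms], of c x] by (intro grad_eq) simp

lemma laplacian_add:
  assumes "p \<in> polys r" "q \<in> polys r"
  shows "laplacian (\<lambda>x. p x + q x) x = laplacian p x + laplacian q x"
proof -
  have "grad (\<lambda>y. grad p y $ i + grad q y $ i) x = grad (\<lambda>y. grad p y $ i) x + grad (\<lambda>y. grad q y $ i) x"
    for i by (rule grad_add[OF grad_in_polys[OF assms(1)] grad_in_polys[OF assms(2)]])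
  then show ?thesis
    unfolding laplacian_def by (simp only: grad_add[OF assms] vector_add_component sum.distrib)
qed

lemma laplacian_scale:
  assumes "p \<in> polys r"
  shows "laplacian (\<lambda>x. c * p x) x = c * laplacian p x"
proof -
  have "grad (\<lambda>y. c * (grad p y $ i)) x = c *\<^sub>R grad (\<lambda>y. grad p y $ i) x"
    for i by (intro grad_scale[OF grad_in_polys[OF assms]])
  then show ?thesis
    unfolding laplacian_def
    by (simp only: grad_scale[OF assms] vector_scaleR_component real_scaleR_def sum_distrib_left)
qed

lemma continuous_polys [intro]: "p \<in> polys r \<Longrightarrow> continuous_on S p"
  unfolding polys_def by (auto intro!: continuous_intros)

lemma continuous_grad [intro]:
  assumes "p \<in> polys r" shows "continuous_on S (grad p)"
proof -
  have "continuous_on S (\<lambda>x. \<chi> i. grad p x $ i)"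
    by (intro continuous_on_vec_lambda continuous_polys[OF grad_in_polys[OF assms]])
  then show ?thesis by simp
qed

text \<open>On every line through a point of the open set the polynomial becomes a univariate polynomial
  with infinitely many zeros.\<close>

lemma polys_zero_on_open:
  assumes "p \<in> polys r" "open U" "U \<noteq> {}" "\<And>x. x \<in> U \<Longrightarrow> p x = 0"
  shows "p = (\<lambda>_. 0)"
proof
  fix y
  obtain x where x: "x \<in> U" using assms(3) by auto
  have lin: "real_polynomial_function (\<lambda>t. (x + t *\<^sub>R (y - x)) $ i)" for i
    using real_polynomial_function.intros(3)[OF real_polynomial_function.intros(2)[of "x $ i"]
        real_polynomial_function.intros(4)[OF real_polynomial_function.intros(1)[OF bounded_linear_ident]
          real_polynomial_function.intros(2)[of "(y - x) $ i"]]] by simp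
  have "real_polynomial_function (\<lambda>t. p (x + t *\<^sub>R (y - x)))"
  proof -
    obtain c where "p = (\<lambda>x. \<Sum>\<alpha>\<in>exponents r. c \<alpha> * monomial \<alpha> x)"
      using assms(1) by (auto simp: polys_expand)
    then show ?thesis unfolding monomial_def
      by (auto intro!: real_polynomial_function_sum real_polynomial_function_prod
          real_polynomial_function_power real_polynomial_function.intros(2,4) lin[simplified])
  qed
  then obtain a n where an: "\<And>t. p (x + t *\<^sub>R (y - x)) = (\<Sum>i\<le>n. a i * t ^ i)"
    using real_polynomial_function_imp_sum by (metis (mono_tags))
  have "continuous_on UNIV (\<lambda>t. x + t *\<^sub>R (y - x))" by (intro continuous_intros)
  then have op: "open ((\<lambda>t. x + t *\<^sub>R (y - x)) -` U)"
    using assms(2) by (simp add: open_vimage)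
  have ne: "0 \<in> (\<lambda>t. x + t *\<^sub>R (y - x)) -` U" using x by simp
  then have "infinite ((\<lambda>t. x + t *\<^sub>R (y - x)) -` U)"
    using op finite_imp_not_open by blast
  moreover have "(\<lambda>t. x + t *\<^sub>R (y - x)) -` U \<subseteq> {t. (\<Sum>i\<le>n. a i * t ^ i) = 0}"
    using assms(4) by (auto simp: an[symmetric])
  ultimately have "infinite {t. (\<Sum>i\<le>n. a i * t ^ i) = 0}" using finite_subset by blast
  then have "\<forall>i\<le>n. a i = 0" using polyfun_rootbound[where c = a] by blast
  then show "p y = 0" using an[of 1] by simp
qed

lemma grad_zero_imp_const:
  assumes "p \<in> polys r" "open U" "U \<noteq> {}" "\<And>x. x \<in> U \<Longrightarrow> grad p x = 0"
  shows "\<exists>c. p = (\<lambda>_. c)"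
proof -
  have "(\<lambda>x. grad p x $ i) = (\<lambda>_. 0)" for i
    using assms by (intro polys_zero_on_open[OF grad_in_polys]) auto
  then have "grad p x = 0" for x by (simp add: vec_eq_iff fun_eq_iff)
  then have "(p has_derivative (\<lambda>h. 0)) (at x)" for x
    using polys_GDERIV[OF assms(1), of x] by (simp add: gderiv_def)
  then obtain c where "\<And>x. x \<in> UNIV \<Longrightarrow> p x = c"
    by (metis has_derivative_zero_constant[of UNIV p] convex_UNIV has_derivative_at_withinI)
  then show ?thesis by auto
qed

section \<open>Polyhedral sets\<close>

lemma polyhedral_set_compact: "polyhedral_set m S \<Longrightarrow> compact S"
  unfolding polyhedral_set_def using compact_Union polytope_imp_compact by metis

lemma polyhedral_set_pieces:
  assumes "polyhedral_set m S" "0 \<le> m"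
  obtains P where "finite P" "S = \<Union>P" "\<And>p. p \<in> P \<Longrightarrow> polytope p \<and> aff_dim p = m"
    "\<And>p. p \<in> P \<Longrightarrow> rel_interior p \<subseteq> rel_interior S"
proof -
  obtain P where P: "finite P" "\<And>p. p \<in> P \<Longrightarrow> polytope p \<and> aff_dim p = m" "S = \<Union>P" "aff_dim S = m"
    using assms(1) unfolding polyhedral_set_def by blast
  have "rel_interior p \<subseteq> rel_interior S" if "p \<in> P" for p
  proof (rule rel_interior_mono)
    show "p \<subseteq> S" using that P by auto
    have "p \<noteq> {}" using P(2)[OF that] assms(2) by auto
    then show "affine hull p = affine hull S"
      using P(2)[OF that] P(4) that P(3)
      by (intro affine_dim_equal) (auto simp: hull_mono Union_upper)
  qed
  then show ?thesis using P that by metis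
qed

text \<open>Each convex piece is the closure of its relative interior, and since all pieces have the same
  affine hull their relative interiors lie in that of the union.\<close>

lemma polyhedral_set_closure:
  assumes "polyhedral_set m S" "0 \<le> m"
  shows "closure (rel_interior S) = S"
proof
  show "closure (rel_interior S) \<subseteq> S"
    using polyhedral_set_compact[OF assms(1)] rel_interior_subset
    by (metis closure_closed closure_mono compact_imp_closed)
  obtain P where P: "S = \<Union>P" "\<And>p. p \<in> P \<Longrightarrow> polytope p \<and> aff_dim p = m"
    "\<And>p. p \<in> P \<Longrightarrow> rel_interior p \<subseteq> rel_interior S"
    using polyhedral_set_pieces[OF assms] by metis
  have "p \<subseteq> closure (rel_interior S)" if "p \<in> P" for p
    using closure_mono[OF P(3)[OF that]] convex_closure_rel_interior[OF polytope_imp_convex, of p]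
      P(2)[OF that] closure_subset[of p] by blast
  then show "S \<subseteq> closure (rel_interior S)" using P by blast
qed

text \<open>A point outside the relative interior of the union is outside the relative interior of every piece
  that contains it, and hence on a facet of that piece.\<close>

lemma polyhedral_set_rel_boundary:
  assumes "polyhedral_set m S" "0 \<le> m"
  obtains A where "finite A" "S - rel_interior S \<subseteq> \<Union>A"
    "\<And>a. a \<in> A \<Longrightarrow> affine a \<and> a \<noteq> {} \<and> aff_dim a = m - 1"
proof -
  obtain P where P: "finite P" "S = \<Union>P" "\<And>p. p \<in> P \<Longrightarrow> polytope p \<and> aff_dim p = m"
    "\<And>p. p \<in> P \<Longrightarrow> rel_interior p \<subseteq> rel_interior S"
    using polyhedral_set_pieces[OF assms] by metis
  define A where "A = (\<Union>p\<in>P. (hull) affine ` {f. f facet_of p})"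
  show ?thesis
  proof
    show "finite A" unfolding A_def using P by (auto intro!: finite_polytope_facets)
    show "S - rel_interior S \<subseteq> \<Union>A"
    proof
      fix x assume x: "x \<in> S - rel_interior S"
      then obtain p where p: "p \<in> P" "x \<in> p" using P by auto
      then have "x \<in> p - rel_interior p" using x P(4) by blast
      then obtain f where "f facet_of p" "x \<in> f"
        using rel_boundary_of_polyhedron[of p] P(3)[OF p(1)] polytope_imp_polyhedron by blast
      then show "x \<in> \<Union>A" unfolding A_def using p(1) by (auto intro: hull_inc)
    qed
    show "affine a \<and> a \<noteq> {} \<and> aff_dim a = m - 1" if "a \<in> A" for a
      using that P(3) unfolding A_def by (auto simp: facet_of_def)
  qed
qed

lemma polyhedral_set_full:
  fixes S :: "(real^'n) set"
  assumes "polyhedral_set (int CARD('n)) S"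
  shows "rel_interior S = interior S" "closure (interior S) = S" "interior S \<noteq> {}"
proof -
  have "aff_dim S = int CARD('n)" using assms by (simp add: polyhedral_set_def)
  then show "rel_interior S = interior S"
    by (intro rel_interior_interior) (simp add: aff_dim_eq_full[symmetric])
  then show "closure (interior S) = S" using polyhedral_set_closure[OF assms] by simp
  moreover have "S \<noteq> {}" using \<open>aff_dim S = int CARD('n)\<close> by auto
  ultimately show "interior S \<noteq> {}" by auto
qed

lemma negligible_affine_lowdim:
  fixes A :: "(real^'n) set"
  assumes "affine A" "aff_dim A < int CARD('n)"
  shows "negligible A"
  using assms aff_dim_nonempty_interior[of A]
  by (auto simp: negligible_convex_interior affine_imp_convex)

lemma negligible_frontier_polyhedral:
  fixes S :: "(real^'n) set"
  assumes "polyhedral_set (int CARD('n)) S"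
  shows "negligible (frontier S)"
proof -
  obtain A where A: "finite A" "S - rel_interior S \<subseteq> \<Union>A"
    "\<And>a. a \<in> A \<Longrightarrow> affine a \<and> a \<noteq> {} \<and> aff_dim a = int CARD('n) - 1"
    using polyhedral_set_rel_boundary[OF assms] by auto
  have "negligible (\<Union>A)" using A by (intro negligible_Union) (auto intro: negligible_affine_lowdim)
  moreover have "frontier S \<subseteq> S - rel_interior S"
    using polyhedral_set_full(1)[OF assms] polyhedral_set_compact[OF assms]
    by (auto simp: frontier_def compact_imp_closed)
  ultimately show ?thesis using A(2) negligible_subset by blast
qed

section \<open>Normals\<close>

text \<open>The affine hull lies in the hyperplane, and both have dimension \<open>d - 1\<close>.\<close>

lemma unit_normal_affine_hull:
  fixes e :: "(real^'n) set"
  assumes "unit_normal_to e \<nu>" "aff_dim e = int CARD('n) - 1" "x \<in> affine hull e"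
  shows "affine hull e = {y. (y - x) \<bullet> \<nu> = 0}"
proof -
  have \<nu>: "\<nu> \<noteq> 0" using assms(1) by (auto simp: unit_normal_to_def)
  have ne: "e \<noteq> {}" using assms(3) by auto
  then obtain z where z: "z \<in> e" by auto
  have sub: "e \<subseteq> {y. \<nu> \<bullet> y = \<nu> \<bullet> z}"
  proof
    fix y assume "y \<in> e"
    then have "(y - z) \<bullet> \<nu> = 0" using assms(1) z unfolding unit_normal_to_def by blast
    then show "y \<in> {y. \<nu> \<bullet> y = \<nu> \<bullet> z}" by (simp add: inner_diff_left inner_diff_right inner_commute)
  qed
  have "affine hull e = {y. \<nu> \<bullet> y = \<nu> \<bullet> z}"
  proof (rule affine_dim_equal)
    show "affine hull e \<subseteq> {y. \<nu> \<bullet> y = \<nu> \<bullet> z}" by (intro hull_minimal sub affine_hyperplane)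
  qed (use assms(2) \<nu> ne in \<open>simp_all add: affine_hyperplane\<close>)
  moreover from this have "\<nu> \<bullet> x = \<nu> \<bullet> z" using assms(3) by auto
  ultimately show ?thesis by (auto simp: inner_diff_left inner_diff_right inner_commute)
qed

lemma unit_normal_exists:
  fixes e :: "(real^'n) set"
  assumes "aff_dim e = int CARD('n) - 1"
  shows "\<exists>\<nu>. unit_normal_to e \<nu>"
proof -
  obtain a b where ab: "a \<noteq> 0" "affine hull e = {x. a \<bullet> x = b}"
    using assms aff_dim_eq_hyperplane[of e] by auto
  have "e \<subseteq> {x. a \<bullet> x = b}" using ab(2) hull_subset by metis
  then have "(x - y) \<bullet> (a /\<^sub>R norm a) = 0" if "x \<in> e" "y \<in> e" for x y
  proof -
    have "a \<bullet> x = b" "a \<bullet> y = b" using that \<open>e \<subseteq> _\<close> by blast+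
    then have "a \<bullet> (x - y) = 0" by (simp add: inner_diff_right)
    then show ?thesis by (simp add: inner_commute)
  qed
  then show ?thesis using ab(1) by (intro exI[of _ "a /\<^sub>R norm a"]) (auto simp: unit_normal_to_def)
qed

text \<open>The component of \<open>\<mu>\<close> orthogonal to \<open>\<nu>\<close> is a direction of the hyperplane, hence also orthogonal
  to \<open>\<mu>\<close>, hence zero.\<close>

lemma unit_normal_unique:
  fixes e :: "(real^'n) set"
  assumes "unit_normal_to e \<nu>" "unit_normal_to e \<mu>" "aff_dim e = int CARD('n) - 1"
  shows "\<mu> = \<nu> \<or> \<mu> = - \<nu>"
proof -
  have "e \<noteq> {}" using assms(3) by (cases "e = {}") auto
  then obtain x where x: "x \<in> affine hull e" by (auto intro: hull_inc)
  define u where "u = \<mu> - (\<mu> \<bullet> \<nu>) *\<^sub>R \<nu>"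
  have nn: "\<nu> \<bullet> \<nu> = 1" "\<mu> \<bullet> \<mu> = 1"
    using assms(1,2) by (auto simp: unit_normal_to_def norm_eq_1)
  have u: "u \<bullet> \<nu> = 0" using nn by (simp add: u_def inner_diff_left)
  then have "x + u \<in> affine hull e"
    using unit_normal_affine_hull[OF assms(1,3) x] by simp
  then have "u \<bullet> \<mu> = 0"
    using unit_normal_affine_hull[OF assms(2,3) x] by simp
  then have "u \<bullet> u = 0" using u by (simp add: u_def inner_diff_right)
  then have eq: "\<mu> = (\<mu> \<bullet> \<nu>) *\<^sub>R \<nu>" by (simp add: u_def)
  then have "(\<mu> \<bullet> \<nu>) * (\<mu> \<bullet> \<nu>) = 1"
    using nn by (metis inner_commute inner_scaleR_left)
  then have "\<mu> \<bullet> \<nu> = 1 \<or> \<mu> \<bullet> \<nu> = -1" by (metis power2_eq_1_iff power2_eq_square)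
  then show ?thesis using eq by (metis scaleR_minus1_left scaleR_one)
qed

text \<open>What a mesh says about a single cell.  Convexity is not available: all statements about the
  position of the cell relative to its faces are local, near relative interior points of the faces.\<close>

locale polyhedral_cell =
  fixes T :: "(real^'n) set" and F :: "(real^'n) set set"
  assumes cell: "polyhedral_set (int CARD('n)) T"
    and finite_faces [simp]: "finite F"
    and face: "e \<in> F \<Longrightarrow> polyhedral_set (int CARD('n) - 1) e"
    and frontier_eq: "frontier T = \<Union>F"
    and faces_disjoint: "\<lbrakk>e \<in> F; e' \<in> F; e \<noteq> e'\<rbrakk> \<Longrightarrow> rel_interior e \<inter> e' = {}"
begin

lemma closed_cell: "closed T" and compact_cell: "compact T"
  using polyhedral_set_compact[OF cell] compact_imp_closed by auto

lemma compact_face: "e \<in> F \<Longrightarrow> compact e"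
  using polyhedral_set_compact[OF face] .

lemma face_subset: "e \<in> F \<Longrightarrow> e \<subseteq> T" "e \<in> F \<Longrightarrow> e \<subseteq> frontier T"
  using frontier_eq frontier_subset_closed[OF closed_cell] by auto

lemma aff_dim_face: "e \<in> F \<Longrightarrow> aff_dim e = int CARD('n) - 1"
  using face by (simp add: polyhedral_set_def)

lemma card_ge: "0 \<le> int CARD('n) - 1"
  using zero_less_card_finite[where 'a = 'n] by linarith

lemma closure_rel_interior_face: "e \<in> F \<Longrightarrow> closure (rel_interior e) = e"
  using polyhedral_set_closure[OF face card_ge] .

lemma rel_interior_face_ne: "e \<in> F \<Longrightarrow> rel_interior e \<noteq> {}"
  using closure_rel_interior_face[of e] aff_dim_face[of e] card_ge by auto

text \<open>Near a relative interior point of \<open>e\<close> the frontier of the cell is a flat disc, because no other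
  face comes near.  Each open half ball is connected and misses the frontier, so it lies inside or
  outside.  Both outside is impossible since the cell is the closure of its interior, both inside
  since the point is a frontier point.\<close>

lemma two_sided_at_face:
  assumes e: "e \<in> F" and x: "x \<in> rel_interior e" and \<nu>: "unit_normal_to e \<nu>"
  shows "\<exists>\<delta>>0. \<exists>\<sigma>\<in>{1, -1}. (\<forall>y\<in>ball x \<delta>. (0 < \<sigma> * ((y - x) \<bullet> \<nu>) \<longrightarrow> y \<notin> T) \<and>
           (\<sigma> * ((y - x) \<bullet> \<nu>) < 0 \<longrightarrow> y \<in> interior T))"
proof -
  have xe: "x \<in> e" using x rel_interior_subset by blast
  have hull: "affine hull e = {y. (y - x) \<bullet> \<nu> = 0}"
    using unit_normal_affine_hull[OF \<nu> aff_dim_face[OF e]] xe hull_inc by metis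
  obtain \<delta>1 where \<delta>1: "\<delta>1 > 0" "ball x \<delta>1 \<inter> affine hull e \<subseteq> e"
    using x by (auto simp: mem_rel_interior_ball)
  have "closed (\<Union>(F - {e}))"
    using compact_face by (intro closed_Union) (auto intro: compact_imp_closed)
  moreover have "x \<notin> \<Union>(F - {e})" using faces_disjoint[OF e] x by auto
  ultimately obtain \<delta>2 where \<delta>2: "\<delta>2 > 0" "ball x \<delta>2 \<inter> \<Union>(F - {e}) = {}"
    by (metis open_Compl open_contains_ball ComplI disjoint_eq_subset_Compl)
  define \<delta> where "\<delta> = min \<delta>1 \<delta>2"
  have \<delta>: "\<delta> > 0" "ball x \<delta> \<inter> affine hull e \<subseteq> e"
    using \<delta>1 \<delta>2 by (auto simp: \<delta>_def)
  have fr: "y \<in> e" if "y \<in> ball x \<delta>" "y \<in> frontier T" for y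
    using that \<delta>2(2) frontier_eq by (auto simp: \<delta>_def)
  let ?H = "\<lambda>s. ball x \<delta> \<inter> {y. 0 < s * ((y - x) \<bullet> \<nu>)}"
  have He: "?H s \<inter> e = {}" for s
    using hull hull_inc[of _ e affine] by fastforce
  have conv: "convex {y. 0 < s * ((y - x) \<bullet> \<nu>)}" and op: "open {y. 0 < s * ((y - x) \<bullet> \<nu>)}" for s
  proof -
    have "{y. 0 < s * ((y - x) \<bullet> \<nu>)} = {y. (s *\<^sub>R \<nu>) \<bullet> y > s * (x \<bullet> \<nu>)}"
      by (auto simp: inner_diff_left inner_diff_right inner_commute right_diff_distrib)
    then show "convex {y. 0 < s * ((y - x) \<bullet> \<nu>)}" "open {y. 0 < s * ((y - x) \<bullet> \<nu>)}"
      using convex_halfspace_gt open_halfspace_gt by metis+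
  qed
  have side: "?H s \<subseteq> T \<or> ?H s \<inter> T = {}" for s
  proof (rule ccontr)
    assume "\<not> ?thesis"
    moreover have "connected (?H s)" by (intro convex_connected convex_Int convex_ball conv)
    ultimately have "?H s \<inter> frontier T \<noteq> {}"
      by (intro connected_Int_frontier) blast+
    then show False using fr He by blast
  qed
  have side_int: "?H s \<subseteq> interior T" if "?H s \<subseteq> T" for s
    using that op by (intro interior_maximal) auto
  have xT: "x \<in> frontier T" using xe face_subset e by blast
  have "\<not> (?H 1 \<inter> T = {} \<and> ?H (-1) \<inter> T = {})"
  proof
    assume *: "?H 1 \<inter> T = {} \<and> ?H (-1) \<inter> T = {}"
    have "x \<in> closure (interior T)"
      using xT polyhedral_set_full(2)[OF cell] closed_cell by (auto simp: frontier_def)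
    then have ne: "ball x \<delta> \<inter> interior T \<noteq> {}"
      using \<delta>(1) by (metis centre_in_ball open_ball closure_iff_nhds_not_empty open_Int_closure_eq_empty
          disjoint_iff)
    have "ball x \<delta> \<inter> interior T \<subseteq> {y. \<nu> \<bullet> y = \<nu> \<bullet> x}"
      using * interior_subset[of T] by (fastforce simp: inner_diff_left inner_diff_right inner_commute)
    then have "ball x \<delta> \<inter> interior T \<subseteq> interior {y. \<nu> \<bullet> y = \<nu> \<bullet> x}"
      by (intro interior_maximal) auto
    moreover have "interior {y. \<nu> \<bullet> y = \<nu> \<bullet> x} = {}"
      using \<nu> by (intro interior_hyperplane) (auto simp: unit_normal_to_def)
    ultimately show False using ne by blast
  qed
  moreover have "\<not> (?H 1 \<subseteq> T \<and> ?H (-1) \<subseteq> T)"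
  proof
    assume *: "?H 1 \<subseteq> T \<and> ?H (-1) \<subseteq> T"
    have "ball x \<delta> \<subseteq> T"
    proof
      fix y assume y: "y \<in> ball x \<delta>"
      consider "(y - x) \<bullet> \<nu> = 0" | "(y - x) \<bullet> \<nu> > 0" | "(y - x) \<bullet> \<nu> < 0" by linarith
      then show "y \<in> T"
      proof cases
        case 1
        then have "y \<in> e" using \<delta>(2) y hull by auto
        then show ?thesis using face_subset[OF e] by auto
      qed (use * y in auto)
    qed
    then have "x \<in> interior T" using \<delta>(1) by (meson centre_in_ball interior_maximal open_ball subsetD)
    then show False using xT by (auto simp: frontier_def)
  qed
  ultimately consider "?H 1 \<inter> T = {}" "?H (-1) \<subseteq> interior T" | "?H (-1) \<inter> T = {}" "?H 1 \<subseteq> interior T"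
    using side side_int by meson
  then show ?thesis
  proof cases
    case 1
    then show ?thesis using \<delta>(1) by (intro exI[of _ \<delta>] conjI bexI[of _ 1]) auto
  next
    case 2
    then show ?thesis using \<delta>(1) by (intro exI[of _ \<delta>] conjI bexI[of _ "-1"]) auto
  qed
qed

text \<open>The first notion is the condition in the definition of the outward normal; the second is the
  stronger information that the geometry provides and that the line argument below uses.\<close>

definition outward_at :: "(real^'n) \<Rightarrow> (real^'n) \<Rightarrow> bool" where
  "outward_at \<nu> x \<longleftrightarrow> (\<exists>\<delta>>0. \<forall>t\<in>{0<..<\<delta>}. x + t *\<^sub>R \<nu> \<notin> T \<and> x - t *\<^sub>R \<nu> \<in> T)"

definition half_ball_at :: "(real^'n) \<Rightarrow> (real^'n) \<Rightarrow> bool" where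
  "half_ball_at \<nu> x \<longleftrightarrow> (\<exists>\<delta>>0. \<forall>y\<in>ball x \<delta>. (0 < (y - x) \<bullet> \<nu> \<longrightarrow> y \<notin> T) \<and>
     ((y - x) \<bullet> \<nu> < 0 \<longrightarrow> y \<in> interior T))"

lemma half_ball_or:
  assumes e: "e \<in> F" and x: "x \<in> rel_interior e" and \<nu>: "unit_normal_to e \<nu>"
  shows "half_ball_at \<nu> x \<or> half_ball_at (-\<nu>) x"
  using two_sided_at_face[OF assms] unfolding half_ball_at_def by (auto simp: algebra_simps)

lemma half_ball_imp_outward:
  assumes "half_ball_at \<nu> x" "norm \<nu> = 1"
  shows "outward_at \<nu> x"
proof -
  obtain \<delta> where \<delta>: "\<delta> > 0" "\<And>y. y \<in> ball x \<delta> \<Longrightarrow> 0 < (y - x) \<bullet> \<nu> \<Longrightarrow> y \<notin> T"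
    "\<And>y. y \<in> ball x \<delta> \<Longrightarrow> (y - x) \<bullet> \<nu> < 0 \<Longrightarrow> y \<in> interior T"
    using assms(1) unfolding half_ball_at_def by blast
  have 1: "\<nu> \<bullet> \<nu> = 1" using assms(2) by (simp add: norm_eq_1)
  have "x + t *\<^sub>R \<nu> \<notin> T \<and> x - t *\<^sub>R \<nu> \<in> T" if "t \<in> {0<..<\<delta>}" for t
    using \<delta>(2)[of "x + t *\<^sub>R \<nu>"] \<delta>(3)[of "x - t *\<^sub>R \<nu>"] that 1 assms(2) interior_subset[of T]
    by (auto simp: dist_norm)
  then show ?thesis using \<delta>(1) unfolding outward_at_def by blast
qed

lemma outward_at_antisym:
  assumes "outward_at \<nu> x" "outward_at (-\<nu>) x"
  shows False
proof -
  obtain \<delta> \<delta>' where "\<delta> > 0" "\<delta>' > 0" "\<And>t. t \<in> {0<..<\<delta>} \<Longrightarrow> x + t *\<^sub>R \<nu> \<notin> T"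
    "\<And>t. t \<in> {0<..<\<delta>'} \<Longrightarrow> x + t *\<^sub>R \<nu> \<in> T"
    using assms unfolding outward_at_def by auto
  then show False
    using dense[of 0 "min \<delta> \<delta>'"] by auto
qed

text \<open>The side of a face on which the cell lies is locally constant along the relative interior of
  the face, hence constant because that set is connected.\<close>

lemma outward_normal_exists:
  assumes e: "e \<in> F"
  shows "\<exists>\<nu>. unit_normal_to e \<nu> \<and> (\<forall>x\<in>rel_interior e. half_ball_at \<nu> x)"
proof -
  obtain \<nu> where \<nu>: "unit_normal_to e \<nu>" using unit_normal_exists[OF aff_dim_face[OF e]] by blast
  then have n1: "norm \<nu> = 1" and m: "unit_normal_to e (-\<nu>)" by (auto simp: unit_normal_to_def)
  have dich: "half_ball_at (-\<nu>) x \<longleftrightarrow> \<not> half_ball_at \<nu> x" if "x \<in> rel_interior e" for x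
    using half_ball_or[OF e that \<nu>] half_ball_imp_outward[of \<nu> x] half_ball_imp_outward[of "-\<nu>" x]
      outward_at_antisym n1 by auto
  have spread: "\<exists>\<delta>>0. \<forall>x'\<in>ball x \<delta> \<inter> e. half_ball_at \<mu> x'"
    if hb: "half_ball_at \<mu> x" and "x \<in> rel_interior e" "unit_normal_to e \<mu>" for x \<mu>
  proof -
    obtain \<delta> where \<delta>: "\<delta> > 0" "\<And>y. y \<in> ball x \<delta> \<Longrightarrow> 0 < (y - x) \<bullet> \<mu> \<Longrightarrow> y \<notin> T"
      "\<And>y. y \<in> ball x \<delta> \<Longrightarrow> (y - x) \<bullet> \<mu> < 0 \<Longrightarrow> y \<in> interior T"
      using hb unfolding half_ball_at_def by blast
    have "half_ball_at \<mu> x'" if x': "x' \<in> ball x (\<delta>/2) \<inter> e" for x'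
      unfolding half_ball_at_def
    proof (intro exI[of _ "\<delta>/2"] conjI ballI)
      fix y assume "y \<in> ball x' (\<delta>/2)"
      then have y: "y \<in> ball x \<delta>" using x' dist_triangle[of x y x'] by auto
      have "x \<in> e" using \<open>x \<in> rel_interior e\<close> rel_interior_subset by blast
      then have "(x - x') \<bullet> \<mu> = 0" using x' \<open>unit_normal_to e \<mu>\<close> by (auto simp: unit_normal_to_def)
      then have "(y - x') \<bullet> \<mu> = (y - x) \<bullet> \<mu>" by (simp add: inner_diff_left)
      then show "(0 < (y - x') \<bullet> \<mu> \<longrightarrow> y \<notin> T)" "((y - x') \<bullet> \<mu> < 0 \<longrightarrow> y \<in> interior T)"
        using \<delta> y by auto
    qed (use \<delta> in auto)
    then show ?thesis using \<delta>(1) by (intro exI[of _ "\<delta>/2"]) auto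
  qed
  have loc: "\<forall>x\<in>rel_interior e. eventually (\<lambda>x'. half_ball_at \<nu> x = half_ball_at \<nu> x') (at x within rel_interior e)"
  proof
    fix x assume x: "x \<in> rel_interior e"
    obtain \<mu> where \<mu>: "\<mu> = \<nu> \<or> \<mu> = -\<nu>" "half_ball_at \<mu> x" "unit_normal_to e \<mu>"
      using half_ball_or[OF e x \<nu>] \<nu> m by blast
    obtain \<delta> where \<delta>: "\<delta> > 0" "\<forall>x'\<in>ball x \<delta> \<inter> e. half_ball_at \<mu> x'"
      using spread[OF \<mu>(2) x \<mu>(3)] by blast
    have "half_ball_at \<nu> x = half_ball_at \<nu> x'" if "x' \<in> rel_interior e" "dist x' x < \<delta>" for x'
      using \<delta>(2) that \<mu> dich[OF x] dich[OF that(1)] rel_interior_subset[of e] by (auto simp: dist_commute)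
    then show "eventually (\<lambda>x'. half_ball_at \<nu> x = half_ball_at \<nu> x') (at x within rel_interior e)"
      unfolding eventually_at using \<delta>(1) by blast
  qed
  have "connected (rel_interior e)" using face[OF e] by (simp add: polyhedral_set_def)
  then have "half_ball_at \<nu> x = half_ball_at \<nu> x'" if "x \<in> rel_interior e" "x' \<in> rel_interior e" for x x'
    using connected_local_const[OF _ that loc] by blast
  then have "(\<forall>x\<in>rel_interior e. half_ball_at \<nu> x) \<or> (\<forall>x\<in>rel_interior e. half_ball_at (-\<nu>) x)"
    using dich by blast
  then show ?thesis using \<nu> m by blast
qed

lemma outward_normal:
  assumes e: "e \<in> F"
  shows "unit_normal_to e (outward_normal T e)"
    and "x \<in> rel_interior e \<Longrightarrow> half_ball_at (outward_normal T e) x"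
proof -
  obtain \<nu> where \<nu>: "unit_normal_to e \<nu>" "\<And>x. x \<in> rel_interior e \<Longrightarrow> half_ball_at \<nu> x"
    using outward_normal_exists[OF e] by blast
  obtain x0 where x0: "x0 \<in> rel_interior e" using rel_interior_face_ne[OF e] by blast
  have "outward_normal T e = (THE \<nu>. unit_normal_to e \<nu> \<and> (\<forall>x\<in>rel_interior e. outward_at \<nu> x))"
    by (simp add: outward_normal_def outward_at_def)
  also have "\<dots> = \<nu>"
  proof (rule the_equality)
    show "unit_normal_to e \<nu> \<and> (\<forall>x\<in>rel_interior e. outward_at \<nu> x)"
      using \<nu> half_ball_imp_outward by (auto simp: unit_normal_to_def)
    then show "\<mu> = \<nu>" if "unit_normal_to e \<mu> \<and> (\<forall>x\<in>rel_interior e. outward_at \<mu> x)" for \<mu>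
      using that x0 unit_normal_unique[OF \<nu>(1) _ aff_dim_face[OF e], of \<mu>] outward_at_antisym by blast
  qed
  finally show "unit_normal_to e (outward_normal T e)"
    "x \<in> rel_interior e \<Longrightarrow> half_ball_at (outward_normal T e) x"
    using \<nu> by auto
qed

end

section \<open>Meshes\<close>

lemma mesh_cell:
  assumes "polyhedral_mesh \<Omega> M" "T \<in> cells M"
  shows "polyhedral_cell T (cell_faces M T)"
  using assms unfolding polyhedral_mesh_def polyhedral_cell_def cell_faces_def by auto

lemma outward_normal_eq_normal:
  assumes M: "polyhedral_mesh \<Omega> M" and "T \<in> cells M" "e \<in> cell_faces M T"
  shows "outward_normal T e = (normal M e \<bullet> outward_normal T e) *\<^sub>R normal M e"
proof -
  interpret polyhedral_cell T "cell_faces M T" using mesh_cell assms by blast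
  have n: "unit_normal_to e (normal M e)"
    using assms by (auto simp: polyhedral_mesh_def cell_faces_def)
  then have "normal M e \<bullet> normal M e = 1" by (simp add: unit_normal_to_def norm_eq_1)
  then show ?thesis
    using unit_normal_unique[OF n outward_normal(1)[OF assms(3)] aff_dim_face[OF assms(3)]] by auto
qed

lemma eventually_on_ray:
  fixes x u :: "'a::real_normed_vector"
  assumes "open A" "x \<in> A"
  shows "\<forall>\<^sub>F t in at_right 0. x + t *\<^sub>R u \<in> A"
proof -
  have "((\<lambda>t. x + t *\<^sub>R u) \<longlongrightarrow> x + 0 *\<^sub>R u) (at_right 0)" by (intro tendsto_intros)
  then show ?thesis using assms by (intro topological_tendstoD) auto
qed

text \<open>Choose a relative interior point of the face that lies in the domain.  A point slightly
  displaced from it to either side lies in the interior of exactly one of the cells that have this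
  face, and the outward normals record the difference of the two counts.\<close>

lemma sum_outward_normals:
  assumes \<Omega>: "polyhedral_domain \<Omega>" and M: "polyhedral_mesh \<Omega> M"
    and e: "e \<in> faces M" and nb: "\<not> e \<subseteq> frontier \<Omega>"
  shows "(\<Sum>T | T \<in> cells M \<and> e \<in> cell_faces M T. outward_normal T e) = 0"
proof -
  define C where "C = {T \<in> cells M. e \<in> cell_faces M T}"
  define \<nu> where "\<nu> = normal M e"
  have \<nu>: "unit_normal_to e \<nu>" using M e by (auto simp: polyhedral_mesh_def \<nu>_def)
  then have \<nu>1: "norm \<nu> = 1" "\<nu> \<bullet> \<nu> = 1" by (auto simp: unit_normal_to_def norm_eq_1)
  have fin: "finite (cells M)" using M by (simp add: polyhedral_mesh_def)
  then have finC: "finite C" by (simp add: C_def)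
  have cell: "polyhedral_cell T (cell_faces M T)" if "T \<in> cells M" for T
    using mesh_cell[OF M that] .
  have closed: "closed T" if "T \<in> cells M" for T
    using polyhedral_cell.closed_cell[OF cell[OF that]] .
  obtain T0 where T0: "T0 \<in> cells M" "e \<in> cell_faces M T0"
    using M e by (auto simp: polyhedral_mesh_def)
  have op: "open \<Omega>" using \<Omega> by (metis open_interior polyhedral_domain_def)
  have "\<not> rel_interior e \<subseteq> frontier \<Omega>"
    using nb closure_minimal[of "rel_interior e" "frontier \<Omega>"]
      polyhedral_cell.closure_rel_interior_face[OF cell[OF T0(1)] T0(2)] by auto
  then obtain x where x: "x \<in> rel_interior e" "x \<notin> frontier \<Omega>" by blast
  then have xe: "x \<in> e" using rel_interior_subset by blast
  have "x \<in> T0" using polyhedral_cell.face_subset[OF cell[OF T0(1)] T0(2)] xe by blast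
  then have "x \<in> closure \<Omega>" using M T0 by (auto simp: polyhedral_mesh_def)
  then have x\<Omega>: "x \<in> \<Omega>" using x(2) op by (auto simp: frontier_def interior_open)
  \<comment> \<open>Otherwise the point would be interior to one cell and a limit of interior points of another, or
    it would lie on a second face.\<close>
  have inC: "T \<in> C" if "T \<in> cells M" "x \<in> T" for T
  proof -
    interpret T: polyhedral_cell T "cell_faces M T" using cell that by blast
    interpret T0: polyhedral_cell T0 "cell_faces M T0" using cell T0 by blast
    have "x \<notin> interior T"
    proof
      assume xi: "x \<in> interior T"
      have xfr: "x \<in> frontier T0" using T0.face_subset T0(2) xe by blast
      then have "T \<noteq> T0" using xi by (auto simp: frontier_def)
      then have "interior T \<inter> interior T0 = {}" using M that T0 by (auto simp: polyhedral_mesh_def)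
      moreover have "x \<in> closure (interior T0)"
        using xfr polyhedral_set_full(2)[OF T0.cell] T0.closed_cell by (auto simp: frontier_def)
      ultimately show False using xi open_Int_closure_eq_empty[OF open_interior] by blast
    qed
    then have "x \<in> frontier T" using that closure_subset by (auto simp: frontier_def)
    then obtain e' where e': "e' \<in> cell_faces M T" "x \<in> e'" using T.frontier_eq by auto
    then have "e' \<in> faces M" by (simp add: cell_faces_def)
    moreover have "\<forall>e\<in>faces M. \<forall>e'\<in>faces M. e \<noteq> e' \<longrightarrow> rel_interior e \<inter> e' = {}"
      using M unfolding polyhedral_mesh_def by blast
    ultimately have "e' = e" using e x(1) e'(2) by blast
    then show ?thesis using e' that by (simp add: C_def)
  qed
  have near: "\<forall>\<^sub>F t in at_right 0. \<forall>s\<in>{1, -1}. (x + t *\<^sub>R (s *\<^sub>R \<nu>) \<in> T \<longrightarrow> x + t *\<^sub>R (s *\<^sub>R \<nu>) \<in> interior T) \<and>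
      of_bool (x + t *\<^sub>R (s *\<^sub>R \<nu>) \<in> interior T) = (1 - s * (\<nu> \<bullet> outward_normal T e)) / 2" if TC: "T \<in> C" for T
  proof -
    interpret polyhedral_cell T "cell_faces M T" using cell TC by (auto simp: C_def)
    have eT: "e \<in> cell_faces M T" using TC by (simp add: C_def)
    obtain \<delta> where \<delta>: "\<delta> > 0" "\<And>y. y \<in> ball x \<delta> \<Longrightarrow> 0 < (y - x) \<bullet> outward_normal T e \<Longrightarrow> y \<notin> T"
      "\<And>y. y \<in> ball x \<delta> \<Longrightarrow> (y - x) \<bullet> outward_normal T e < 0 \<Longrightarrow> y \<in> interior T"
      using outward_normal(2)[OF eT x(1)] unfolding half_ball_at_def by blast
    have n: "outward_normal T e = \<nu> \<or> outward_normal T e = -\<nu>"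
      by (rule unit_normal_unique[OF \<nu> outward_normal(1)[OF eT] aff_dim_face[OF eT]])
    have "\<forall>\<^sub>F t in at_right 0. x + t *\<^sub>R (s *\<^sub>R \<nu>) \<in> ball x \<delta>" for s
      using \<delta>(1) by (intro eventually_on_ray) auto
    then have "\<forall>\<^sub>F t in at_right 0. \<forall>s\<in>{1, -1}. x + t *\<^sub>R (s *\<^sub>R \<nu>) \<in> ball x \<delta>"
      by (intro eventually_ball_finite) auto
    moreover have "\<forall>\<^sub>F t in at_right 0. 0 < (t::real)" by (rule eventually_at_right_less)
    ultimately show ?thesis
    proof eventually_elim
      case (elim t)
      show ?case
      proof
        fix s :: real assume s: "s \<in> {1, -1}"
        let ?y = "x + t *\<^sub>R (s *\<^sub>R \<nu>)"
        have "(?y - x) \<bullet> outward_normal T e = t \<or> (?y - x) \<bullet> outward_normal T e = - t" using s n \<nu>1 by auto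
        then show "(?y \<in> T \<longrightarrow> ?y \<in> interior T) \<and>
            of_bool (?y \<in> interior T) = (1 - s * (\<nu> \<bullet> outward_normal T e)) / 2"
          using \<delta>(2,3)[of ?y] elim s n \<nu>1 interior_subset[of T] by auto
      qed
    qed
  qed
  have far: "\<forall>\<^sub>F t in at_right 0. \<forall>s\<in>{1, -1}. x + t *\<^sub>R (s *\<^sub>R \<nu>) \<in> \<Omega> - \<Union>{T \<in> cells M. x \<notin> T}"
    using closed fin op x\<Omega> by (intro eventually_ball_finite ballI eventually_on_ray open_Diff closed_Union) auto
  have "\<forall>\<^sub>F t in at_right 0. \<forall>T\<in>C. \<forall>s\<in>{1, -1}. (x + t *\<^sub>R (s *\<^sub>R \<nu>) \<in> T \<longrightarrow> x + t *\<^sub>R (s *\<^sub>R \<nu>) \<in> interior T) \<and>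
      of_bool (x + t *\<^sub>R (s *\<^sub>R \<nu>) \<in> interior T) = (1 - s * (\<nu> \<bullet> outward_normal T e)) / 2"
    using near finC by (intro eventually_ball_finite) auto
  then obtain t where t: "\<forall>s\<in>{1, -1}. x + t *\<^sub>R (s *\<^sub>R \<nu>) \<in> \<Omega> - \<Union>{T \<in> cells M. x \<notin> T}"
    "\<forall>T\<in>C. \<forall>s\<in>{1, -1}. (x + t *\<^sub>R (s *\<^sub>R \<nu>) \<in> T \<longrightarrow> x + t *\<^sub>R (s *\<^sub>R \<nu>) \<in> interior T) \<and>
      of_bool (x + t *\<^sub>R (s *\<^sub>R \<nu>) \<in> interior T) = (1 - s * (\<nu> \<bullet> outward_normal T e)) / 2"
    using eventually_happens'[OF trivial_limit_at_right_real eventually_conj[OF far]] by blast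
  \<comment> \<open>The two displaced points are \<open>y 1\<close> and \<open>y (-1)\<close>.\<close>
  define y where "y s = x + t *\<^sub>R (s *\<^sub>R \<nu>)" for s
  have y: "y s \<in> \<Omega> - \<Union>{T \<in> cells M. x \<notin> T}" "T \<in> C \<Longrightarrow> y s \<in> T \<Longrightarrow> y s \<in> interior T"
    "T \<in> C \<Longrightarrow> of_bool (y s \<in> interior T) = (1 - s * (\<nu> \<bullet> outward_normal T e)) / 2"
    if "s \<in> {1, -1}" for s T
    using t that unfolding y_def by blast+
  have one: "(\<Sum>T\<in>C. of_bool (y s \<in> interior T)) = (1::real)" if s: "s \<in> {1, -1}" for s
  proof -
    have "y s \<in> closure \<Omega>" using y(1)[OF s] closure_subset by blast
    moreover have "\<Union>(cells M) = closure \<Omega>" using M by (simp add: polyhedral_mesh_def)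
    ultimately obtain T where T: "T \<in> cells M" "y s \<in> T" by blast
    then have TC: "T \<in> C" using inC y(1)[OF s] by blast
    have "y s \<in> interior T' \<longleftrightarrow> T' = T" if "T' \<in> C" for T'
    proof -
      have "T' \<noteq> T \<Longrightarrow> interior T' \<inter> interior T = {}"
        using M T(1) that by (auto simp: polyhedral_mesh_def C_def)
      then show ?thesis using y(2)[OF s TC T(2)] by blast
    qed
    then have "(\<Sum>T'\<in>C. of_bool (y s \<in> interior T')) = (\<Sum>T'\<in>C. if T' = T then 1 else (0::real))"
      by (intro sum.cong) auto
    then show ?thesis using TC finC by simp
  qed
  have "outward_normal T e = (of_bool (y (-1) \<in> interior T) - of_bool (y 1 \<in> interior T)) *\<^sub>R \<nu>"
    if "T \<in> C" for T
  proof -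
    have c: "of_bool (y (-1) \<in> interior T) - of_bool (y 1 \<in> interior T) = \<nu> \<bullet> outward_normal T e"
      using that by (subst (1 2) y(3)) (auto simp: field_simps)
    show ?thesis
      unfolding c \<nu>_def by (rule outward_normal_eq_normal[OF M]) (use that in \<open>auto simp: C_def\<close>)
  qed
  then have "(\<Sum>T\<in>C. outward_normal T e) = (\<Sum>T\<in>C. of_bool (y (-1) \<in> interior T) - of_bool (y 1 \<in> interior T)) *\<^sub>R \<nu>"
    by (simp add: scaleR_sum_left)
  also have "\<dots> = 0" using one[of 1] one[of "-1"] by (simp add: sum_subtractf)
  finally show ?thesis by (simp add: C_def)
qed

section \<open>Surface measure\<close>

text \<open>Coordinates relative to the hyperplane through \<open>a\<close> with unit normal \<open>\<nu>\<close>, and the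
  projection onto it along a transversal direction \<open>w\<close>.\<close>

definition height :: "real^'n \<Rightarrow> real^'n \<Rightarrow> real^'n \<Rightarrow> real" where
  "height a \<nu> x = (x - a) \<bullet> \<nu>"

definition skew :: "real^'n \<Rightarrow> real^'n \<Rightarrow> real^'n \<Rightarrow> real^'n \<Rightarrow> real^'n" where
  "skew a \<nu> w x = x - height a \<nu> x *\<^sub>R w"

lemma height_measurable [measurable]: "height a \<nu> \<in> borel_measurable borel"
  unfolding height_def by measurable

lemma skew_measurable [measurable]: "skew a \<nu> w \<in> borel_measurable borel"
  unfolding skew_def by measurable

lemma height_translate: "height a \<nu> (x + z) = height a \<nu> x + z \<bullet> \<nu>"
  by (simp add: height_def inner_diff_left inner_add_left)

lemma skew_translate: "skew a \<nu> w (x + z) = skew a \<nu> w x + (z - (z \<bullet> \<nu>) *\<^sub>R w)"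
  by (simp add: skew_def height_translate algebra_simps)

lemma height_skew: "w \<bullet> \<nu> = 1 \<Longrightarrow> height a \<nu> (skew a \<nu> w x) = 0"
  by (simp add: skew_def height_def inner_diff_left)

lemma nn_integral_lborel_translate:
  fixes f :: "'a::euclidean_space \<Rightarrow> ennreal"
  assumes [measurable]: "f \<in> borel_measurable borel"
  shows "(\<integral>\<^sup>+x. f (x + c) \<partial>lborel) = (\<integral>\<^sup>+x. f x \<partial>lborel)"
  by (subst (2) lborel_distr_plus[symmetric, of c]) (simp add: nn_integral_distr add.commute)

lemma nn_integral_lborel_swap:
  fixes f :: "'a::euclidean_space \<Rightarrow> 'b::euclidean_space \<Rightarrow> ennreal"
  assumes [measurable]: "case_prod f \<in> borel_measurable (borel \<Otimes>\<^sub>M borel)"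
  shows "(\<integral>\<^sup>+x. \<integral>\<^sup>+y. f x y \<partial>lborel \<partial>lborel) = (\<integral>\<^sup>+y. \<integral>\<^sup>+x. f x y \<partial>lborel \<partial>lborel)"
  by (rule lborel_pair.Fubini') measurable

text \<open>The quarter turn \<open>(\<xi>, r) \<mapsto> (r, -\<xi>)\<close> of the height and an auxiliary real variable is a composition
  of three shears, and a shear is a family of translations; so it preserves the integral by
  Fubini's theorem and translation invariance, for every transversal direction.\<close>

lemma quarter_turn:
  fixes w \<nu> a :: "real^'n"
  assumes w: "w \<bullet> \<nu> = 1"
    and [measurable]: "(\<lambda>(p, \<xi>, r). \<Phi> p \<xi> r) \<in> borel_measurable (borel \<Otimes>\<^sub>M borel \<Otimes>\<^sub>M borel)"
  shows "(\<integral>\<^sup>+x. \<integral>\<^sup>+r. \<Phi> (skew a \<nu> w x) (height a \<nu> x) r \<partial>lborel \<partial>lborel) =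
         (\<integral>\<^sup>+x. \<integral>\<^sup>+r. \<Phi> (skew a \<nu> w x) r (- height a \<nu> x) \<partial>lborel \<partial>lborel)"
proof -
  define J :: "((real^'n) \<times> real \<times> real \<Rightarrow> ennreal) \<Rightarrow> ennreal" where
    "J \<psi> = (\<integral>\<^sup>+x. \<integral>\<^sup>+r. \<psi> (skew a \<nu> w x, height a \<nu> x, r) \<partial>lborel \<partial>lborel)" for \<psi>
  have shear_height: "J (\<lambda>(p, \<xi>, r). \<psi> (p, \<xi> + r, r)) = J \<psi>"
    if [measurable]: "\<psi> \<in> borel_measurable (borel \<Otimes>\<^sub>M borel \<Otimes>\<^sub>M borel)" for \<psi>
  proof -
    have "J (\<lambda>(p, \<xi>, r). \<psi> (p, \<xi> + r, r)) =
        (\<integral>\<^sup>+r. \<integral>\<^sup>+x. \<psi> (skew a \<nu> w x, height a \<nu> x + r, r) \<partial>lborel \<partial>lborel)"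
      unfolding J_def case_prod_conv by (rule nn_integral_lborel_swap) measurable
    also have "\<dots> = (\<integral>\<^sup>+r. \<integral>\<^sup>+x. \<psi> (skew a \<nu> w (x + r *\<^sub>R w), height a \<nu> (x + r *\<^sub>R w), r) \<partial>lborel \<partial>lborel)"
      by (simp add: height_translate skew_translate w)
    also have "\<dots> = (\<integral>\<^sup>+r. \<integral>\<^sup>+x. \<psi> (skew a \<nu> w x, height a \<nu> x, r) \<partial>lborel \<partial>lborel)"
      by (intro nn_integral_cong nn_integral_lborel_translate) measurable
    also have "\<dots> = J \<psi>"
      unfolding J_def by (rule nn_integral_lborel_swap[symmetric]) measurable
    finally show ?thesis .
  qed
  have shear_aux: "J (\<lambda>(p, \<xi>, r). \<psi> (p, \<xi>, r - \<xi>)) = J \<psi>"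
    if [measurable]: "\<psi> \<in> borel_measurable (borel \<Otimes>\<^sub>M borel \<Otimes>\<^sub>M borel)" for \<psi>
    unfolding J_def case_prod_conv diff_conv_add_uminus
    by (intro nn_integral_cong nn_integral_lborel_translate) measurable
  define \<Psi> where "\<Psi> = (\<lambda>(p, \<xi>, r). \<Phi> p \<xi> r)"
  have [measurable]: "\<Psi> \<in> borel_measurable (borel \<Otimes>\<^sub>M borel \<Otimes>\<^sub>M borel)"
    unfolding \<Psi>_def by fact
  have "J \<Psi> = J (\<lambda>(p, \<xi>, r). \<Psi> (p, \<xi> + r, r))"
    by (rule shear_height[symmetric]) measurable
  also have "\<dots> = J (\<lambda>(p, \<xi>, r). case (p, \<xi>, r - \<xi>) of (p, \<xi>, r) \<Rightarrow> \<Psi> (p, \<xi> + r, r))"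
    by (rule shear_aux[symmetric]) measurable
  also have "\<dots> = J (\<lambda>(p, \<xi>, r). \<Psi> (p, r, r - \<xi>))" by simp
  also have "\<dots> = J (\<lambda>(p, \<xi>, r). case (p, \<xi> + r, r) of (p, \<xi>, r) \<Rightarrow> \<Psi> (p, r, r - \<xi>))"
    by (rule shear_height[symmetric]) measurable
  finally show ?thesis by (simp add: J_def \<Psi>_def)
qed

definition slab :: "real set" where "slab = {-1/2..1/2}"

lemma sets_slab [measurable]: "slab \<in> sets borel"
  by (simp add: slab_def)

lemma slab_mean: "(\<integral>\<^sup>+r. c * indicator slab r \<partial>lborel) = c"
  by (simp add: nn_integral_cmult_indicator slab_def)

lemma slab_uminus: "indicator slab (-r) = (indicator slab r :: ennreal)"
  by (auto simp: indicator_def slab_def)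

text \<open>The slab that defines the surface measure may be projected along any transversal direction:
  after a quarter turn the obliqueness is a translation parallel to the hyperplane.\<close>

lemma slab_projection_direction:
  fixes w \<nu> a :: "real^'n"
  assumes w: "w \<bullet> \<nu> = 1" and \<nu>: "\<nu> \<bullet> \<nu> = 1" and [measurable]: "g \<in> borel_measurable borel"
  shows "(\<integral>\<^sup>+x. indicator slab (height a \<nu> x) * g (skew a \<nu> w x) \<partial>lborel) =
         (\<integral>\<^sup>+x. indicator slab (height a \<nu> x) * g (skew a \<nu> \<nu> x) \<partial>lborel)"
proof -
  define u where "u = \<nu> - w"
  have u: "u \<bullet> \<nu> = 0" using w \<nu> by (simp add: u_def inner_diff_left)
  have sk: "skew a \<nu> w x = skew a \<nu> \<nu> x + height a \<nu> x *\<^sub>R u" for x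
    by (simp add: skew_def u_def algebra_simps)
  have "(\<integral>\<^sup>+x. indicator slab (height a \<nu> x) * g (skew a \<nu> w x) \<partial>lborel) =
      (\<integral>\<^sup>+x. \<integral>\<^sup>+r. indicator slab (height a \<nu> x) * g (skew a \<nu> \<nu> x + height a \<nu> x *\<^sub>R u) * indicator slab r \<partial>lborel \<partial>lborel)"
    by (simp add: slab_mean sk)
  also have "\<dots> = (\<integral>\<^sup>+x. \<integral>\<^sup>+r. indicator slab r * g (skew a \<nu> \<nu> x + r *\<^sub>R u) * indicator slab (- height a \<nu> x) \<partial>lborel \<partial>lborel)"
    by (rule quarter_turn[OF \<nu>]) measurable
  also have "\<dots> = (\<integral>\<^sup>+x. \<integral>\<^sup>+r. indicator slab r * g (skew a \<nu> \<nu> (x + r *\<^sub>R u)) * indicator slab (height a \<nu> (x + r *\<^sub>R u)) \<partial>lborel \<partial>lborel)"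
    by (simp add: slab_uminus height_translate skew_translate u)
  also have "\<dots> = (\<integral>\<^sup>+r. \<integral>\<^sup>+x. indicator slab r * g (skew a \<nu> \<nu> (x + r *\<^sub>R u)) * indicator slab (height a \<nu> (x + r *\<^sub>R u)) \<partial>lborel \<partial>lborel)"
    by (rule nn_integral_lborel_swap) measurable
  also have "\<dots> = (\<integral>\<^sup>+r. \<integral>\<^sup>+x. indicator slab r * g (skew a \<nu> \<nu> x) * indicator slab (height a \<nu> x) \<partial>lborel \<partial>lborel)"
    by (intro nn_integral_cong nn_integral_lborel_translate) measurable
  also have "\<dots> = (\<integral>\<^sup>+x. \<integral>\<^sup>+r. indicator slab r * g (skew a \<nu> \<nu> x) * indicator slab (height a \<nu> x) \<partial>lborel \<partial>lborel)"
    by (rule nn_integral_lborel_swap[symmetric]) measurable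
  also have "\<dots> = (\<integral>\<^sup>+x. indicator slab (height a \<nu> x) * g (skew a \<nu> \<nu> x) \<partial>lborel)"
    by (subst slab_mean[symmetric]) (simp only: mult_ac)
  finally show ?thesis .
qed

locale flat_face =
  fixes e :: "(real^'n) set" and \<nu> a :: "real^'n"
  assumes compact: "compact e"
    and hull: "affine hull e = {y. height a \<nu> y = 0}"
    and norm_normal: "norm \<nu> = 1"
begin

lemma normal_inner [simp]: "\<nu> \<bullet> \<nu> = 1"
  using norm_normal by (simp add: norm_eq_1)

lemma height_zero: "y \<in> e \<Longrightarrow> height a \<nu> y = 0"
  using hull hull_inc[of y e affine] by blast

lemma borel_face [measurable]: "e \<in> sets borel"
  using compact by (simp add: compact_imp_closed borel_closed)

lemma closest_point_hull: "closest_point (affine hull e) x = skew a \<nu> \<nu> x"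
proof (rule closest_point_unique[symmetric])
  show "skew a \<nu> \<nu> x \<in> affine hull e" by (simp add: hull height_skew)
  show "\<forall>z\<in>affine hull e. dist x (skew a \<nu> \<nu> x) \<le> dist x z"
  proof
    fix z assume "z \<in> affine hull e"
    then have "(x - z) \<bullet> \<nu> = height a \<nu> x" by (simp add: hull height_def inner_diff_left)
    then have "\<bar>height a \<nu> x\<bar> \<le> norm (x - z)"
      using Cauchy_Schwarz_ineq2[of "x - z" \<nu>] norm_normal by simp
    then show "dist x (skew a \<nu> \<nu> x) \<le> dist x z"
      by (simp add: skew_def dist_norm norm_normal)
  qed
qed (auto simp: affine_imp_convex)

lemma infdist_hull: "infdist x (affine hull e) = \<bar>height a \<nu> x\<bar>"
proof -
  have "skew a \<nu> \<nu> x \<in> affine hull e" by (simp add: hull height_skew)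
  then have "infdist x (affine hull e) = dist x (closest_point (affine hull e) x)"
    unfolding infdist_eq_setdist by (intro setdist_closest_point) auto
  then show ?thesis by (simp add: closest_point_hull skew_def dist_norm norm_normal)
qed

lemma surface_eq: "surface e = distr (restrict_space lborel {x. height a \<nu> x \<in> slab}) borel (skew a \<nu> \<nu>)"
proof -
  have "{x. infdist x (affine hull e) \<le> 1/2} = {x. height a \<nu> x \<in> slab}"
    by (auto simp: infdist_hull abs_le_iff slab_def)
  moreover have "closest_point (affine hull e) = skew a \<nu> \<nu>"
    by (simp add: fun_eq_iff closest_point_hull)
  ultimately show ?thesis unfolding surface_def by simp
qed

lemma sets_surface [simp, measurable_cong]: "sets (surface e) = sets borel"
  and space_surface [simp]: "space (surface e) = UNIV"
  by (simp_all add: surface_def)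

lemma measurable_surface_source:
  "skew a \<nu> \<nu> \<in> measurable (restrict_space lborel {x. height a \<nu> x \<in> slab}) borel"
  by (rule measurable_restrict_space1) measurable

lemma sets_slab_region [measurable]: "{x. height a \<nu> x \<in> slab} \<in> sets borel"
  by measurable

lemma nn_integral_surface:
  assumes [measurable]: "g \<in> borel_measurable borel"
  shows "(\<integral>\<^sup>+y. g y \<partial>surface e) = (\<integral>\<^sup>+x. indicator slab (height a \<nu> x) * g (skew a \<nu> \<nu> x) \<partial>lborel)"
proof -
  have "(\<integral>\<^sup>+y. g y \<partial>surface e) = (\<integral>\<^sup>+x. g (skew a \<nu> \<nu> x) \<partial>restrict_space lborel {x. height a \<nu> x \<in> slab})"
    unfolding surface_eq by (rule nn_integral_distr[OF measurable_surface_source]) measurable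
  also have "\<dots> = (\<integral>\<^sup>+x. g (skew a \<nu> \<nu> x) * indicator {x. height a \<nu> x \<in> slab} x \<partial>lborel)"
    by (rule nn_integral_restrict_space) (simp add: sets_slab_region)
  also have "\<dots> = (\<integral>\<^sup>+x. indicator slab (height a \<nu> x) * g (skew a \<nu> \<nu> x) \<partial>lborel)"
    by (intro nn_integral_cong) (auto simp: indicator_def)
  finally show ?thesis .
qed

lemma nn_integral_surface_skew:
  assumes "w \<bullet> \<nu> = 1" and [measurable]: "g \<in> borel_measurable borel"
  shows "(\<integral>\<^sup>+x. indicator slab (height a \<nu> x) * g (skew a \<nu> w x) \<partial>lborel) = (\<integral>\<^sup>+y. g y \<partial>surface e)"
  using slab_projection_direction[OF assms(1) normal_inner assms(2)] nn_integral_surface[OF assms(2)]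
  by simp

lemma surface_finite: "emeasure (surface e) e < \<infinity>"
proof -
  obtain B where B: "\<And>y. y \<in> e \<Longrightarrow> norm y \<le> B"
    using compact compact_imp_bounded bounded_iff by metis
  have "emeasure (surface e) e = (\<integral>\<^sup>+y. indicator e y \<partial>surface e)" by simp
  also have "\<dots> = (\<integral>\<^sup>+x. indicator slab (height a \<nu> x) * indicator e (skew a \<nu> \<nu> x) \<partial>lborel)"
    by (rule nn_integral_surface) measurable
  also have "\<dots> \<le> (\<integral>\<^sup>+x. indicator (cball 0 (B + 1) :: (real^'n) set) x \<partial>lborel)"
  proof (intro nn_integral_mono)
    fix x
    show "indicator slab (height a \<nu> x) * indicator e (skew a \<nu> \<nu> x) \<le> (indicator (cball 0 (B + 1)) x :: ennreal)"
    proof (cases "height a \<nu> x \<in> slab \<and> skew a \<nu> \<nu> x \<in> e")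
      case True
      have "norm x \<le> norm (skew a \<nu> \<nu> x) + norm (height a \<nu> x *\<^sub>R \<nu>)"
        using norm_triangle_ineq[of "skew a \<nu> \<nu> x" "height a \<nu> x *\<^sub>R \<nu>"] by (simp add: skew_def)
      also have "\<dots> \<le> B + 1" using True B by (intro add_mono) (auto simp: norm_normal slab_def)
      finally show ?thesis by (simp add: indicator_def)
    qed (auto simp: indicator_def)
  qed
  also have "\<dots> < \<infinity>" using emeasure_bounded_finite[of "cball 0 (B+1) :: (real^'n) set"] by simp
  finally show ?thesis .
qed

text \<open>Integration over the skew prism swept out by the face moving with velocity \<open>- v\<close>.  A quarter
  turn exchanges the height of a point of the prism with an auxiliary variable that ranges over an
  interval of length one; what remains is an integral over the slab that defines the surface
  measure, for each value of the former height.\<close>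

lemma nn_integral_sweep:
  assumes c: "v \<bullet> \<nu> \<noteq> 0" and t: "0 < t" and [measurable]: "g \<in> borel_measurable borel"
  shows "(\<integral>\<^sup>+x. indicator {x. \<exists>s\<in>{0..t}. x + s *\<^sub>R v \<in> e} x * g x \<partial>lborel) =
    ennreal (t * \<bar>v \<bullet> \<nu>\<bar>) * (\<integral>\<^sup>+\<sigma>. indicator {0..1} \<sigma> * (\<integral>\<^sup>+y. indicator e y * g (y - (t * \<sigma>) *\<^sub>R v) \<partial>surface e) \<partial>lborel)"
proof -
  define k where "k = v \<bullet> \<nu>"
  define w where "w = v /\<^sub>R k"
  have k: "k \<noteq> 0" and w: "w \<bullet> \<nu> = 1" using c by (auto simp: k_def w_def)
  \<comment> \<open>The heights of the points of the prism, written such that the substitution \<open>r = - t k \<sigma>\<close>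
    maps them to \<open>0 \<le> \<sigma> \<le> 1\<close>.\<close>
  define I where "I = {r. - r / (t * k) \<in> {0..1}}"
  have I_meas [measurable]: "I \<in> sets borel" unfolding I_def by measurable
  have mem: "(\<exists>s\<in>{0..t}. x + s *\<^sub>R v \<in> e) \<longleftrightarrow> height a \<nu> x \<in> I \<and> skew a \<nu> w x \<in> e" for x
  proof
    assume "\<exists>s\<in>{0..t}. x + s *\<^sub>R v \<in> e"
    then obtain s where s: "0 \<le> s" "s \<le> t" "x + s *\<^sub>R v \<in> e" by auto
    then have h: "height a \<nu> x = - s * k"
      using height_zero[OF s(3)] by (simp add: height_translate k_def)
    then have "skew a \<nu> w x = x + s *\<^sub>R v" using k by (simp add: skew_def w_def)
    moreover have eq: "- height a \<nu> x / (t * k) = s / t" using h k by simp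
    have "height a \<nu> x \<in> I" unfolding I_def mem_Collect_eq eq using s t by simp
    ultimately show "height a \<nu> x \<in> I \<and> skew a \<nu> w x \<in> e" using s by simp
  next
    assume *: "height a \<nu> x \<in> I \<and> skew a \<nu> w x \<in> e"
    define s where "s = - height a \<nu> x / k"
    have "s / t = - height a \<nu> x / (t * k)" by (simp add: s_def)
    then have "0 \<le> s / t" "s / t \<le> 1" using * unfolding I_def by simp_all
    then have "s \<in> {0..t}" using t by (simp add: field_simps)
    moreover have "x + s *\<^sub>R v = skew a \<nu> w x"
      by (simp add: skew_def w_def s_def divide_inverse mult.commute)
    ultimately show "\<exists>s\<in>{0..t}. x + s *\<^sub>R v \<in> e" using * by metis
  qed
  have "(\<integral>\<^sup>+x. indicator {x. \<exists>s\<in>{0..t}. x + s *\<^sub>R v \<in> e} x * g x \<partial>lborel) =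
      (\<integral>\<^sup>+x. \<integral>\<^sup>+r. indicator I (height a \<nu> x) * (indicator e (skew a \<nu> w x) *
        g (skew a \<nu> w x + height a \<nu> x *\<^sub>R w)) * indicator slab r \<partial>lborel \<partial>lborel)"
    by (subst slab_mean) (auto simp: mem skew_def indicator_def intro!: nn_integral_cong)
  also have "\<dots> = (\<integral>\<^sup>+x. \<integral>\<^sup>+r. indicator I r * (indicator e (skew a \<nu> w x) *
        g (skew a \<nu> w x + r *\<^sub>R w)) * indicator slab (- height a \<nu> x) \<partial>lborel \<partial>lborel)"
    by (rule quarter_turn[OF w]) measurable
  also have "\<dots> = (\<integral>\<^sup>+r. \<integral>\<^sup>+x. indicator I r * (indicator e (skew a \<nu> w x) *
        g (skew a \<nu> w x + r *\<^sub>R w)) * indicator slab (- height a \<nu> x) \<partial>lborel \<partial>lborel)"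
    by (rule nn_integral_lborel_swap) measurable
  also have "\<dots> = (\<integral>\<^sup>+r. indicator I r * (\<integral>\<^sup>+x. indicator slab (height a \<nu> x) * (indicator e (skew a \<nu> w x) *
        g (skew a \<nu> w x + r *\<^sub>R w)) \<partial>lborel) \<partial>lborel)"
    by (intro nn_integral_cong, subst nn_integral_cmult[symmetric]) (auto simp: slab_uminus mult_ac)
  also have "\<dots> = (\<integral>\<^sup>+r. indicator I r * (\<integral>\<^sup>+y. indicator e y * g (y + r *\<^sub>R w) \<partial>surface e) \<partial>lborel)"
    by (intro nn_integral_cong arg_cong2[of _ _ _ _ "(*)"] refl
        nn_integral_surface_skew[OF w, of "\<lambda>y. indicator e y * g (y + _ *\<^sub>R w)"]) measurable
  also have "\<dots> = (\<integral>\<^sup>+r. indicator I r * (\<integral>\<^sup>+x. indicator slab (height a \<nu> x) * (indicator e (skew a \<nu> \<nu> x) *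
        g (skew a \<nu> \<nu> x + r *\<^sub>R w)) \<partial>lborel) \<partial>lborel)"
    by (simp add: nn_integral_surface)
  also have "\<dots> = ennreal \<bar>- t * k\<bar> * (\<integral>\<^sup>+\<sigma>. indicator I (0 + (- t * k) * \<sigma>) *
      (\<integral>\<^sup>+x. indicator slab (height a \<nu> x) * (indicator e (skew a \<nu> \<nu> x) *
        g (skew a \<nu> \<nu> x + (0 + (- t * k) * \<sigma>) *\<^sub>R w)) \<partial>lborel) \<partial>lborel)"
  proof (rule nn_integral_real_affine)
    show "- t * k \<noteq> 0" using t k by simp
  qed measurable
  also have "\<dots> = ennreal (t * \<bar>k\<bar>) * (\<integral>\<^sup>+\<sigma>. indicator {0..1} \<sigma> *
      (\<integral>\<^sup>+x. indicator slab (height a \<nu> x) * (indicator e (skew a \<nu> \<nu> x) *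
        g (skew a \<nu> \<nu> x - (t * \<sigma>) *\<^sub>R v)) \<partial>lborel) \<partial>lborel)"
  proof -
    have "indicator I (0 + (- t * k) * \<sigma>) = (indicator {0..1} \<sigma> :: ennreal)" for \<sigma>
      using t k by (auto simp: I_def indicator_def)
    moreover have "(0 + (- t * k) * \<sigma>) *\<^sub>R w = - ((t * \<sigma>) *\<^sub>R v)" for \<sigma>
      using k by (simp add: w_def)
    ultimately show ?thesis using t by (simp add: abs_mult)
  qed
  finally show ?thesis by (simp add: nn_integral_surface k_def)
qed

end

context flat_face
begin

abbreviation sweep :: "real^'n \<Rightarrow> real \<Rightarrow> (real^'n) set" where
  "sweep v t \<equiv> {x. \<exists>s\<in>{0..t}. x + s *\<^sub>R v \<in> e}"

text \<open>The parameter domain of the prism, with a time parameter scaled to the unit interval; this measure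
  is finite and does not depend on the height of the prism.\<close>

definition strip_measure :: "(real \<times> (real^'n)) measure" where
  "strip_measure = restrict_space lborel {0..1} \<Otimes>\<^sub>M restrict_space (surface e) e"

lemma compact_sweep: "compact (sweep v t)"
proof -
  have "sweep v t = (\<lambda>(y, s). y - s *\<^sub>R v) ` (e \<times> {0..t})"
  proof (intro set_eqI iffI)
    fix x assume "x \<in> sweep v t"
    then obtain s where "s \<in> {0..t}" "x + s *\<^sub>R v \<in> e" by blast
    then show "x \<in> (\<lambda>(y, s). y - s *\<^sub>R v) ` (e \<times> {0..t})"
      by (intro image_eqI[of _ _ "(x + s *\<^sub>R v, s)"]) auto
  next
    fix x assume "x \<in> (\<lambda>(y, s). y - s *\<^sub>R v) ` (e \<times> {0..t})"
    then obtain y s where "y \<in> e" "s \<in> {0..t}" "x = y - s *\<^sub>R v" by auto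
    then show "x \<in> sweep v t" by (auto intro!: bexI[of _ s])
  qed
  then show ?thesis
    by (auto intro!: compact_continuous_image compact_Times compact continuous_intros simp: split_beta)
qed

lemma finite_measure_interval: "finite_measure (restrict_space lborel {0..1::real})"
  by (rule finite_measureI) (simp add: emeasure_restrict_space space_restrict_space)

lemma finite_measure_surface: "finite_measure (restrict_space (surface e) e)"
  using surface_finite
  by (intro finite_measureI) (simp add: emeasure_restrict_space space_restrict_space)

lemma finite_measure_strip: "finite_measure strip_measure"
  unfolding strip_measure_def
  by (rule finite_measure_pair_measure[OF finite_measure_surface finite_measure_interval])

lemma space_strip: "space strip_measure = {0..1} \<times> e"
  by (simp add: strip_measure_def space_pair_measure space_restrict_space)

lemma measurable_strip:
  assumes "f \<in> measurable (borel \<Otimes>\<^sub>M borel) N"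
  shows "f \<in> measurable strip_measure N"
proof -
  have "(\<lambda>z. (fst z, snd z)) \<in> measurable strip_measure (borel \<Otimes>\<^sub>M borel)"
    unfolding strip_measure_def
    by (intro measurable_Pair measurable_compose[OF measurable_fst] measurable_compose[OF measurable_snd]
        measurable_restrict_space1) (auto simp: measurable_def)
  then show ?thesis using measurable_compose[OF _ assms] by simp
qed

text \<open>The formula for nonnegative functions, read as an equality of measures, extends to signed
  functions.\<close>

lemma integral_sweep:
  fixes p :: "real^'n \<Rightarrow> real"
  assumes c: "v \<bullet> \<nu> \<noteq> 0" and t: "0 < t" and p [measurable]: "p \<in> borel_measurable borel"
  shows "(\<integral>x. indicator (sweep v t) x * p x \<partial>lborel) =
    t * \<bar>v \<bullet> \<nu>\<bar> * (\<integral>z. p (snd z - (t * fst z) *\<^sub>R v) \<partial>strip_measure)"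
proof -
  interpret S: finite_measure "restrict_space (surface e) e" by (rule finite_measure_surface)
  have [measurable]: "sweep v t \<in> sets borel" using compact_sweep by (simp add: borel_closed compact_imp_closed)
  define \<phi> where "\<phi> z = snd z - (t * fst z) *\<^sub>R v" for z
  have \<phi> [measurable]: "\<phi> \<in> measurable strip_measure borel"
    by (rule measurable_strip) (unfold \<phi>_def, measurable)
  have "density lborel (\<lambda>x. ennreal (indicator (sweep v t) x)) =
      density (distr strip_measure borel \<phi>) (\<lambda>_. ennreal (t * \<bar>v \<bullet> \<nu>\<bar>))"
  proof (rule measure_eqI)
    fix A assume "A \<in> sets (density lborel (\<lambda>x. ennreal (indicator (sweep v t) x)))"
    then have A [measurable]: "A \<in> sets borel" by simp
    have "emeasure (density lborel (\<lambda>x. ennreal (indicator (sweep v t) x))) A =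
        (\<integral>\<^sup>+x. indicator (sweep v t) x * indicator A x \<partial>lborel)"
      by (subst emeasure_density) (auto simp: ennreal_indicator)
    also have "\<dots> = ennreal (t * \<bar>v \<bullet> \<nu>\<bar>) * (\<integral>\<^sup>+\<sigma>. indicator {0..1} \<sigma> *
        (\<integral>\<^sup>+y. indicator e y * indicator A (y - (t * \<sigma>) *\<^sub>R v) \<partial>surface e) \<partial>lborel)"
      by (rule nn_integral_sweep[OF c t]) measurable
    also have "(\<integral>\<^sup>+\<sigma>. indicator {0..1} \<sigma> *
        (\<integral>\<^sup>+y. indicator e y * indicator A (y - (t * \<sigma>) *\<^sub>R v) \<partial>surface e) \<partial>lborel) =
        (\<integral>\<^sup>+\<sigma>. (\<integral>\<^sup>+y. indicator A (\<phi> (\<sigma>, y)) \<partial>restrict_space (surface e) e) \<partial>restrict_space lborel {0..1})"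
      by (simp add: nn_integral_restrict_space \<phi>_def mult.commute)
    also have "\<dots> = (\<integral>\<^sup>+z. indicator A (\<phi> z) \<partial>strip_measure)"
      unfolding strip_measure_def by (rule S.nn_integral_fst) (unfold strip_measure_def[symmetric], measurable)
    also have "\<dots> = (\<integral>\<^sup>+x. indicator A x \<partial>distr strip_measure borel \<phi>)"
      by (rule nn_integral_distr[symmetric]) measurable
    also have "ennreal (t * \<bar>v \<bullet> \<nu>\<bar>) * \<dots> =
        emeasure (density (distr strip_measure borel \<phi>) (\<lambda>_. ennreal (t * \<bar>v \<bullet> \<nu>\<bar>))) A"
      by (simp add: emeasure_density nn_integral_cmult)
    finally show "emeasure (density lborel (\<lambda>x. ennreal (indicator (sweep v t) x))) A =
      emeasure (density (distr strip_measure borel \<phi>) (\<lambda>_. ennreal (t * \<bar>v \<bullet> \<nu>\<bar>))) A" .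
  qed simp
  then have "(\<integral>x. p x \<partial>density lborel (\<lambda>x. ennreal (indicator (sweep v t) x))) =
      (\<integral>x. p x \<partial>density (distr strip_measure borel \<phi>) (\<lambda>_. ennreal (t * \<bar>v \<bullet> \<nu>\<bar>)))" by simp
  then show ?thesis
    using t by (simp add: integral_density integral_distr \<phi>_def)
qed

lemma integral_strip_const:
  fixes p :: "real^'n \<Rightarrow> real"
  assumes "continuous_on UNIV p"
  shows "(\<integral>z. p (snd z) \<partial>strip_measure) = (LINT y:e|surface e. p y)"
proof -
  interpret I: finite_measure "restrict_space lborel {0..1::real}" by (rule finite_measure_interval)
  interpret S: finite_measure "restrict_space (surface e) e" by (rule finite_measure_surface)
  interpret N: finite_measure strip_measure by (rule finite_measure_strip)
  interpret P: pair_sigma_finite "restrict_space lborel {0..1::real}" "restrict_space (surface e) e" ..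
  have [measurable]: "p \<in> borel_measurable borel" using assms by (rule borel_measurable_continuous_onI)
  have "bounded (p ` e)"
    by (intro compact_imp_bounded compact_continuous_image compact continuous_on_subset[OF assms]) auto
  then obtain B where B: "\<And>y. y \<in> e \<Longrightarrow> \<bar>p y\<bar> \<le> B" by (auto simp: bounded_iff)
  have "integrable strip_measure (\<lambda>z. p (snd z))"
    by (rule N.integrable_const_bound[of _ B])
       (auto simp: space_strip intro!: AE_I2 B measurable_strip)
  then have "(\<integral>z. p (snd z) \<partial>strip_measure) =
      (\<integral>\<sigma>. (\<integral>y. p y \<partial>restrict_space (surface e) e) \<partial>restrict_space lborel {0..1::real})"
    unfolding strip_measure_def by (subst P.integral_fst'[symmetric]) auto
  also have "\<dots> = (\<integral>y. p y \<partial>restrict_space (surface e) e)"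
    by (simp add: measure_restrict_space space_restrict_space)
  also have "\<dots> = (LINT y:e|surface e. p y)"
    by (simp add: integral_restrict_space set_lebesgue_integral_def)
  finally show ?thesis .
qed

text \<open>A thin prism over a face has volume height times area; bounded convergence on the parameter
  domain gives the corresponding statement for integrals of continuous functions.\<close>

lemma sweep_limit:
  fixes p :: "real^'n \<Rightarrow> real"
  assumes c: "v \<bullet> \<nu> \<noteq> 0" and p: "continuous_on UNIV p"
    and t: "t \<longlonglongrightarrow> 0" "\<And>n. 0 < t n" "\<And>n. t n \<le> (1::real)"
  shows "(\<lambda>n. (\<integral>x. indicator (sweep v (t n)) x * p x \<partial>lborel) / t n)
    \<longlonglongrightarrow> \<bar>v \<bullet> \<nu>\<bar> * (LINT y:e|surface e. p y)"
proof -
  interpret N: finite_measure strip_measure by (rule finite_measure_strip)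
  have pm [measurable]: "p \<in> borel_measurable borel" using p by (rule borel_measurable_continuous_onI)
  have "bounded (p ` sweep v 1)"
    by (intro compact_imp_bounded compact_continuous_image compact_sweep continuous_on_subset[OF p]) auto
  then obtain B where B: "\<And>x. x \<in> sweep v 1 \<Longrightarrow> \<bar>p x\<bar> \<le> B" by (auto simp: bounded_iff)
  have "(\<lambda>n. \<integral>z. p (snd z - (t n * fst z) *\<^sub>R v) \<partial>strip_measure) \<longlonglongrightarrow> (\<integral>z. p (snd z) \<partial>strip_measure)"
  proof (rule integral_dominated_convergence[where w = "\<lambda>_. B"])
    show "AE z in strip_measure. (\<lambda>n. p (snd z - (t n * fst z) *\<^sub>R v)) \<longlonglongrightarrow> p (snd z)"
    proof (intro AE_I2)
      fix z :: "real \<times> (real^'n)"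
      have "(\<lambda>n. snd z - (t n * fst z) *\<^sub>R v) \<longlonglongrightarrow> snd z - (0 * fst z) *\<^sub>R v"
        by (intro tendsto_intros t)
      then have lim: "(\<lambda>n. snd z - (t n * fst z) *\<^sub>R v) \<longlonglongrightarrow> snd z" by simp
      have "isCont p (snd z)" using p by (simp add: continuous_on_eq_continuous_at)
      then show "(\<lambda>n. p (snd z - (t n * fst z) *\<^sub>R v)) \<longlonglongrightarrow> p (snd z)"
        using lim by (rule isCont_tendsto_compose)
    qed
    show "AE z in strip_measure. norm (p (snd z - (t n * fst z) *\<^sub>R v)) \<le> B" for n
    proof (intro AE_I2)
      fix z assume "z \<in> space strip_measure"
      then have z: "0 \<le> fst z" "fst z \<le> 1" "snd z \<in> e" by (auto simp: space_strip)
      have "t n * fst z \<in> {0..1}"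
        using z t(2,3)[of n] mult_mono[of "t n" 1 "fst z" 1] by auto
      then have "snd z - (t n * fst z) *\<^sub>R v \<in> sweep v 1"
        using z(3) by (auto intro!: bexI[of _ "t n * fst z"])
      then show "norm (p (snd z - (t n * fst z) *\<^sub>R v)) \<le> B" using B by simp
    qed
  qed (auto intro!: measurable_strip)
  then have "(\<lambda>n. \<bar>v \<bullet> \<nu>\<bar> * (\<integral>z. p (snd z - (t n * fst z) *\<^sub>R v) \<partial>strip_measure))
      \<longlonglongrightarrow> \<bar>v \<bullet> \<nu>\<bar> * (LINT y:e|surface e. p y)"
    by (intro tendsto_mult tendsto_const) (simp add: integral_strip_const[OF p])
  moreover have "(\<integral>x. indicator (sweep v (t n)) x * p x \<partial>lborel) / t n =
      \<bar>v \<bullet> \<nu>\<bar> * (\<integral>z. p (snd z - (t n * fst z) *\<^sub>R v) \<partial>strip_measure)" for n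
    using integral_sweep[OF c t(2) pm, of n] t(2)[of n] by simp
  ultimately show ?thesis by simp
qed

end

section \<open>The divergence theorem\<close>

lemma AE_not_in_negligible:
  fixes N :: "(real^'n) set"
  assumes "negligible N"
  shows "AE x in lborel. x \<notin> N"
proof -
  have "AE x in lebesgue. x \<notin> N" using assms by (intro AE_not_in) (simp add: negligible_iff_null_sets)
  then show ?thesis by (simp add: AE_completion_iff)
qed

text \<open>The lines in direction \<open>v\<close> through a set of codimension two sweep out codimension at least one.\<close>

lemma negligible_cylinder:
  fixes A :: "(real^'n) set"
  assumes "affine A" "A \<noteq> {}" "aff_dim A \<le> int CARD('n) - 2"
  shows "negligible {z + s *\<^sub>R v | z s. z \<in> A}"
proof -
  obtain z0 where z0: "z0 \<in> A" using assms(2) by auto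
  let ?B = "affine hull (insert (z0 + v) A)"
  have "aff_dim ?B < int CARD('n)"
    using assms(3) by (simp add: aff_dim_insert)
  then have "negligible ?B" by (intro negligible_affine_lowdim) auto
  moreover have "{z + s *\<^sub>R v | z s. z \<in> A} \<subseteq> ?B"
  proof clarify
    fix z s assume z: "z \<in> A"
    have "z + s *\<^sub>R ((z0 + v) - z0) \<in> ?B"
      by (intro mem_affine_3_minus) (auto intro: hull_inc z z0)
    then show "z + s *\<^sub>R v \<in> ?B" by simp
  qed
  ultimately show ?thesis using negligible_subset by blast
qed

lemma sgn_via_of_bool:
  fixes s0 a b c :: real
  assumes "a \<le> s0" "s0 \<le> b"
  shows "(1 - sgn ((b - s0) * c)) - (1 - sgn ((a - s0) * c)) =
    - sgn c * (of_bool (a < s0) + of_bool (s0 < b))"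
proof -
  have "sgn (b - s0) = of_bool (s0 < b)" "sgn (a - s0) = - of_bool (a < s0)"
    using assms by auto
  then show ?thesis by (simp only: sgn_mult) (simp add: algebra_simps)
qed

lemma lborel_integral_translate:
  fixes f :: "'a::euclidean_space \<Rightarrow> real"
  assumes [measurable]: "f \<in> borel_measurable borel"
  shows "(\<integral>x. f (x + c) \<partial>lborel) = (\<integral>x. f x \<partial>lborel)"
  by (subst (2) lborel_distr_plus[symmetric, of c]) (simp add: integral_distr add.commute)

context polyhedral_cell
begin

abbreviation n :: "(real^'n) set \<Rightarrow> real^'n" where
  "n e \<equiv> outward_normal T e"

lemma flat_face:
  assumes "e \<in> F" "a \<in> e"
  shows "flat_face e (n e) a"
proof
  show "compact e" by (rule compact_face[OF assms(1)])
  show "affine hull e = {y. height a (n e) y = 0}"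
    using unit_normal_affine_hull[OF outward_normal(1)[OF assms(1)] aff_dim_face[OF assms(1)]]
      assms(2) hull_inc[of a e affine] by (auto simp: height_def)
  show "norm (n e) = 1" using outward_normal(1)[OF assms(1)] by (simp add: unit_normal_to_def)
qed

text \<open>The points whose line in direction \<open>v\<close> lies in the hyperplane of a face or meets the relative
  boundary of a face.\<close>

definition bad_points :: "real^'n \<Rightarrow> (real^'n) set" where
  "bad_points v = (\<Union>e\<in>{e \<in> F. v \<bullet> n e = 0}. affine hull e) \<union>
     (\<Union>e\<in>F. {z + s *\<^sub>R v | z s. z \<in> e - rel_interior e})"

lemma negligible_bad_points: "negligible (bad_points v)"
proof -
  have "negligible (affine hull e)" if "e \<in> F" for e
    using aff_dim_face[OF that] by (intro negligible_affine_lowdim) auto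
  moreover have "negligible {z + s *\<^sub>R v | z s. z \<in> e - rel_interior e}" if "e \<in> F" for e
  proof -
    obtain A where A: "finite A" "e - rel_interior e \<subseteq> \<Union>A"
      "\<And>a. a \<in> A \<Longrightarrow> affine a \<and> a \<noteq> {} \<and> aff_dim a = int CARD('n) - 1 - 1"
      using polyhedral_set_rel_boundary[OF face[OF \<open>e \<in> F\<close>] card_ge] by metis
    have "negligible (\<Union>a\<in>A. {z + s *\<^sub>R v | z s. z \<in> a})"
      using A(1)
    proof (intro negligible_Union finite_imageI)
      fix B assume "B \<in> (\<lambda>a. {z + s *\<^sub>R v | z s. z \<in> a}) ` A"
      then obtain a where a: "a \<in> A" "B = {z + s *\<^sub>R v | z s. z \<in> a}" by blast
      have "affine a" "a \<noteq> {}" "aff_dim a \<le> int CARD('n) - 2" using A(3)[OF a(1)] by auto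
      then show "negligible B" unfolding a(2) by (rule negligible_cylinder)
    qed
    moreover have "{z + s *\<^sub>R v | z s. z \<in> e - rel_interior e} \<subseteq> (\<Union>a\<in>A. {z + s *\<^sub>R v | z s. z \<in> a})"
      using A(2) by blast
    ultimately show ?thesis using negligible_subset by blast
  qed
  ultimately show ?thesis
    unfolding bad_points_def by (intro negligible_Un negligible_Union) auto
qed

text \<open>Twice the indicator of the cell, with the symmetric value on the boundary; this makes the
  crossing formula below additive in the interval.\<close>

definition twice_ind :: "real^'n \<Rightarrow> real" where
  "twice_ind x = of_bool (x \<in> T) + of_bool (x \<in> interior T)"

text \<open>Crossings at the ends of the interval count half, in accordance with the value of the doubled
  indicator on the boundary.  A transversal line meets a face at most once.\<close>

definition crossings :: "real^'n \<Rightarrow> real^'n \<Rightarrow> real \<Rightarrow> real \<Rightarrow> (real^'n) set \<Rightarrow> real" where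
  "crossings x v a b e = of_bool (\<exists>s. a < s \<and> s \<le> b \<and> x + s *\<^sub>R v \<in> e) +
     of_bool (\<exists>s. a \<le> s \<and> s < b \<and> x + s *\<^sub>R v \<in> e)"

lemma crossings_zero:
  assumes "\<And>s. a \<le> s \<Longrightarrow> s \<le> b \<Longrightarrow> x + s *\<^sub>R v \<notin> e"
  shows "crossings x v a b e = 0"
proof -
  have "\<not> (\<exists>s. a < s \<and> s \<le> b \<and> x + s *\<^sub>R v \<in> e)" "\<not> (\<exists>s. a \<le> s \<and> s < b \<and> x + s *\<^sub>R v \<in> e)"
    using assms by (meson less_imp_le)+
  then show ?thesis by (simp add: crossings_def)
qed

lemma line_meets_face_once:
  assumes "e \<in> F" "v \<bullet> n e \<noteq> 0" "x + s *\<^sub>R v \<in> e" "x + s' *\<^sub>R v \<in> e"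
  shows "s = s'"
proof -
  have "((x + s *\<^sub>R v) - (x + s' *\<^sub>R v)) \<bullet> n e = 0"
    using outward_normal(1)[OF assms(1)] assms(3,4) unfolding unit_normal_to_def by blast
  then have "(s - s') * (v \<bullet> n e) = 0" by (simp add: inner_diff_left inner_add_left algebra_simps)
  then show ?thesis using assms(2) by simp
qed

text \<open>Along a line that avoids the bad points the indicator of the cell jumps exactly at the
  crossings with faces, downwards where the line leaves the cell.  The formula is additive in the
  interval and holds on short intervals around every parameter, so it holds on every interval.\<close>

lemma crossing_formula:
  assumes x: "x \<notin> bad_points v" and "a \<le> b"
  shows "twice_ind (x + b *\<^sub>R v) - twice_ind (x + a *\<^sub>R v) =
    - (\<Sum>e\<in>F. sgn (v \<bullet> n e) * crossings x v a b e)"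
  using \<open>a \<le> b\<close>
proof (induction rule: Bolzano)
  case (trans a b c)
  have "sgn (v \<bullet> n e) * crossings x v a c e =
      sgn (v \<bullet> n e) * crossings x v a b e + sgn (v \<bullet> n e) * crossings x v b c e" if e: "e \<in> F" for e
  proof (cases "v \<bullet> n e = 0 \<or> (\<forall>s. x + s *\<^sub>R v \<notin> e)")
    case True
    then show ?thesis by (auto simp: crossings_def)
  next
    case False
    then obtain s0 where s0: "x + s0 *\<^sub>R v \<in> e" "v \<bullet> n e \<noteq> 0" by blast
    have "x + s *\<^sub>R v \<in> e \<longleftrightarrow> s = s0" for s
      using line_meets_face_once[OF e s0(2) _ s0(1), of s] s0(1) by blast
    then have "crossings x v a' b' e = of_bool (a' < s0 \<and> s0 \<le> b') + of_bool (a' \<le> s0 \<and> s0 < b')" for a' b'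
      by (simp add: crossings_def)
    then have "crossings x v a c e = crossings x v a b e + crossings x v b c e"
      using trans(3,4) by (auto simp: of_bool_def)
    then show ?thesis by (simp add: distrib_left)
  qed
  then show ?case using trans(1,2) by (simp add: sum.distrib)
next
  case (local s0)
  define z where "z = x + s0 *\<^sub>R v"
  \<comment> \<open>A parameter interval shorter than \<open>\<delta> / k\<close> stays in the ball of radius \<open>\<delta>\<close>, also for \<open>v = 0\<close>.\<close>
  define k where "k = norm v + 1"
  have k: "k > 0" by (simp add: k_def add_nonneg_pos)
  have near: "x + s *\<^sub>R v \<in> ball z \<delta>" if "a \<le> s0" "s0 \<le> b" "b - a < \<delta> / k" "a \<le> s" "s \<le> b" for a b s \<delta>
  proof -
    have "z - (x + s *\<^sub>R v) = (s0 - s) *\<^sub>R v" by (simp add: z_def algebra_simps)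
    then have "dist z (x + s *\<^sub>R v) = \<bar>s0 - s\<bar> * norm v" by (simp add: dist_norm)
    also have "\<dots> \<le> (b - a) * k" using that by (intro mult_mono) (auto simp: k_def)
    also have "\<dots> < \<delta>" using that(3) k by (simp add: field_simps)
    finally show ?thesis by simp
  qed
  show ?case
  proof (cases "z \<in> frontier T")
    case False
    then have "z \<in> interior T \<or> z \<in> - T" using closure_subset[of T] by (auto simp: frontier_def)
    moreover have "open (interior T)" "open (- T)" using closed_cell by auto
    ultimately obtain \<delta> where \<delta>: "\<delta> > 0" "ball z \<delta> \<subseteq> interior T \<or> ball z \<delta> \<subseteq> - T"
      by (meson open_contains_ball)
    show ?thesis
    proof (intro exI[of _ "\<delta> / k"] conjI allI impI)
      fix a b assume ab: "a \<le> s0 \<and> s0 \<le> b \<and> b - a < \<delta> / k"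
      then have bl: "x + s *\<^sub>R v \<in> ball z \<delta>" if "a \<le> s" "s \<le> b" for s using near that by blast
      have "y \<notin> e" if "y \<in> ball z \<delta>" "e \<in> F" for y e
        using \<delta>(2) that face_subset[of e] by (auto simp: frontier_def)
      then have "crossings x v a b e = 0" if "e \<in> F" for e
        using bl that by (intro crossings_zero) blast
      moreover have "twice_ind (x + b *\<^sub>R v) = twice_ind (x + a *\<^sub>R v)"
        using bl[of a] bl[of b] ab \<delta>(2) interior_subset[of T] by (auto simp: twice_ind_def)
      ultimately show "twice_ind (x + b *\<^sub>R v) - twice_ind (x + a *\<^sub>R v) =
          - (\<Sum>e\<in>F. sgn (v \<bullet> n e) * crossings x v a b e)" by simp
    qed (use \<delta> k in auto)
  next
    case True
    then obtain e0 where e0: "e0 \<in> F" "z \<in> e0" using frontier_eq by auto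
    have xz: "x = z + (- s0) *\<^sub>R v" by (simp add: z_def)
    have c: "v \<bullet> n e0 \<noteq> 0"
    proof
      assume 0: "v \<bullet> n e0 = 0"
      interpret flat_face e0 "n e0" z using flat_face e0 by blast
      have "height z (n e0) (z + (- s0) *\<^sub>R v) = 0"
        unfolding height_translate using 0 height_zero[OF e0(2)] by simp
      then have "x \<in> affine hull e0" by (simp only: hull xz mem_Collect_eq)
      then show False using x 0 e0 by (auto simp: bad_points_def)
    qed
    have zr: "z \<in> rel_interior e0"
    proof (rule ccontr)
      assume "z \<notin> rel_interior e0"
      then have "x \<in> bad_points v" unfolding bad_points_def using e0 xz by blast
      then show False using x by blast
    qed
    obtain \<delta>1 where \<delta>1: "\<delta>1 > 0" "\<And>y. y \<in> ball z \<delta>1 \<Longrightarrow> 0 < (y - z) \<bullet> n e0 \<Longrightarrow> y \<notin> T"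
      "\<And>y. y \<in> ball z \<delta>1 \<Longrightarrow> (y - z) \<bullet> n e0 < 0 \<Longrightarrow> y \<in> interior T"
      using outward_normal(2)[OF e0(1) zr] unfolding half_ball_at_def by blast
    have "closed (\<Union>(F - {e0}))"
      using compact_face by (intro closed_Union) (auto intro: compact_imp_closed)
    moreover have "z \<notin> \<Union>(F - {e0})" using faces_disjoint[OF e0(1)] zr by auto
    ultimately obtain \<delta>2 where \<delta>2: "\<delta>2 > 0" "ball z \<delta>2 \<inter> \<Union>(F - {e0}) = {}"
      by (metis open_Compl open_contains_ball ComplI disjoint_eq_subset_Compl)
    define \<delta> where "\<delta> = min \<delta>1 \<delta>2"
    have \<delta>: "\<delta> > 0" "ball z \<delta> \<subseteq> ball z \<delta>1" "ball z \<delta> \<subseteq> ball z \<delta>2" using \<delta>1 \<delta>2 by (auto simp: \<delta>_def)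
    show ?thesis
    proof (intro exI[of _ "\<delta> / k"] conjI allI impI)
      fix a b assume ab: "a \<le> s0 \<and> s0 \<le> b \<and> b - a < \<delta> / k"
      then have bl: "x + s *\<^sub>R v \<in> ball z \<delta>" if "a \<le> s" "s \<le> b" for s using near that by blast
      have other: "crossings x v a b e = 0" if e: "e \<in> F - {e0}" for e
      proof (rule crossings_zero)
        fix s assume "a \<le> s" "s \<le> b"
        then have "x + s *\<^sub>R v \<in> ball z \<delta>2" using bl \<delta>(3) by blast
        then show "x + s *\<^sub>R v \<notin> e" using \<delta>2(2) e by blast
      qed
      have "x + s *\<^sub>R v \<in> e0 \<longleftrightarrow> s = s0" for s
        using line_meets_face_once[OF e0(1) c, of x s s0] e0(2) by (auto simp: z_def)
      then have own: "crossings x v a b e0 = of_bool (a < s0) + of_bool (s0 < b)"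
        using ab by (simp add: crossings_def)
      have val: "twice_ind (x + s *\<^sub>R v) = 1 - sgn ((s - s0) * (v \<bullet> n e0))" if "a \<le> s" "s \<le> b" for s
      proof -
        let ?y = "x + s *\<^sub>R v"
        have yb: "?y \<in> ball z \<delta>1" using bl[OF that] \<delta>(2) by blast
        have h: "(?y - z) \<bullet> n e0 = (s - s0) * (v \<bullet> n e0)" by (simp add: z_def inner_diff_left inner_add_left algebra_simps)
        consider "(s - s0) * (v \<bullet> n e0) > 0" | "(s - s0) * (v \<bullet> n e0) < 0" | "(s - s0) * (v \<bullet> n e0) = 0"
          by linarith
        then show ?thesis
        proof cases
          case 1
          then show ?thesis using \<delta>1(2)[OF yb] h interior_subset[of T] by (auto simp: twice_ind_def)
        next
          case 2
          then show ?thesis using \<delta>1(3)[OF yb] h interior_subset[of T] by (auto simp: twice_ind_def)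
        next
          case 3
          then have "?y = z" using c by (simp add: z_def)
          moreover have "z \<in> T" "z \<notin> interior T"
            using True frontier_subset_closed[OF closed_cell] by (auto simp: frontier_def)
          ultimately show ?thesis unfolding 3 by (simp add: twice_ind_def)
        qed
      qed
      have "(\<Sum>e\<in>F. sgn (v \<bullet> n e) * crossings x v a b e) = sgn (v \<bullet> n e0) * crossings x v a b e0"
        using e0(1) other by (subst sum.remove[OF finite_faces e0(1)]) simp
      then show "twice_ind (x + b *\<^sub>R v) - twice_ind (x + a *\<^sub>R v) =
          - (\<Sum>e\<in>F. sgn (v \<bullet> n e) * crossings x v a b e)"
        using val[of a] val[of b] ab own sgn_via_of_bool[of a s0 b "v \<bullet> n e0"] by simp
    qed (use \<delta> k in auto)
  qed
qed

text \<open>Off a null set the end points are not on the boundary, and the two halves of a crossing add up.\<close>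

lemma translated_cell_indicator:
  assumes "0 \<le> t"
  shows "AE x in lborel. indicator T (x + t *\<^sub>R v) - indicator T x =
    - (\<Sum>e\<in>F. sgn (v \<bullet> n e) * indicator {x. \<exists>s\<in>{0..t}. x + s *\<^sub>R v \<in> e} x :: real)"
proof -
  have fr: "negligible (frontier T)" by (rule negligible_frontier_polyhedral[OF cell])
  have "negligible ((+) (- (t *\<^sub>R v)) ` frontier T)" by (rule negligible_translation[OF fr])
  then have "AE x in lborel. x \<notin> (+) (- (t *\<^sub>R v)) ` frontier T" by (rule AE_not_in_negligible)
  moreover have "AE x in lborel. x \<notin> frontier T" by (rule AE_not_in_negligible[OF fr])
  moreover have "AE x in lborel. x \<notin> bad_points v"
    by (rule AE_not_in_negligible[OF negligible_bad_points])
  ultimately show ?thesis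
  proof eventually_elim
    case (elim x)
    have x2: "x + t *\<^sub>R v \<notin> frontier T"
      using elim(1) by (metis (no_types, lifting) add.commute add_uminus_conv_diff diff_add_cancel image_eqI)
    have ti: "twice_ind y = 2 * indicator T y" if "y \<notin> frontier T" for y
      using that closed_cell interior_subset[of T]
      by (auto simp: twice_ind_def frontier_def closure_closed indicator_def)
    have cr: "crossings x v 0 t e = 2 * indicator {x. \<exists>s\<in>{0..t}. x + s *\<^sub>R v \<in> e} x" if "e \<in> F" for e
    proof -
      have ne: "x \<notin> e" "x + t *\<^sub>R v \<notin> e" using elim(2) x2 face_subset[OF that] by auto
      have "0 < s \<and> s \<le> t \<and> x + s *\<^sub>R v \<in> e \<longleftrightarrow> s \<in> {0..t} \<and> x + s *\<^sub>R v \<in> e"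
        "0 \<le> s \<and> s < t \<and> x + s *\<^sub>R v \<in> e \<longleftrightarrow> s \<in> {0..t} \<and> x + s *\<^sub>R v \<in> e" for s
        using ne by (cases "s = 0"; cases "s = t"; force)+
      then show ?thesis by (simp add: crossings_def indicator_def Bex_def)
    qed
    have "(\<Sum>e\<in>F. sgn (v \<bullet> n e) * crossings x v 0 t e) =
        2 * (\<Sum>e\<in>F. sgn (v \<bullet> n e) * indicator {x. \<exists>s\<in>{0..t}. x + s *\<^sub>R v \<in> e} x)"
      unfolding sum_distrib_left by (intro sum.cong refl) (simp only: cr mult.left_commute)
    then have "2 * indicator T (x + t *\<^sub>R v) - 2 * indicator T x =
        - (2 * (\<Sum>e\<in>F. sgn (v \<bullet> n e) * indicator {x. \<exists>s\<in>{0..t}. x + s *\<^sub>R v \<in> e} x))"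
      using crossing_formula[OF elim(3) assms] ti[OF elim(2)] ti[OF x2] by simp
    then show ?case by linarith
  qed
qed

text \<open>Integrate the preceding formula; translation invariance moves the translated cell back and the
  translation into the integrand.\<close>

lemma integral_translation_difference:
  fixes p :: "real^'n \<Rightarrow> real"
  assumes t: "0 \<le> t" and p: "continuous_on UNIV p"
  shows "(\<integral>x. indicator T x * (p (x - t *\<^sub>R v) - p x) \<partial>lborel) =
    - (\<Sum>e\<in>F. sgn (v \<bullet> n e) * (\<integral>x. indicator {x. \<exists>s\<in>{0..t}. x + s *\<^sub>R v \<in> e} x * p x \<partial>lborel))"
proof -
  let ?S = "\<lambda>e. {x. \<exists>s\<in>{0..t}. x + s *\<^sub>R v \<in> e}"
  let ?T' = "(+) (- (t *\<^sub>R v)) ` T"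
  have [measurable]: "p \<in> borel_measurable borel" using p by (rule borel_measurable_continuous_onI)
  have [measurable]: "T \<in> sets borel" using closed_cell by (rule borel_closed)
  have int: "integrable lborel (\<lambda>x. indicator K x * q x)"
    if "compact K" "continuous_on UNIV q" for K and q :: "real^'n \<Rightarrow> real"
    using borel_integrable_compact[OF that(1) continuous_on_subset[OF that(2)]] by simp
  have compS: "compact (?S e)" if e: "e \<in> F" for e
  proof -
    obtain a where "a \<in> e" using rel_interior_face_ne[OF e] rel_interior_subset by blast
    then show ?thesis using flat_face.compact_sweep[OF flat_face[OF e]] by blast
  qed
  have shift: "continuous_on UNIV (\<lambda>x. p (x - t *\<^sub>R v))"
    by (intro continuous_on_compose2[OF p] continuous_intros) auto
  have T': "indicator T (x + t *\<^sub>R v) = (indicator ?T' x :: real)" for x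
    by (auto simp: indicator_def image_iff algebra_simps intro!: bexI[of _ "x + t *\<^sub>R v"])
  have "(\<integral>x. indicator T x * p (x - t *\<^sub>R v) \<partial>lborel) = (\<integral>x. indicator T (x + t *\<^sub>R v) * p (x + t *\<^sub>R v - t *\<^sub>R v) \<partial>lborel)"
    by (rule lborel_integral_translate[symmetric]) measurable
  then have 1: "(\<integral>x. indicator T x * p (x - t *\<^sub>R v) \<partial>lborel) = (\<integral>x. indicator ?T' x * p x \<partial>lborel)"
    by (simp add: T')
  have "compact ?T'" by (rule compact_translation[OF compact_cell])
  then have "(\<integral>x. indicator T x * (p (x - t *\<^sub>R v) - p x) \<partial>lborel) =
      (\<integral>x. (indicator ?T' x - indicator T x) * p x \<partial>lborel)"
    using int[OF compact_cell shift] int[OF compact_cell p] int[OF _ p]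
    by (simp add: right_diff_distrib left_diff_distrib 1)
  also have "\<dots> = (\<integral>x. - (\<Sum>e\<in>F. sgn (v \<bullet> n e) * (indicator (?S e) x * p x)) \<partial>lborel)"
  proof (rule integral_cong_AE)
    show "AE x in lborel. (indicator ?T' x - indicator T x) * p x = - (\<Sum>e\<in>F. sgn (v \<bullet> n e) * (indicator (?S e) x * p x))"
      using translated_cell_indicator[OF t, of v]
      by eventually_elim (simp only: T' minus_mult_left[symmetric] sum_distrib_right mult.assoc)
    have [measurable]: "?T' \<in> sets borel" using \<open>compact ?T'\<close> by (simp add: compact_imp_closed borel_closed)
    show "(\<lambda>x. (indicator ?T' x - indicator T x) * p x) \<in> borel_measurable lborel" by measurable
    have "(\<lambda>x. indicator (?S e) x * p x) \<in> borel_measurable lborel" if "e \<in> F" for e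
      using int[OF compS[OF that] p] by (rule borel_measurable_integrable)
    then show "(\<lambda>x. - (\<Sum>e\<in>F. sgn (v \<bullet> n e) * (indicator (?S e) x * p x))) \<in> borel_measurable lborel"
      by (intro borel_measurable_uminus borel_measurable_sum borel_measurable_times[OF borel_measurable_const]) auto
  qed
  also have "\<dots> = - (\<Sum>e\<in>F. sgn (v \<bullet> n e) * (\<integral>x. indicator (?S e) x * p x \<partial>lborel))"
    using int[OF compS p] by (simp add: Bochner_Integration.integral_sum)
  finally show ?thesis .
qed

lemma difference_quotient_limit:
  fixes p :: "real^'n \<Rightarrow> real"
  assumes p: "\<And>x. GDERIV p x :> G x" and G: "continuous_on UNIV G"
    and t: "t \<longlonglongrightarrow> 0" "\<And>n. 0 < t n" "\<And>n. t n \<le> (1::real)"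
  shows "(\<lambda>n. (\<integral>x. indicator T x * (p (x - t n *\<^sub>R v) - p x) \<partial>lborel) / t n)
    \<longlonglongrightarrow> - (\<integral>x. indicator T x * (G x \<bullet> v) \<partial>lborel)"
proof -
  have pc: "continuous_on UNIV p"
    using p by (auto simp: gderiv_def intro!: continuous_at_imp_continuous_on has_derivative_continuous)
  have pm [measurable]: "p \<in> borel_measurable borel" using pc by (rule borel_measurable_continuous_onI)
  have Gm [measurable]: "G \<in> borel_measurable borel" using G by (rule borel_measurable_continuous_onI)
  have Tm [measurable]: "T \<in> sets borel" using closed_cell by (rule borel_closed)
  have der: "((\<lambda>s. p (x - s *\<^sub>R v)) has_real_derivative - (G (x - s *\<^sub>R v) \<bullet> v)) (at s)" for x s
  proof -
    have "((\<lambda>s. p (x - s *\<^sub>R v)) has_derivative (\<lambda>h. (- (h *\<^sub>R v)) \<bullet> G (x - s *\<^sub>R v))) (at s)"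
      by (rule has_derivative_compose[of "\<lambda>s. x - s *\<^sub>R v"])
         (use p in \<open>auto simp: gderiv_def intro!: derivative_eq_intros\<close>)
    then show ?thesis
      unfolding has_field_derivative_def
      by (rule has_derivative_eq_rhs) (simp add: fun_eq_iff inner_commute)
  qed
  define K where "K = (\<lambda>(x, s). x - s *\<^sub>R v) ` (T \<times> {0..1})"
  have "compact K" unfolding K_def
    by (auto intro!: compact_continuous_image compact_Times compact_cell continuous_intros simp: split_beta)
  then have "bounded (G ` K)"
    by (intro compact_imp_bounded compact_continuous_image continuous_on_subset[OF G]) auto
  then obtain B where B: "\<And>x. x \<in> K \<Longrightarrow> norm (G x) \<le> B" by (auto simp: bounded_iff)
  have "(\<lambda>n. \<integral>x. indicator T x * ((p (x - t n *\<^sub>R v) - p x) / t n) \<partial>lborel)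
      \<longlonglongrightarrow> (\<integral>x. indicator T x * - (G x \<bullet> v) \<partial>lborel)"
  proof (rule integral_dominated_convergence[where w = "\<lambda>x. indicator T x *\<^sub>R (B * norm v)"])
    show "integrable lborel (\<lambda>x. indicator T x *\<^sub>R (B * norm v))"
      by (rule borel_integrable_compact[OF compact_cell continuous_on_const])
    show "AE x in lborel. (\<lambda>n. indicator T x * ((p (x - t n *\<^sub>R v) - p x) / t n)) \<longlonglongrightarrow> indicator T x * - (G x \<bullet> v)"
    proof (intro AE_I2 tendsto_mult tendsto_const)
      fix x
      have "((\<lambda>h. (p (x - h *\<^sub>R v) - p x) / h) \<longlongrightarrow> - (G x \<bullet> v)) (at 0)"
        using der[of x 0] by (simp add: DERIV_def)
      moreover have "filterlim t (at 0) sequentially"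
        using t(1) t(2) by (auto simp: filterlim_at less_imp_neq[symmetric])
      ultimately show "(\<lambda>n. (p (x - t n *\<^sub>R v) - p x) / t n) \<longlonglongrightarrow> - (G x \<bullet> v)"
        by (rule filterlim_compose)
    qed
    show "AE x in lborel. norm (indicator T x * ((p (x - t n *\<^sub>R v) - p x) / t n)) \<le> indicator T x *\<^sub>R (B * norm v)" for n
    proof (intro AE_I2)
      fix x
      show "norm (indicator T x * ((p (x - t n *\<^sub>R v) - p x) / t n)) \<le> indicator T x *\<^sub>R (B * norm v)"
      proof (cases "x \<in> T")
        case True
        obtain z where z: "0 < z" "z < t n"
          "p (x - t n *\<^sub>R v) - p (x - 0 *\<^sub>R v) = (t n - 0) * - (G (x - z *\<^sub>R v) \<bullet> v)"
          using MVT2[OF t(2) der, of n x] by blast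
        have "x - z *\<^sub>R v \<in> K" unfolding K_def
          using True z t(3)[of n] by (intro image_eqI[of _ _ "(x, z)"]) auto
        then have "\<bar>G (x - z *\<^sub>R v) \<bullet> v\<bar> \<le> B * norm v"
          using Cauchy_Schwarz_ineq2[of "G (x - z *\<^sub>R v)" v] B mult_right_mono[of "norm (G (x - z *\<^sub>R v))" B "norm v"]
          by force
        then show ?thesis using z t(2)[of n] True by simp
      qed simp
    qed
  qed measurable
  then show ?thesis by (simp only: times_divide_eq_right integral_divide_zero mult_minus_right
        Bochner_Integration.integral_minus)
qed

text \<open>Compare the cell with its translate by \<open>t v\<close>: divided by \<open>t\<close>, the difference of the integrals of
  \<open>p\<close> tends to the integral of the directional derivative, whereas the prisms over the faces
  contribute the surface integrals weighted with \<open>v \<bullet> n\<close>.\<close>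

theorem divergence_theorem:
  fixes p :: "real^'n \<Rightarrow> real"
  assumes p: "\<And>x. GDERIV p x :> G x" and G: "continuous_on UNIV G"
  shows "(LINT x:T|lebesgue. G x \<bullet> v) = (\<Sum>e\<in>F. (v \<bullet> n e) * (LINT y:e|surface e. p y))"
proof -
  \<comment> \<open>Any null sequence in \<open>(0, 1]\<close> would do.\<close>
  define t where "t m = inverse (real (Suc m))" for m
  have t: "t \<longlonglongrightarrow> 0" "\<And>m. 0 < t m" "\<And>m. t m \<le> 1"
    unfolding t_def using LIMSEQ_inverse_real_of_nat by (auto simp: field_simps)
  have pc: "continuous_on UNIV p"
    using p by (auto simp: gderiv_def intro!: continuous_at_imp_continuous_on has_derivative_continuous)
  let ?S = "\<lambda>e t. {x. \<exists>s\<in>{0..t}. x + s *\<^sub>R v \<in> e}"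
  have face_lim: "(\<lambda>m. sgn (v \<bullet> n e) * ((\<integral>x. indicator (?S e (t m)) x * p x \<partial>lborel) / t m))
      \<longlonglongrightarrow> (v \<bullet> n e) * (LINT y:e|surface e. p y)" if e: "e \<in> F" for e
  proof (cases "v \<bullet> n e = 0")
    case False
    obtain a where "a \<in> e" using rel_interior_face_ne[OF e] rel_interior_subset by blast
    then interpret flat_face e "n e" a by (rule flat_face[OF e])
    have "(\<lambda>m. sgn (v \<bullet> n e) * ((\<integral>x. indicator (?S e (t m)) x * p x \<partial>lborel) / t m))
      \<longlonglongrightarrow> sgn (v \<bullet> n e) * (\<bar>v \<bullet> n e\<bar> * (LINT y:e|surface e. p y))"
      by (intro tendsto_mult tendsto_const sweep_limit[OF False pc t])
    then show ?thesis by (simp only: mult.assoc[symmetric] sgn_mult_abs)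
  qed simp
  have "(\<lambda>m. (\<integral>x. indicator T x * (p (x - t m *\<^sub>R v) - p x) \<partial>lborel) / t m)
      \<longlonglongrightarrow> - (\<Sum>e\<in>F. (v \<bullet> n e) * (LINT y:e|surface e. p y))"
    using tendsto_minus[OF tendsto_sum[OF face_lim]] t(2)
    by (simp add: integral_translation_difference[OF less_imp_le pc] sum_divide_distrib)
  then have "(\<integral>x. indicator T x * (G x \<bullet> v) \<partial>lborel) = (\<Sum>e\<in>F. (v \<bullet> n e) * (LINT y:e|surface e. p y))"
    using LIMSEQ_unique[OF difference_quotient_limit[OF p G t]] by fastforce
  moreover have "(LINT x:T|lebesgue. G x \<bullet> v) = (\<integral>x. indicator T x * (G x \<bullet> v) \<partial>lborel)"
  proof -
    have "G \<in> borel_measurable borel" "T \<in> sets borel"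
      using G closed_cell by (auto intro: borel_measurable_continuous_onI)
    then have "(\<lambda>x. indicator T x * (G x \<bullet> v)) \<in> borel_measurable lborel" by measurable
    then show ?thesis by (simp add: set_lebesgue_integral_def integral_completion)
  qed
  ultimately show ?thesis by simp
qed

end

section \<open>Inner products and projections\<close>

text \<open>The stabilized form is assembled from inner products by pull-back, scaling and summation, so that
  bilinearity, symmetry and nonnegativity need not be checked for it as a whole.\<close>

lemma psd_form_pullback:
  assumes "psd_form U B" "subspace V"
    and "\<And>x. x \<in> V \<Longrightarrow> f x \<in> U"
    and "\<And>x y. \<lbrakk>x \<in> V; y \<in> V\<rbrakk> \<Longrightarrow> f (x + y) = f x + f y"
    and "\<And>c x. x \<in> V \<Longrightarrow> f (c *\<^sub>R x) = c *\<^sub>R f x"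
  shows "psd_form V (\<lambda>x y. B (f x) (f y))"
proof -
  interpret psd_form U B by fact
  show ?thesis
    using assms(2-5) by unfold_locales (auto simp: add_left scale_left nonneg intro: sym)
qed

lemma psd_form_add:
  assumes "psd_form V B" "psd_form V C"
  shows "psd_form V (\<lambda>x y. B x y + C x y)"
proof -
  interpret B: psd_form V B by fact
  interpret C: psd_form V C by fact
  show ?thesis
    by unfold_locales
      (auto simp: B.subspace B.add_left C.add_left B.scale_left C.scale_left distrib_left B.nonneg C.nonneg
        intro!: arg_cong2[of _ _ _ _ "(+)"] B.sym C.sym)
qed

lemma psd_form_scale:
  assumes "psd_form V B" "0 \<le> c"
  shows "psd_form V (\<lambda>x y. c * B x y)"
proof -
  interpret B: psd_form V B by fact
  show ?thesis
    using assms(2) by unfold_locales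
      (auto simp: B.subspace B.add_left B.scale_left distrib_left B.nonneg intro!: arg_cong2[of _ _ _ _ "(*)"] B.sym)
qed

lemma psd_form_sum:
  assumes "\<And>i. i \<in> I \<Longrightarrow> psd_form V (B i)" "subspace V"
  shows "psd_form V (\<lambda>x y. \<Sum>i\<in>I. B i x y)"
  using assms(1)
proof (induction I rule: infinite_finite_induct)
  case (insert i I)
  then show ?case using psd_form_add[of V "B i" "\<lambda>x y. \<Sum>i\<in>I. B i x y"] by simp
qed (use assms(2) in \<open>unfold_locales, auto\<close>)

definition bilinear_on :: "'a::real_vector set \<Rightarrow> 'b::real_vector set \<Rightarrow> ('a \<Rightarrow> 'b \<Rightarrow> real) \<Rightarrow> bool" where
  "bilinear_on V W b \<longleftrightarrow>
     (\<forall>x\<in>V. \<forall>y\<in>V. \<forall>z\<in>W. b (x + y) z = b x z + b y z) \<and>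
     (\<forall>x\<in>V. \<forall>z\<in>W. \<forall>c. b (c *\<^sub>R x) z = c * b x z) \<and>
     (\<forall>z\<in>V. \<forall>x\<in>W. \<forall>y\<in>W. b z (x + y) = b z x + b z y) \<and>
     (\<forall>z\<in>V. \<forall>x\<in>W. \<forall>c. b z (c *\<^sub>R x) = c * b z x)"

lemma (in psd_form) bilinear_pullback:
  assumes "\<And>x. x \<in> U \<Longrightarrow> f x \<in> V" "\<And>y. y \<in> W \<Longrightarrow> g y \<in> V"
    and "\<And>x y. \<lbrakk>x \<in> U; y \<in> U\<rbrakk> \<Longrightarrow> f (x + y) = f x + f y" "\<And>c x. x \<in> U \<Longrightarrow> f (c *\<^sub>R x) = c *\<^sub>R f x"
    and "\<And>x y. \<lbrakk>x \<in> W; y \<in> W\<rbrakk> \<Longrightarrow> g (x + y) = g x + g y" "\<And>c x. x \<in> W \<Longrightarrow> g (c *\<^sub>R x) = c *\<^sub>R g x"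
  shows "bilinear_on U W (\<lambda>x y. B (f x) (g y))"
  using assms by (simp add: bilinear_on_def add_left add_right scale_left scale_right)

lemma bilinear_on_sum:
  "(\<And>i. i \<in> I \<Longrightarrow> bilinear_on V W (b i)) \<Longrightarrow> bilinear_on V W (\<lambda>x y. \<Sum>i\<in>I. b i x y)"
  by (simp add: bilinear_on_def sum.distrib sum_distrib_left)

lemma bilinear_on_combine:
  "\<lbrakk>bilinear_on V W a; bilinear_on V W b; bilinear_on V W c\<rbrakk> \<Longrightarrow> bilinear_on V W (\<lambda>x y. a x y - b x y + c x y)"
  by (simp add: bilinear_on_def algebra_simps)

lemma subspace_continuous: "subspace {g :: 'a::topological_space \<Rightarrow> real. continuous_on S g}"
  by (auto simp: subspace_def zero_fun_def plus_fun_def scaleR_fun_def intro!: continuous_intros)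

lemma open_AE_empty:
  fixes U :: "(real^'n) set"
  assumes "open U" "AE x in lborel. x \<notin> U"
  shows "U = {}"
proof -
  have "U \<in> null_sets lborel" using assms AE_iff_null_sets[of U lborel] by simp
  then have "negligible U" by (simp add: negligible_iff_null_sets null_sets_completionI)
  then show ?thesis using open_not_negligible[OF assms(1)] by blast
qed

lemma set_integrable_compact:
  fixes g :: "real^'n \<Rightarrow> real"
  assumes "compact T" "continuous_on T g"
  shows "set_integrable lebesgue T g"
  using borel_integrable_compact[OF assms] unfolding set_integrable_def
  by (subst integrable_completion) (auto intro: borel_measurable_integrable)

lemma psd_inner_cell:
  fixes T :: "(real^'n) set"
  assumes "compact T"
  shows "psd_form {g. continuous_on T g} (inner_cell T)"
proof
  show "inner_cell T (x + y) z = inner_cell T x z + inner_cell T y z"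
    if "x \<in> {g. continuous_on T g}" "y \<in> {g. continuous_on T g}" "z \<in> {g. continuous_on T g}" for x y z
    using that unfolding inner_cell_def plus_fun_apply distrib_right
    by (intro set_integral_add set_integrable_compact[OF assms] continuous_intros) auto
  show "inner_cell T (c *\<^sub>R x) z = c * inner_cell T x z" for c x z
    by (simp add: inner_cell_def mult.assoc)
  show "inner_cell T x y = inner_cell T y x" for x y by (simp add: inner_cell_def mult.commute)
  show "0 \<le> inner_cell T x x" for x
    unfolding inner_cell_def set_lebesgue_integral_def by (intro Bochner_Integration.integral_nonneg) auto
qed (rule subspace_continuous)

lemma inner_cell_definite:
  fixes T :: "(real^'n) set"
  assumes T: "compact T" "interior T \<noteq> {}" and p: "p \<in> polys r" and 0: "inner_cell T p p = 0"
  shows "p = (\<lambda>_. 0)"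
proof (rule polys_zero_on_open[OF p open_interior T(2)])
  have pc: "continuous_on UNIV p" using p by blast
  have pp: "continuous_on T (\<lambda>x. p x * p x)"
    by (intro continuous_intros continuous_on_subset[OF pc]) auto
  have "integrable lborel (\<lambda>x. indicator T x *\<^sub>R (p x * p x))" by (rule borel_integrable_compact[OF T(1) pp])
  moreover from borel_measurable_integrable[OF this]
  have "(\<integral>x. indicator T x *\<^sub>R (p x * p x) \<partial>lborel) = 0"
    using 0 unfolding inner_cell_def set_lebesgue_integral_def by (simp only: integral_completion)
  ultimately have "AE x in lborel. indicator T x *\<^sub>R (p x * p x) = 0"
    by (subst (asm) integral_nonneg_eq_0_iff_AE) auto
  then have "AE x in lborel. x \<notin> interior T \<inter> {x. p x \<noteq> 0}"
    by eventually_elim (use interior_subset[of T] in \<open>auto simp: indicator_def\<close>)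
  moreover have "open (interior T \<inter> {x. p x \<noteq> 0})"
    using pc by (intro open_Int open_interior open_Collect_neq continuous_intros) auto
  ultimately have "interior T \<inter> {x. p x \<noteq> 0} = {}" using open_AE_empty by blast
  then show "x \<in> interior T \<Longrightarrow> p x = 0" for x by blast
qed

context flat_face
begin

lemma borel_measurable_on_face:
  fixes g :: "real^'n \<Rightarrow> real"
  assumes "continuous_on e g"
  shows "(\<lambda>x. indicator e x *\<^sub>R g x) \<in> borel_measurable borel"
  using assms borel_face by (rule borel_measurable_continuous_on_indicator[rotated])

lemma set_integrable_face:
  fixes g :: "real^'n \<Rightarrow> real"
  assumes "continuous_on e g"
  shows "set_integrable (surface e) e g"
proof -
  have "bounded (g ` e)" using compact_imp_bounded[OF compact_continuous_image[OF assms compact]] .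
  then obtain B where B: "\<And>x. x \<in> e \<Longrightarrow> \<bar>g x\<bar> \<le> B" by (auto simp: bounded_iff)
  show ?thesis unfolding set_integrable_def
    by (rule integrableI_bounded_set[of e _ _ B])
       (use B surface_finite borel_measurable_on_face[OF assms] in \<open>auto cong: measurable_cong_sets\<close>)
qed

lemma psd_inner_face: "psd_form {g. continuous_on e g} (inner_face e)"
proof
  show "inner_face e (x + y) z = inner_face e x z + inner_face e y z"
    if "x \<in> {g. continuous_on e g}" "y \<in> {g. continuous_on e g}" "z \<in> {g. continuous_on e g}" for x y z
    using that unfolding inner_face_def plus_fun_apply distrib_right
    by (intro set_integral_add set_integrable_face continuous_intros) auto
  show "inner_face e (c *\<^sub>R x) z = c * inner_face e x z" for c x z
    by (simp add: inner_face_def mult.assoc)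
  show "inner_face e x y = inner_face e y x" for x y by (simp add: inner_face_def mult.commute)
  show "0 \<le> inner_face e x x" for x
    unfolding inner_face_def set_lebesgue_integral_def by (intro Bochner_Integration.integral_nonneg) auto
qed (rule subspace_continuous)

text \<open>If \<open>g\<close> does not vanish at a relative interior point, the points of the slab that are projected to
  a small relative neighbourhood of it form an open set, which has positive measure.\<close>

lemma inner_face_definite:
  assumes g: "continuous_on e g" and 0: "inner_face e g g = 0" and x: "x \<in> rel_interior e"
  shows "g x = 0"
proof (rule ccontr)
  assume gx: "g x \<noteq> 0"
  have xe: "x \<in> e" using x rel_interior_subset by blast
  have gg: "continuous_on e (\<lambda>x. g x * g x)" using g by (intro continuous_intros)
  note gm = borel_measurable_on_face[OF gg]
  have "integrable (surface e) (\<lambda>y. indicator e y *\<^sub>R (g y * g y))"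
    using set_integrable_face[OF gg] by (simp add: set_integrable_def)
  moreover have "(\<integral>y. indicator e y *\<^sub>R (g y * g y) \<partial>surface e) = 0"
    using 0 by (simp add: inner_face_def set_lebesgue_integral_def)
  ultimately have "AE y in surface e. indicator e y *\<^sub>R (g y * g y) = 0"
    by (subst (asm) integral_nonneg_eq_0_iff_AE) auto
  then have "AE z in restrict_space lborel {x. height a \<nu> x \<in> slab}.
      indicator e (skew a \<nu> \<nu> z) *\<^sub>R (g (skew a \<nu> \<nu> z) * g (skew a \<nu> \<nu> z)) = 0"
    unfolding surface_eq by (rule AE_distrD[OF measurable_surface_source])
  then have ae: "AE z in lborel. height a \<nu> z \<in> slab \<longrightarrow>
      indicator e (skew a \<nu> \<nu> z) *\<^sub>R (g (skew a \<nu> \<nu> z) * g (skew a \<nu> \<nu> z)) = 0"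
    by (subst (asm) AE_restrict_space_iff) (auto simp: sets_slab_region)
  obtain O1 where O1: "open O1" "x \<in> O1" "O1 \<inter> affine hull e \<subseteq> e"
    using x by (auto simp: mem_rel_interior)
  have "openin (top_of_set e) (e \<inter> g -` (- {0}))"
    using g by (intro continuous_openin_preimage_gen) auto
  then obtain O2 where O2: "open O2" "e \<inter> g -` (- {0}) = e \<inter> O2" by (auto simp: openin_open)
  define U where "U = height a \<nu> -` {-1/2<..<1/2} \<inter> skew a \<nu> \<nu> -` (O1 \<inter> O2)"
  have ch: "continuous_on UNIV (height a \<nu>)" "continuous_on UNIV (skew a \<nu> \<nu>)"
    unfolding skew_def[abs_def] height_def[abs_def] by (intro continuous_intros)+
  have "open U" unfolding U_def using O1 O2 ch by (intro open_Int open_vimage) auto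
  moreover have "AE z in lborel. z \<notin> U"
    using ae
  proof eventually_elim
    case (elim z)
    show ?case
    proof
      assume z: "z \<in> U"
      then have "skew a \<nu> \<nu> z \<in> O1 \<inter> affine hull e" by (simp add: U_def hull height_skew)
      then have ze: "skew a \<nu> \<nu> z \<in> e" using O1 by blast
      then have "g (skew a \<nu> \<nu> z) \<noteq> 0" using z O2(2) by (auto simp: U_def)
      moreover have "height a \<nu> z \<in> slab" using z by (auto simp: U_def slab_def)
      ultimately show False using elim ze by simp
    qed
  qed
  ultimately have "U = {}" by (rule open_AE_empty)
  moreover have "x \<in> U"
    using height_zero[OF xe] O1(2) O2(2) gx xe by (auto simp: U_def skew_def)
  ultimately show False by blast
qed

end

lemma inner_face_cong:
  assumes "\<And>x. x \<in> e \<Longrightarrow> g x = g' x" "\<And>x. x \<in> e \<Longrightarrow> h x = h' x"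
  shows "inner_face e g h = inner_face e g' h'"
  unfolding inner_face_def set_lebesgue_integral_def
  using assms by (intro Bochner_Integration.integral_cong) (auto simp: indicator_def)

definition restrict_fun :: "'a set \<Rightarrow> ('a \<Rightarrow> real) \<Rightarrow> 'a \<Rightarrow> real" where
  "restrict_fun e p = (\<lambda>x. if x \<in> e then p x else 0)"

lemma linear_restrict_fun: "linear (restrict_fun e)"
  by (rule linearI) (auto simp: restrict_fun_def fun_eq_iff)

lemma face_polys_eq_image: "face_polys r e = restrict_fun e ` polys r"
  by (auto simp: face_polys_def restrict_fun_def)

text \<open>Polynomials on a face are a finite-dimensional space because extension by zero is linear.\<close>

lemma face_polys_eq_span: "face_polys r e = span (restrict_fun e ` monomial ` exponents r)"
  by (simp add: face_polys_eq_image polys_eq_span linear_span_image[OF linear_restrict_fun])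

lemma subspace_face_polys: "subspace (face_polys r e)"
  by (simp add: face_polys_eq_span)

lemma continuous_face_polys: "q \<in> face_polys r e \<Longrightarrow> continuous_on e q"
proof -
  assume "q \<in> face_polys r e"
  then obtain p where p: "p \<in> polys r" "q = (\<lambda>x. if x \<in> e then p x else 0)"
    by (auto simp: face_polys_def)
  have "continuous_on e p" using p(1) by blast
  then show ?thesis using p(2) by (simp cong: continuous_on_cong)
qed

text \<open>A face as it occurs in a mesh: it is the closure of its relative interior, so continuous
  functions that vanish there vanish on the face.\<close>

locale mesh_face = flat_face +
  assumes closure_rel_interior: "closure (rel_interior e) = e"
begin

lemma inner_face_definite_closed:
  assumes g: "continuous_on e g" and 0: "inner_face e g g = 0" and x: "x \<in> e"
  shows "g x = 0"
proof -
  have "x \<in> closure (rel_interior e)" using x closure_rel_interior by simp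
  then show ?thesis
    using continuous_constant_on_closure[of "rel_interior e" g 0 x] g inner_face_definite[OF g 0]
      closure_rel_interior by simp
qed

lemma L2_proj_face_exists:
  assumes "continuous_on e g"
  shows "\<exists>!q. q \<in> face_polys r e \<and> (\<forall>p\<in>face_polys r e. inner_face e q p = inner_face e g p)"
proof -
  interpret I: psd_form "{g. continuous_on e g}" "inner_face e" by (rule psd_inner_face)
  have sub: "face_polys r e \<subseteq> {g. continuous_on e g}" using continuous_face_polys by blast
  show ?thesis
  proof (rule riesz_unique[OF _ face_polys_eq_span])
    show "psd_form (face_polys r e) (inner_face e)"
      by (rule psd_form_subspace[OF psd_inner_face subspace_face_polys sub])
    show "q = 0" if q: "q \<in> face_polys r e" "inner_face e q q = 0" for q
    proof
      fix x
      show "q x = 0 x"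
        using inner_face_definite_closed[OF continuous_face_polys[OF q(1)] q(2), of x] q(1)
        by (cases "x \<in> e") (auto simp: face_polys_def)
    qed
  qed (use assms sub in \<open>auto simp: subset_iff I.add_right I.scale_right\<close>)
qed

lemma L2_proj_face:
  assumes "continuous_on e g"
  shows "L2_proj_face r e g \<in> face_polys r e"
    and "p \<in> face_polys r e \<Longrightarrow> inner_face e (L2_proj_face r e g) p = inner_face e g p"
  using theI'[OF L2_proj_face_exists[OF assms, where r = r]] unfolding L2_proj_face_def by blast+

lemma continuous_L2_proj_face: "continuous_on e g \<Longrightarrow> continuous_on e (L2_proj_face r e g)"
  by (rule continuous_face_polys[OF L2_proj_face(1)])

lemma L2_proj_face_unique:
  assumes "continuous_on e g" "q \<in> face_polys r e"
    and "\<And>p. p \<in> face_polys r e \<Longrightarrow> inner_face e q p = inner_face e g p"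
  shows "L2_proj_face r e g = q"
  using L2_proj_face_exists[OF assms(1), where r = r] L2_proj_face[OF assms(1), where r = r] assms(2,3) by blast

lemma L2_proj_face_add:
  assumes "continuous_on e g" "continuous_on e h"
  shows "L2_proj_face r e (g + h) = L2_proj_face r e g + L2_proj_face r e h"
proof -
  interpret I: psd_form "{g. continuous_on e g}" "inner_face e" by (rule psd_inner_face)
  show ?thesis
  proof (rule L2_proj_face_unique)
    show "continuous_on e (g + h)" using I.closed(2)[of g h] assms by simp
    show "L2_proj_face r e g + L2_proj_face r e h \<in> face_polys r e"
      using assms by (intro subspace_add subspace_face_polys L2_proj_face)
    show "inner_face e (L2_proj_face r e g + L2_proj_face r e h) p = inner_face e (g + h) p"
      if p: "p \<in> face_polys r e" for p
      using assms continuous_face_polys[OF p] continuous_L2_proj_face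
      by (simp add: I.add_left L2_proj_face(2) p)
  qed
qed

lemma L2_proj_face_scale:
  assumes "continuous_on e g"
  shows "L2_proj_face r e (c *\<^sub>R g) = c *\<^sub>R L2_proj_face r e g"
proof -
  interpret I: psd_form "{g. continuous_on e g}" "inner_face e" by (rule psd_inner_face)
  show ?thesis
  proof (rule L2_proj_face_unique)
    show "continuous_on e (c *\<^sub>R g)" using I.closed(3)[of g c] assms by simp
    show "c *\<^sub>R L2_proj_face r e g \<in> face_polys r e"
      using assms by (intro subspace_scale subspace_face_polys L2_proj_face)
    show "inner_face e (c *\<^sub>R L2_proj_face r e g) p = inner_face e (c *\<^sub>R g) p"
      if p: "p \<in> face_polys r e" for p
      using assms continuous_face_polys[OF p] continuous_L2_proj_face
      by (simp add: I.scale_left L2_proj_face(2) p)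
  qed
qed

lemma L2_proj_face_restrict:
  assumes "p \<in> polys r"
  shows "L2_proj_face r e p = restrict_fun e p"
  by (rule L2_proj_face_unique)
     (use assms in \<open>auto simp: face_polys_eq_image restrict_fun_def intro: inner_face_cong\<close>)

end

section \<open>Weak functions and the stabilized form\<close>

lemma grad_plus: "p \<in> polys r \<Longrightarrow> q \<in> polys s \<Longrightarrow> grad (p + q) x = grad p x + grad q x"
  unfolding plus_fun_def by (rule grad_add)

lemma grad_scaleR: "p \<in> polys r \<Longrightarrow> grad (c *\<^sub>R p) x = c *\<^sub>R grad p x"
  using grad_scale[of p r c x] by (simp add: scaleR_fun_def)

lemma laplacian_plus: "p \<in> polys r \<Longrightarrow> q \<in> polys r \<Longrightarrow> laplacian (p + q) = laplacian p + laplacian q"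
  using laplacian_add[of p r q] by (simp add: plus_fun_def fun_eq_iff)

lemma laplacian_scaleR: "p \<in> polys r \<Longrightarrow> laplacian (c *\<^sub>R p) = c *\<^sub>R laplacian p"
  using laplacian_scale[of p r c] by (simp add: scaleR_fun_def fun_eq_iff)

text \<open>Weak functions as vectors: triples of families inherit the linear structure that the datatype
  lacks.\<close>

definition weak :: "('n::finite) family \<times> 'n family \<times> 'n family \<Rightarrow> 'n weak_fun" where
  "weak x = WF (fst x) (fst (snd x)) (snd (snd x))"

lemma weak_sel [simp]:
  "wf0 (weak x) = fst x" "wfb (weak x) = fst (snd x)" "wfn (weak x) = snd (snd x)"
  by (simp_all add: weak_def)

lemma weak_exhaust: "\<exists>x. v = weak x"
  by (cases v) (auto simp: weak_def)

locale mesh_setting =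
  fixes k :: nat and \<Omega> :: "(real^'n) set" and M :: "('n::finite) mesh"
  assumes k: "2 \<le> k" and domain: "polyhedral_domain \<Omega>" and mesh: "polyhedral_mesh \<Omega> M"
begin

lemma finite_cells [simp]: "finite (cells M)" and finite_mesh_faces [simp]: "finite (faces M)"
  using mesh by (auto simp: polyhedral_mesh_def)

lemma cell: "T \<in> cells M \<Longrightarrow> polyhedral_cell T (cell_faces M T)"
  by (rule mesh_cell[OF mesh])

lemma cell_faces_subset: "e \<in> cell_faces M T \<Longrightarrow> e \<in> faces M"
  by (simp add: cell_faces_def)

lemma finite_cell_faces [simp]: "finite (cell_faces M T)"
  by (simp add: cell_faces_def)

lemma compact_cell: "T \<in> cells M \<Longrightarrow> compact T"
  using polyhedral_cell.compact_cell[OF cell] .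

lemma interior_cell: "T \<in> cells M \<Longrightarrow> interior T \<noteq> {}"
  using polyhedral_set_full(3)[OF polyhedral_cell.cell[OF cell]] .

lemma mesh_face:
  assumes "e \<in> faces M"
  shows "\<exists>a. mesh_face e (normal M e) a"
proof -
  obtain T where T: "T \<in> cells M" "e \<in> cell_faces M T"
    using mesh assms by (auto simp: polyhedral_mesh_def)
  interpret polyhedral_cell T "cell_faces M T" using cell T by blast
  obtain a where a: "a \<in> e" using rel_interior_face_ne[OF T(2)] rel_interior_subset by blast
  have nu: "unit_normal_to e (normal M e)" using mesh assms by (auto simp: polyhedral_mesh_def)
  have "mesh_face e (normal M e) a"
  proof
    show "compact e" by (rule compact_face[OF T(2)])
    show "affine hull e = {y. height a (normal M e) y = 0}"
      using unit_normal_affine_hull[OF nu aff_dim_face[OF T(2)]] a hull_inc[of a e affine]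
      by (auto simp: height_def)
    show "norm (normal M e) = 1" using nu by (simp add: unit_normal_to_def)
    show "closure (rel_interior e) = e" by (rule closure_rel_interior_face[OF T(2)])
  qed
  then show ?thesis by blast
qed

lemma psd_face: "e \<in> faces M \<Longrightarrow> psd_form {g. continuous_on e g} (inner_face e)"
  using mesh_face[of e] flat_face.psd_inner_face mesh_face.axioms(1) by blast

lemma psd_cell: "T \<in> cells M \<Longrightarrow> psd_form {g. continuous_on T g} (inner_cell T)"
  by (rule psd_inner_cell[OF compact_cell])

lemma face_definite:
  "\<lbrakk>e \<in> faces M; continuous_on e g; inner_face e g g = 0; x \<in> e\<rbrakk> \<Longrightarrow> g x = 0"
  using mesh_face[of e] mesh_face.inner_face_definite_closed by blast

lemma cell_definite: "\<lbrakk>T \<in> cells M; p \<in> polys r; inner_cell T p p = 0\<rbrakk> \<Longrightarrow> p = (\<lambda>_. 0)"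
  by (rule inner_cell_definite[OF compact_cell interior_cell])

lemma projection:
  assumes "e \<in> faces M" "continuous_on e g"
  shows "L2_proj_face r e g \<in> face_polys r e" "continuous_on e (L2_proj_face r e g)"
    "p \<in> polys r \<Longrightarrow> inner_face e (L2_proj_face r e g) p = inner_face e g p"
proof -
  obtain a where "mesh_face e (normal M e) a" using mesh_face[OF assms(1)] by blast
  then interpret mesh_face e "normal M e" a .
  show "L2_proj_face r e g \<in> face_polys r e" "continuous_on e (L2_proj_face r e g)"
    using assms(2) by (rule L2_proj_face, rule continuous_L2_proj_face)
  show "inner_face e (L2_proj_face r e g) p = inner_face e g p" if "p \<in> polys r"
  proof -
    have r: "restrict_fun e p \<in> face_polys r e" using that by (simp add: face_polys_eq_image)
    have "inner_face e q p = inner_face e q (restrict_fun e p)" for q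
      by (rule inner_face_cong) (simp_all add: restrict_fun_def)
    then show ?thesis using L2_proj_face(2)[OF assms(2) r] by simp
  qed
qed

lemma projection_linear:
  assumes "e \<in> faces M" "continuous_on e g" "continuous_on e h"
  shows "L2_proj_face r e (g + h) = L2_proj_face r e g + L2_proj_face r e h"
    and "L2_proj_face r e (c *\<^sub>R g) = c *\<^sub>R L2_proj_face r e g"
  using mesh_face[OF assms(1)] mesh_face.L2_proj_face_add mesh_face.L2_proj_face_scale assms(2,3) by blast+

lemma projection_restrict: "\<lbrakk>e \<in> faces M; p \<in> polys r\<rbrakk> \<Longrightarrow> L2_proj_face r e p = restrict_fun e p"
  using mesh_face[of e] mesh_face.L2_proj_face_restrict by blast

lemma diameter_pos: "T \<in> cells M \<Longrightarrow> 0 < diameter T"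
proof -
  assume T: "T \<in> cells M"
  then obtain x \<delta> where x: "\<delta> > 0" "ball x \<delta> \<subseteq> T" using interior_cell[OF T] by (auto simp: mem_interior)
  define y where "y = x + (\<delta> / 2) *\<^sub>R axis undefined 1"
  have d: "dist x y = \<delta> / 2" using x(1) by (simp add: y_def dist_norm norm_axis_1)
  then have "x \<in> T" "y \<in> T" using x by (auto simp: subset_iff)
  then have "dist x y \<le> diameter T"
    using compact_imp_bounded[OF compact_cell[OF T]] by (rule diameter_bounded_bound[rotated])
  then show ?thesis using d x(1) by simp
qed

definition weak_space :: "('n family \<times> 'n family \<times> 'n family) set" where
  "weak_space = {x. weak x \<in> Vh k M}"

definition weak_space0 :: "('n family \<times> 'n family \<times> 'n family) set" where
  "weak_space0 = {x. weak x \<in> Vh0 k \<Omega> M}"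

lemma weak_space_iff: "x \<in> weak_space \<longleftrightarrow>
     (\<forall>T\<in>cells M. fst x T \<in> polys k) \<and>
     (\<forall>e\<in>faces M. fst (snd x) e \<in> face_polys (k - 1) e \<and> snd (snd x) e \<in> face_polys (k - 1) e) \<and>
     (\<forall>T. T \<notin> cells M \<longrightarrow> fst x T = 0) \<and>
     (\<forall>e. e \<notin> faces M \<longrightarrow> fst (snd x) e = 0 \<and> snd (snd x) e = 0)"
  by (simp add: weak_space_def Vh_def zero_fun_def)

lemma weak_space0_iff: "x \<in> weak_space0 \<longleftrightarrow> x \<in> weak_space \<and>
     (\<forall>e\<in>faces M. e \<subseteq> frontier \<Omega> \<longrightarrow> fst (snd x) e = 0 \<and> snd (snd x) e = 0)"
  by (simp add: weak_space0_def weak_space_def Vh0_def zero_fun_def)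

lemma subspace_weak_space: "subspace weak_space"
  unfolding subspace_def
proof (intro conjI ballI allI)
  show "0 \<in> weak_space"
    by (simp add: weak_space_iff subspace_0 subspace_polys subspace_face_polys)
  show "x + y \<in> weak_space" if "x \<in> weak_space" "y \<in> weak_space" for x y
    using that by (simp add: weak_space_iff subspace_add subspace_polys subspace_face_polys)
  show "c *\<^sub>R x \<in> weak_space" if "x \<in> weak_space" for c x
    using that by (simp add: weak_space_iff subspace_scale subspace_polys subspace_face_polys)
qed

lemma subspace_weak_space0: "subspace weak_space0"
  unfolding subspace_def
proof (intro conjI ballI allI)
  show "0 \<in> weak_space0" using subspace_0[OF subspace_weak_space] by (simp add: weak_space0_iff)
  show "x + y \<in> weak_space0" if "x \<in> weak_space0" "y \<in> weak_space0" for x y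
    using that subspace_add[OF subspace_weak_space] by (simp add: weak_space0_iff)
  show "c *\<^sub>R x \<in> weak_space0" if "x \<in> weak_space0" for c x
    using that subspace_scale[OF subspace_weak_space] by (simp add: weak_space0_iff)
qed

lemma weak_space_continuous:
  assumes "x \<in> weak_space"
  shows "T \<in> cells M \<Longrightarrow> continuous_on S (fst x T)"
    and "e \<in> faces M \<Longrightarrow> continuous_on e (fst (snd x) e)"
    and "e \<in> faces M \<Longrightarrow> continuous_on e (snd (snd x) e)"
  using assms by (auto simp: weak_space_iff intro: continuous_face_polys)

lemma weak_space_polys: "x \<in> weak_space \<Longrightarrow> T \<in> cells M \<Longrightarrow> fst x T \<in> polys k"
  by (simp add: weak_space_iff)

text \<open>The right-hand side of the equation that defines the weak Laplacian.\<close>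

definition laplacian_functional ::
    "(real^'n) set \<Rightarrow> ('n family \<times> 'n family \<times> 'n family) \<Rightarrow> (real^'n \<Rightarrow> real) \<Rightarrow> real" where
  "laplacian_functional T x \<phi> =
     inner_cell T (fst x T) (laplacian \<phi>)
       - (\<Sum>e\<in>cell_faces M T. inner_face e (fst (snd x) e) (\<lambda>y. grad \<phi> y \<bullet> outward_normal T e))
       + (\<Sum>e\<in>cell_faces M T.
            inner_face e (\<lambda>y. snd (snd x) e y * (normal M e \<bullet> outward_normal T e)) \<phi>)"

lemma bilinear_laplacian_functional:
  assumes T: "T \<in> cells M"
  shows "bilinear_on weak_space (polys (k - 2)) (laplacian_functional T)"
proof -
  have contl: "continuous_on S (laplacian \<phi>)" if "\<phi> \<in> polys (k - 2)" for S \<phi>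
    by (rule continuous_polys[OF laplacian_in_polys[OF that]])
  have contg: "continuous_on S (\<lambda>y. grad \<phi> y \<bullet> w)" if "\<phi> \<in> polys (k - 2)" for S \<phi> w
    by (rule continuous_polys[OF grad_inner_in_polys[OF that]])
  have "bilinear_on weak_space (polys (k - 2)) (\<lambda>x \<phi>. inner_cell T (fst x T) (laplacian \<phi>))"
    by (rule psd_form.bilinear_pullback[OF psd_cell[OF T]])
       (simp_all add: weak_space_continuous(1)[OF _ T] contl laplacian_plus[where r = "k - 2"]
         laplacian_scaleR[where r = "k - 2"])
  moreover have "bilinear_on weak_space (polys (k - 2))
      (\<lambda>x \<phi>. inner_face e (fst (snd x) e) (\<lambda>y. grad \<phi> y \<bullet> outward_normal T e))" if "e \<in> cell_faces M T" for e
    by (rule psd_form.bilinear_pullback[OF psd_face[OF cell_faces_subset[OF that]]])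
       (simp_all add: weak_space_continuous(2)[OF _ cell_faces_subset[OF that]] contg fun_eq_iff
         grad_plus[where r = "k - 2" and s = "k - 2"] grad_scaleR[where r = "k - 2"] inner_add_left)
  moreover have "bilinear_on weak_space (polys (k - 2))
      (\<lambda>x \<phi>. inner_face e (\<lambda>y. snd (snd x) e y * (normal M e \<bullet> outward_normal T e)) \<phi>)" if "e \<in> cell_faces M T" for e
    by (rule psd_form.bilinear_pullback[OF psd_face[OF cell_faces_subset[OF that]]])
       (simp_all add: weak_space_continuous(3)[OF _ cell_faces_subset[OF that]] continuous_polys fun_eq_iff
         distrib_right continuous_on_mult_right)
  ultimately show ?thesis
    unfolding laplacian_functional_def[abs_def] by (intro bilinear_on_combine bilinear_on_sum)
qed

lemmas laplacian_functional_linear =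
  bilinear_laplacian_functional[unfolded bilinear_on_def, THEN conjunct1, rule_format]
  bilinear_laplacian_functional[unfolded bilinear_on_def, THEN conjunct2, THEN conjunct1, rule_format]
  bilinear_laplacian_functional[unfolded bilinear_on_def, THEN conjunct2, THEN conjunct2, THEN conjunct1, rule_format]
  bilinear_laplacian_functional[unfolded bilinear_on_def, THEN conjunct2, THEN conjunct2, THEN conjunct2, rule_format]

lemma weak_laplacian_exists:
  assumes T: "T \<in> cells M" and x: "x \<in> weak_space"
  shows "\<exists>!p. p \<in> polys (k - 2) \<and> (\<forall>\<phi>\<in>polys (k - 2). inner_cell T p \<phi> = laplacian_functional T x \<phi>)"
proof (rule riesz_unique[OF _ polys_eq_span])
  have "polys (k - 2) \<subseteq> {g. continuous_on T g}" by blast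
  then show "psd_form (polys (k - 2)) (inner_cell T)"
    by (rule psd_form_subspace[OF psd_cell[OF T] subspace_polys])
  show "p = 0" if "p \<in> polys (k - 2)" "inner_cell T p p = 0" for p
    using cell_definite[OF T that] by (simp add: zero_fun_def)
qed (use laplacian_functional_linear(3,4)[OF T x] in auto)

lemma weak_laplacian:
  assumes T: "T \<in> cells M" and x: "x \<in> weak_space"
  shows "weak_laplacian k M (weak x) T \<in> polys (k - 2)"
    and "\<phi> \<in> polys (k - 2) \<Longrightarrow> inner_cell T (weak_laplacian k M (weak x) T) \<phi> = laplacian_functional T x \<phi>"
  using theI'[OF weak_laplacian_exists[OF assms]]
  unfolding weak_laplacian_def laplacian_functional_def weak_sel by blast+

lemma weak_laplacian_unique:
  assumes T: "T \<in> cells M" and x: "x \<in> weak_space" and "p \<in> polys (k - 2)"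
    and "\<And>\<phi>. \<phi> \<in> polys (k - 2) \<Longrightarrow> inner_cell T p \<phi> = laplacian_functional T x \<phi>"
  shows "weak_laplacian k M (weak x) T = p"
  using weak_laplacian_exists[OF T x] weak_laplacian[OF T x] assms(3,4) by blast

lemma weak_laplacian_add:
  assumes T: "T \<in> cells M" and x: "x \<in> weak_space" and y: "y \<in> weak_space"
  shows "weak_laplacian k M (weak (x + y)) T = weak_laplacian k M (weak x) T + weak_laplacian k M (weak y) T"
proof (rule weak_laplacian_unique[OF T])
  interpret C: psd_form "{g. continuous_on T g}" "inner_cell T" by (rule psd_cell[OF T])
  show "x + y \<in> weak_space" using x y subspace_weak_space by (simp add: subspace_add)
  show "weak_laplacian k M (weak x) T + weak_laplacian k M (weak y) T \<in> polys (k - 2)"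
    using T x y by (intro subspace_add subspace_polys weak_laplacian)
  show "inner_cell T (weak_laplacian k M (weak x) T + weak_laplacian k M (weak y) T) \<phi> =
      laplacian_functional T (x + y) \<phi>" if p: "\<phi> \<in> polys (k - 2)" for \<phi>
    using weak_laplacian[OF T x] weak_laplacian[OF T y] p
    by (subst C.add_left) (auto simp: laplacian_functional_linear(1)[OF T x y p])
qed

lemma weak_laplacian_scale:
  assumes T: "T \<in> cells M" and x: "x \<in> weak_space"
  shows "weak_laplacian k M (weak (c *\<^sub>R x)) T = c *\<^sub>R weak_laplacian k M (weak x) T"
proof (rule weak_laplacian_unique[OF T])
  interpret C: psd_form "{g. continuous_on T g}" "inner_cell T" by (rule psd_cell[OF T])
  show "c *\<^sub>R x \<in> weak_space" using x subspace_weak_space by (simp add: subspace_scale)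
  show "c *\<^sub>R weak_laplacian k M (weak x) T \<in> polys (k - 2)"
    using T x by (intro subspace_scale subspace_polys weak_laplacian)
  show "inner_cell T (c *\<^sub>R weak_laplacian k M (weak x) T) \<phi> =
      laplacian_functional T (c *\<^sub>R x) \<phi>" if p: "\<phi> \<in> polys (k - 2)" for \<phi>
    using weak_laplacian[OF T x] p
    by (subst C.scale_left) (auto simp: laplacian_functional_linear(2)[OF T x p])
qed

abbreviation normal_defect where
  "normal_defect T e x \<equiv> (\<lambda>y. grad (fst x T) y \<bullet> normal M e - snd (snd x) e y)"

abbreviation trace_defect where
  "trace_defect T e x \<equiv> (\<lambda>y. L2_proj_face (k - 1) e (fst x T) y - fst (snd x) e y)"

lemma continuous_defects:
  assumes "T \<in> cells M" "e \<in> faces M" "x \<in> weak_space"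
  shows "continuous_on e (normal_defect T e x)" "continuous_on e (trace_defect T e x)"
proof -
  have "continuous_on e (\<lambda>y. grad (fst x T) y \<bullet> normal M e)"
    using grad_inner_in_polys[OF weak_space_polys[OF assms(3,1)]] by blast
  then show "continuous_on e (normal_defect T e x)" "continuous_on e (trace_defect T e x)"
    using weak_space_continuous[OF assms(3)] assms(1,2) projection(2)
    by (auto intro!: continuous_on_diff)
qed

text \<open>Each summand of \<open>a\<close> is the pull-back of an inner product under a linear map.\<close>

lemma psd_normal_defect:
  assumes T: "T \<in> cells M" and e: "e \<in> faces M"
  shows "psd_form weak_space (\<lambda>x y. inner_face e (normal_defect T e x) (normal_defect T e y))"
proof (rule psd_form_pullback[OF psd_face[OF e] subspace_weak_space])
  show "normal_defect T e x \<in> {g. continuous_on e g}" if "x \<in> weak_space" for x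
    using continuous_defects[OF T e that] by simp
  show "normal_defect T e (x + y) = normal_defect T e x + normal_defect T e y"
    if "x \<in> weak_space" "y \<in> weak_space" for x y
    using grad_plus[OF weak_space_polys[OF that(1) T] weak_space_polys[OF that(2) T]]
    by (simp add: fun_eq_iff inner_add_left)
  show "normal_defect T e (c *\<^sub>R x) = c *\<^sub>R normal_defect T e x" if "x \<in> weak_space" for x c
    using grad_scaleR[OF weak_space_polys[OF that T]] by (simp add: fun_eq_iff right_diff_distrib)
qed

lemma psd_trace_defect:
  assumes T: "T \<in> cells M" and e: "e \<in> faces M"
  shows "psd_form weak_space (\<lambda>x y. inner_face e (trace_defect T e x) (trace_defect T e y))"
proof (rule psd_form_pullback[OF psd_face[OF e] subspace_weak_space])
  show "trace_defect T e x \<in> {g. continuous_on e g}" if "x \<in> weak_space" for x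
    using continuous_defects[OF T e that] by simp
  show "trace_defect T e (x + y) = trace_defect T e x + trace_defect T e y"
    if "x \<in> weak_space" "y \<in> weak_space" for x y
    using projection_linear(1)[OF e weak_space_continuous(1)[OF that(1) T] weak_space_continuous(1)[OF that(2) T]]
    by (simp add: fun_eq_iff)
  show "trace_defect T e (c *\<^sub>R x) = c *\<^sub>R trace_defect T e x" if "x \<in> weak_space" for x c
    using projection_linear(2)[OF e weak_space_continuous(1)[OF that T] weak_space_continuous(1)[OF that T]]
    by (simp add: fun_eq_iff right_diff_distrib)
qed

lemma psd_weak_laplacian:
  assumes T: "T \<in> cells M"
  shows "psd_form weak_space
    (\<lambda>x y. inner_cell T (weak_laplacian k M (weak x) T) (weak_laplacian k M (weak y) T))"
  by (rule psd_form_pullback[OF psd_cell[OF T] subspace_weak_space])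
     (use weak_laplacian(1)[OF T] weak_laplacian_add[OF T] weak_laplacian_scale[OF T] in auto)

lemma psd_a_form: "psd_form weak_space (\<lambda>x y. a_form k M (weak x) (weak y))"
  unfolding a_form_def s_form_def weak_sel
  using psd_normal_defect[OF _ cell_faces_subset] psd_trace_defect[OF _ cell_faces_subset]
    psd_weak_laplacian diameter_pos
  by (intro psd_form_add psd_form_sum psd_form_scale subspace_weak_space) (auto simp: less_imp_le)

end

section \<open>Coercivity\<close>

lemma set_integral_sum_family:
  fixes f :: "'i \<Rightarrow> 'a \<Rightarrow> real"
  assumes "\<And>i. i \<in> I \<Longrightarrow> set_integrable N A (f i)"
  shows "(LINT x:A|N. (\<Sum>i\<in>I. f i x)) = (\<Sum>i\<in>I. LINT x:A|N. f i x)"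
  using assms unfolding set_lebesgue_integral_def set_integrable_def
  by (simp add: sum_distrib_left Bochner_Integration.integral_sum)

context mesh_setting
begin

text \<open>Green's first identity, from the divergence theorem for the fields \<open>p \<partial>\<^sub>i q\<close>.\<close>

lemma green:
  assumes T: "T \<in> cells M" and p: "p \<in> polys r" and q: "q \<in> polys s"
  shows "(\<Sum>i\<in>UNIV. inner_cell T (\<lambda>x. grad p x $ i) (\<lambda>x. grad q x $ i)) + inner_cell T p (laplacian q) =
    (\<Sum>e\<in>cell_faces M T. inner_face e p (\<lambda>x. grad q x \<bullet> outward_normal T e))"
proof -
  interpret polyhedral_cell T "cell_faces M T" using cell T by blast
  have ci: "set_integrable lebesgue T g" if "continuous_on UNIV g" for g :: "real^'n \<Rightarrow> real"
    by (rule set_integrable_compact[OF compact_cell continuous_on_subset[OF that]]) simp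
  have cf: "set_integrable (surface e) e g" if "e \<in> cell_faces M T" "continuous_on UNIV g" for e and g :: "real^'n \<Rightarrow> real"
    using mesh_face[OF cell_faces_subset[OF that(1)]] flat_face.set_integrable_face mesh_face.axioms(1)
      continuous_on_subset[OF that(2)] by (metis subset_UNIV)
  have pc: "continuous_on UNIV p" and lc: "continuous_on UNIV (laplacian q)"
    and gc: "continuous_on UNIV (\<lambda>x. grad p x $ i)" "continuous_on UNIV (\<lambda>x. grad q x $ i)" for i
    using p laplacian_in_polys[OF q] grad_in_polys[OF p] grad_in_polys[OF q] by blast+
  define G where "G i x = p x *\<^sub>R grad (\<lambda>y. grad q y $ i) x + (grad q x $ i) *\<^sub>R grad p x" for i x
  have der: "GDERIV (\<lambda>x. p x * (grad q x $ i)) x :> G i x" for i x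
    unfolding G_def by (intro GDERIV_mult polys_GDERIV[OF p] polys_GDERIV[OF grad_in_polys[OF q]])
  have contG: "continuous_on UNIV (G i)" for i
    unfolding G_def[abs_def] using pc gc
    by (intro continuous_intros continuous_grad[OF p] continuous_grad[OF q] continuous_grad[OF grad_in_polys[OF q]])
  have face_term: "continuous_on UNIV (\<lambda>x. p x * (grad q x $ i))" for i
    by (intro continuous_on_mult pc gc)
  have Gi: "set_integrable lebesgue T (\<lambda>x. G i x \<bullet> axis i 1)" for i
    by (intro ci continuous_on_inner contG continuous_on_const)
  have sumG: "(\<Sum>i\<in>UNIV. G i x \<bullet> axis i 1) = (\<Sum>i\<in>UNIV. grad p x $ i * (grad q x $ i)) + p x * laplacian q x" for x
    by (simp add: G_def inner_axis laplacian_def sum.distrib sum_distrib_left inner_add_left mult.commute add.commute)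
  have pq: "set_integrable lebesgue T (\<lambda>x. grad p x $ i * (grad q x $ i))" for i
    by (intro ci continuous_on_mult gc)
  have pqs: "set_integrable lebesgue T (\<lambda>x. \<Sum>i\<in>UNIV. grad p x $ i * (grad q x $ i))"
    by (intro ci continuous_on_sum continuous_on_mult gc)
  have pl: "set_integrable lebesgue T (\<lambda>x. p x * laplacian q x)"
    by (intro ci continuous_on_mult pc lc)
  have "(\<Sum>i\<in>UNIV. LINT x:T|lebesgue. G i x \<bullet> axis i 1) =
      (LINT x:T|lebesgue. (\<Sum>i\<in>UNIV. grad p x $ i * (grad q x $ i)) + p x * laplacian q x)"
    by (simp only: set_integral_sum_family[OF Gi, symmetric] sumG)
  also have "\<dots> = (\<Sum>i\<in>UNIV. inner_cell T (\<lambda>x. grad p x $ i) (\<lambda>x. grad q x $ i)) + inner_cell T p (laplacian q)"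
    unfolding inner_cell_def by (simp only: set_integral_add(2)[OF pqs pl] set_integral_sum_family[OF pq])
  finally have "(\<Sum>i\<in>UNIV. inner_cell T (\<lambda>x. grad p x $ i) (\<lambda>x. grad q x $ i)) + inner_cell T p (laplacian q) =
      (\<Sum>i\<in>UNIV. LINT x:T|lebesgue. G i x \<bullet> axis i 1)" by simp
  also have "\<dots> = (\<Sum>i\<in>UNIV. \<Sum>e\<in>cell_faces M T. (axis i 1 \<bullet> outward_normal T e) *
      (LINT y:e|surface e. p y * (grad q y $ i)))"
    by (intro sum.cong refl divergence_theorem[OF der contG])
  also have "\<dots> = (\<Sum>e\<in>cell_faces M T. \<Sum>i\<in>UNIV. (axis i 1 \<bullet> outward_normal T e) *
      (LINT y:e|surface e. p y * (grad q y $ i)))"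
    by (rule sum.swap)
  also have "\<dots> = (\<Sum>e\<in>cell_faces M T. inner_face e p (\<lambda>x. grad q x \<bullet> outward_normal T e))"
  proof (intro sum.cong refl)
    fix e assume e: "e \<in> cell_faces M T"
    have "inner_face e p (\<lambda>x. grad q x \<bullet> outward_normal T e) =
        (LINT y:e|surface e. \<Sum>i\<in>UNIV. (outward_normal T e $ i) * (p y * (grad q y $ i)))"
      unfolding inner_face_def
      by (simp add: inner_vec_def sum_distrib_left mult_ac)
    also have "\<dots> = (\<Sum>i\<in>UNIV. LINT y:e|surface e. (outward_normal T e $ i) * (p y * (grad q y $ i)))"
      by (intro set_integral_sum_family cf[OF e] continuous_on_mult continuous_on_const pc gc)
    finally show "(\<Sum>i\<in>UNIV. (axis i 1 \<bullet> outward_normal T e) * (LINT y:e|surface e. p y * (grad q y $ i))) =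
        inner_face e p (\<lambda>x. grad q x \<bullet> outward_normal T e)"
      by (simp add: inner_axis' set_integral_mult_right)
  qed
  finally show ?thesis .
qed

text \<open>After exchanging the sums, the coefficient of \<open>K e\<close> contains the sum of the outward normals of
  the cells that share the face \<open>e\<close>, which is zero unless \<open>e\<close> is on the boundary of the domain.\<close>

lemma flux_cancellation:
  assumes "\<And>e. e \<in> faces M \<Longrightarrow> e \<subseteq> frontier \<Omega> \<Longrightarrow> K e = 0"
  shows "(\<Sum>T\<in>cells M. \<Sum>e\<in>cell_faces M T. (u e \<bullet> outward_normal T e) * K e) = (0::real)"
proof -
  have "(\<Sum>T\<in>cells M. \<Sum>e\<in>cell_faces M T. (u e \<bullet> outward_normal T e) * K e) =
      (\<Sum>e\<in>faces M. \<Sum>T | T \<in> cells M \<and> e \<subseteq> frontier T. (u e \<bullet> outward_normal T e) * K e)"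
    unfolding cell_faces_def by (rule sum.swap_restrict) auto
  also have "\<dots> = 0"
  proof (rule sum.neutral, rule ballI)
    fix e assume e: "e \<in> faces M"
    have "(\<Sum>T | T \<in> cells M \<and> e \<subseteq> frontier T. (u e \<bullet> outward_normal T e) * K e) =
        (u e \<bullet> (\<Sum>T | T \<in> cells M \<and> e \<in> cell_faces M T. outward_normal T e)) * K e"
      using e by (simp add: cell_faces_def inner_sum_right sum_distrib_right)
    then show "(\<Sum>T | T \<in> cells M \<and> e \<subseteq> frontier T. (u e \<bullet> outward_normal T e) * K e) = 0"
      using sum_outward_normals[OF domain mesh e] assms[OF e] by (cases "e \<subseteq> frontier \<Omega>") auto
  qed
  finally show ?thesis .
qed

text \<open>All summands of \<open>a(x, x)\<close> are nonnegative, so each of them vanishes.\<close>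

lemma a_form_zero:
  assumes x: "x \<in> weak_space" and 0: "a_form k M (weak x) (weak x) = 0" and T: "T \<in> cells M"
  shows "weak_laplacian k M (weak x) T = 0"
    and "\<lbrakk>e \<in> cell_faces M T; y \<in> e\<rbrakk> \<Longrightarrow> grad (fst x T) y \<bullet> normal M e = snd (snd x) e y"
    and "\<lbrakk>e \<in> cell_faces M T; y \<in> e\<rbrakk> \<Longrightarrow> L2_proj_face (k - 1) e (fst x T) y = fst (snd x) e y"
proof -
  define LL where "LL T = inner_cell T (weak_laplacian k M (weak x) T) (weak_laplacian k M (weak x) T)" for T
  define NN where "NN T e = inner_face e (normal_defect T e x) (normal_defect T e x)" for T e
  define QQ where "QQ T e = inner_face e (trace_defect T e x) (trace_defect T e x)" for T e
  have nn: "0 \<le> LL T" if "T \<in> cells M" for T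
    using psd_form.nonneg[OF psd_weak_laplacian[OF that] x] by (simp add: LL_def)
  have nf: "0 \<le> NN T e" "0 \<le> QQ T e" if "T \<in> cells M" "e \<in> cell_faces M T" for T e
    using psd_form.nonneg[OF psd_normal_defect[OF that(1) cell_faces_subset[OF that(2)]] x]
      psd_form.nonneg[OF psd_trace_defect[OF that(1) cell_faces_subset[OF that(2)]] x]
    by (simp_all add: NN_def QQ_def)
  have d: "0 < inverse (diameter T)" "0 < inverse (diameter T ^ 3)" if "T \<in> cells M" for T
    using diameter_pos[OF that] by auto
  define SN where "SN T = inverse (diameter T) * (\<Sum>e\<in>cell_faces M T. NN T e)" for T
  define SQ where "SQ T = inverse (diameter T ^ 3) * (\<Sum>e\<in>cell_faces M T. QQ T e)" for T
  have nS: "0 \<le> SN T" "0 \<le> SQ T" if "T \<in> cells M" for T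
    using nf[OF that] d[OF that] unfolding SN_def SQ_def by (auto intro!: mult_nonneg_nonneg sum_nonneg)
  have "(\<Sum>T\<in>cells M. LL T) + ((\<Sum>T\<in>cells M. SN T) + (\<Sum>T\<in>cells M. SQ T)) = 0"
    using 0 unfolding a_form_def s_form_def LL_def SN_def SQ_def NN_def QQ_def weak_sel .
  moreover have "0 \<le> (\<Sum>T\<in>cells M. LL T)" "0 \<le> (\<Sum>T\<in>cells M. SN T)" "0 \<le> (\<Sum>T\<in>cells M. SQ T)"
    using nn nS by (auto intro: sum_nonneg)
  ultimately have "(\<Sum>T\<in>cells M. LL T) = 0" "(\<Sum>T\<in>cells M. SN T) = 0" "(\<Sum>T\<in>cells M. SQ T) = 0"
    by linarith+
  then have L0: "LL T = 0" and N0: "SN T = 0" and Q0: "SQ T = 0"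
    using T nn nS by (simp_all add: sum_nonneg_eq_0_iff)
  have NQ: "NN T e = 0" "QQ T e = 0" if "e \<in> cell_faces M T" for e
    using N0 Q0 d[OF T] nf[OF T] that by (simp_all add: SN_def SQ_def sum_nonneg_eq_0_iff)
  show "weak_laplacian k M (weak x) T = 0"
    using cell_definite[OF T weak_laplacian(1)[OF T x]] L0 by (simp add: LL_def zero_fun_def)
  show "grad (fst x T) y \<bullet> normal M e = snd (snd x) e y" if "e \<in> cell_faces M T" "y \<in> e"
    using face_definite[OF cell_faces_subset[OF that(1)] continuous_defects(1)[OF T cell_faces_subset[OF that(1)] x] _ that(2)]
      NQ(1)[OF that(1)] by (simp add: NN_def)
  show "L2_proj_face (k - 1) e (fst x T) y = fst (snd x) e y" if "e \<in> cell_faces M T" "y \<in> e"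
    using face_definite[OF cell_faces_subset[OF that(1)] continuous_defects(2)[OF T cell_faces_subset[OF that(1)] x] _ that(2)]
      NQ(2)[OF that(1)] by (simp add: QQ_def)
qed

context
  fixes x
  assumes x: "x \<in> weak_space0" and zero: "a_form k M (weak x) (weak x) = 0"
begin

lemma x_in_weak_space: "x \<in> weak_space" using x by (simp add: weak_space0_iff)

lemma normal_derivative_eq:
  assumes T: "T \<in> cells M" and e: "e \<in> cell_faces M T" and y: "y \<in> e"
  shows "grad (fst x T) y \<bullet> outward_normal T e = snd (snd x) e y * (normal M e \<bullet> outward_normal T e)"
  using a_form_zero(2)[OF x_in_weak_space zero T e y]
  by (subst outward_normal_eq_normal[OF mesh T e]) simp

lemma trace_against_poly:
  assumes T: "T \<in> cells M" and e: "e \<in> cell_faces M T" and p: "p \<in> polys (k - 1)"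
  shows "inner_face e (fst (snd x) e) p = inner_face e (fst x T) p"
proof -
  have "inner_face e (fst (snd x) e) p = inner_face e (L2_proj_face (k - 1) e (fst x T)) p"
    using a_form_zero(3)[OF x_in_weak_space zero T e] by (intro inner_face_cong) auto
  then show ?thesis
    using projection(3)[OF cell_faces_subset[OF e] weak_space_continuous(1)[OF x_in_weak_space T] p] by simp
qed

text \<open>With the stabilizer gone, two applications of Green's identity turn the definition of the weak
  Laplacian into the ordinary Laplacian.\<close>

lemma cell_harmonic:
  assumes T: "T \<in> cells M"
  shows "laplacian (fst x T) = (\<lambda>_. 0)"
proof -
  define p where "p = fst x T"
  define q where "q = laplacian p"
  have p: "p \<in> polys k" using weak_space_polys[OF x_in_weak_space T] by (simp add: p_def)
  have q: "q \<in> polys (k - 2)" unfolding q_def by (rule laplacian_in_polys[OF p])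
  interpret C: psd_form "{g. continuous_on T g}" "inner_cell T" by (rule psd_cell[OF T])
  have "laplacian_functional T x q = 0"
    using weak_laplacian(2)[OF T x_in_weak_space q] a_form_zero(1)[OF x_in_weak_space zero T] C.zero_left[of q] q by auto
  moreover have "inner_face e (fst (snd x) e) (\<lambda>y. grad q y \<bullet> outward_normal T e) =
      inner_face e p (\<lambda>y. grad q y \<bullet> outward_normal T e)" if "e \<in> cell_faces M T" for e
  proof -
    have "(\<lambda>y. grad q y \<bullet> outward_normal T e) \<in> polys (k - 1)"
      by (rule subsetD[OF polys_mono grad_inner_in_polys[OF q]]) simp
    then show ?thesis using trace_against_poly[OF T that] by (simp add: p_def)
  qed
  moreover have "inner_face e (\<lambda>y. snd (snd x) e y * (normal M e \<bullet> outward_normal T e)) q =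
      inner_face e q (\<lambda>y. grad p y \<bullet> outward_normal T e)" if e: "e \<in> cell_faces M T" for e
  proof -
    have "inner_face e (\<lambda>y. snd (snd x) e y * (normal M e \<bullet> outward_normal T e)) q =
        inner_face e (\<lambda>y. grad p y \<bullet> outward_normal T e) q"
      using normal_derivative_eq[OF T e] by (intro inner_face_cong) (auto simp: p_def)
    then show ?thesis by (simp add: inner_face_def mult.commute)
  qed
  ultimately have "inner_cell T p (laplacian q) - (\<Sum>e\<in>cell_faces M T. inner_face e p (\<lambda>y. grad q y \<bullet> outward_normal T e))
      + (\<Sum>e\<in>cell_faces M T. inner_face e q (\<lambda>y. grad p y \<bullet> outward_normal T e)) = 0"
    unfolding laplacian_functional_def p_def[symmetric] by simp
  moreover have "inner_cell T (\<lambda>x. grad p x $ i) (\<lambda>x. grad q x $ i) = inner_cell T (\<lambda>x. grad q x $ i) (\<lambda>x. grad p x $ i)" for i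
    by (simp add: inner_cell_def mult.commute)
  ultimately have "inner_cell T q q = 0"
    using green[OF T p q] green[OF T q p] by (simp add: q_def[symmetric])
  then show ?thesis using cell_definite[OF T q] by (simp add: q_def p_def)
qed

text \<open>For a harmonic polynomial the Dirichlet energy of a cell is a boundary integral, and by the
  vanishing of the stabilizer its integrand is the product of the single-valued traces.\<close>

lemma cell_gradient_energy:
  assumes T: "T \<in> cells M"
  shows "(\<Sum>i\<in>UNIV. inner_cell T (\<lambda>y. grad (fst x T) y $ i) (\<lambda>y. grad (fst x T) y $ i)) =
    (\<Sum>e\<in>cell_faces M T. (normal M e \<bullet> outward_normal T e) * inner_face e (fst (snd x) e) (snd (snd x) e))"
proof -
  define p where "p = fst x T"
  have p: "p \<in> polys k" using weak_space_polys[OF x_in_weak_space T] by (simp add: p_def)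
  have "inner_cell T p (laplacian p) = 0"
    using cell_harmonic[OF T] by (simp add: p_def inner_cell_def)
  moreover have "inner_face e p (\<lambda>y. grad p y \<bullet> outward_normal T e) =
      (normal M e \<bullet> outward_normal T e) * inner_face e (fst (snd x) e) (snd (snd x) e)" if e: "e \<in> cell_faces M T" for e
  proof -
    have "inner_face e p (\<lambda>y. grad p y \<bullet> outward_normal T e) =
        inner_face e (fst (snd x) e) (\<lambda>y. grad p y \<bullet> outward_normal T e)"
      using trace_against_poly[OF T e grad_inner_in_polys[OF p]] by (simp add: p_def)
    also have "\<dots> = inner_face e (fst (snd x) e) (\<lambda>y. snd (snd x) e y * (normal M e \<bullet> outward_normal T e))"
      using normal_derivative_eq[OF T e] by (intro inner_face_cong) (auto simp: p_def)
    also have "\<dots> = (normal M e \<bullet> outward_normal T e) * inner_face e (fst (snd x) e) (snd (snd x) e)"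
      unfolding inner_face_def mult.assoc[symmetric] by (simp add: mult.commute)
    finally show ?thesis .
  qed
  ultimately show ?thesis using green[OF T p p] by (simp add: p_def)
qed

text \<open>The energies of all cells add up to a sum of fluxes that cancel.\<close>

lemma cell_constant:
  assumes T: "T \<in> cells M"
  shows "\<exists>c. fst x T = (\<lambda>_. c)"
proof -
  define E where "E T = (\<Sum>i\<in>UNIV. inner_cell T (\<lambda>y. grad (fst x T) y $ i) (\<lambda>y. grad (fst x T) y $ i))" for T
  have g: "(\<lambda>y. grad (fst x T) y $ i) \<in> polys (k - 1)" if "T \<in> cells M" for T i
    using grad_in_polys[OF weak_space_polys[OF x_in_weak_space that]] .
  have nn: "0 \<le> inner_cell T (\<lambda>y. grad (fst x T) y $ i) (\<lambda>y. grad (fst x T) y $ i)" if "T \<in> cells M" for T i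
    using psd_form.nonneg[OF psd_cell[OF that]] g[OF that] by blast
  have "(\<Sum>T\<in>cells M. E T) = (\<Sum>T\<in>cells M. \<Sum>e\<in>cell_faces M T. (normal M e \<bullet> outward_normal T e) *
      inner_face e (fst (snd x) e) (snd (snd x) e))"
    unfolding E_def by (intro sum.cong refl cell_gradient_energy)
  also have "\<dots> = 0"
    by (rule flux_cancellation) (use x in \<open>auto simp: weak_space0_iff inner_face_def\<close>)
  finally have "E T = 0"
    using T nn by (simp add: sum_nonneg_eq_0_iff E_def sum_nonneg)
  then have "inner_cell T (\<lambda>y. grad (fst x T) y $ i) (\<lambda>y. grad (fst x T) y $ i) = 0" for i
    using nn[OF T] by (simp add: E_def sum_nonneg_eq_0_iff)
  then have "(\<lambda>y. grad (fst x T) y $ i) = (\<lambda>_. 0)" for i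
    using cell_definite[OF T g[OF T]] by blast
  then have "grad (fst x T) y = 0" for y by (simp add: vec_eq_iff fun_eq_iff)
  then show ?thesis
    using grad_zero_imp_const[OF weak_space_polys[OF x_in_weak_space T] open_UNIV] by simp
qed

lemma trace_constant:
  assumes T: "T \<in> cells M" and e: "e \<in> cell_faces M T" and y: "y \<in> e"
  shows "fst (snd x) e y = fst x T y" "snd (snd x) e y = 0"
proof -
  obtain c where c: "fst x T = (\<lambda>_. c)" using cell_constant[OF T] by blast
  show "fst (snd x) e y = fst x T y"
    using a_form_zero(3)[OF x_in_weak_space zero T e y] projection_restrict[OF cell_faces_subset[OF e], of "\<lambda>_. c" "k - 1"] y
    by (simp add: c restrict_fun_def polys_const)
  have "grad (\<lambda>_. c) y = 0" by (rule grad_eq) (rule GDERIV_const)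
  then show "snd (snd x) e y = 0"
    using a_form_zero(2)[OF x_in_weak_space zero T e y] by (simp add: c)
qed

text \<open>The divergence theorem for a coordinate function expresses the volume of a cell by an integral
  over its boundary.  Weighted with the squares of the constants the boundary integrands become
  single-valued, because on the faces the constants agree with \<open>v\<^sub>b\<close>; so they cancel in the sum over
  all cells, and the squares of the constants have to vanish.\<close>

lemma cell_zero:
  assumes T: "T \<in> cells M"
  shows "fst x T = 0"
proof -
  \<comment> \<open>An arbitrary coordinate.\<close>
  define i :: 'n where "i = undefined"
  define K where "K e = (LINT y:e|surface e. (fst (snd x) e y)\<^sup>2 * (y $ i))" for e
  have id: "inner_cell T (fst x T) (fst x T) = (\<Sum>e\<in>cell_faces M T. (axis i 1 \<bullet> outward_normal T e) * K e)"
    if T: "T \<in> cells M" for T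
  proof -
    interpret polyhedral_cell T "cell_faces M T" using cell T by blast
    obtain c where c: "fst x T = (\<lambda>_. c)" using cell_constant[OF T] by blast
    have der: "GDERIV (\<lambda>y. c\<^sup>2 * (y $ i)) y :> (c\<^sup>2 *\<^sub>R axis i 1)" for y
      unfolding gderiv_def
      by (rule bounded_linear_imp_has_derivative[THEN has_derivative_eq_rhs])
         (auto intro!: bounded_linear_mult_right[THEN bounded_linear_compose] bounded_linear_vec_nth simp: inner_axis)
    have "inner_cell T (fst x T) (fst x T) = (LINT y:T|lebesgue. (c\<^sup>2 *\<^sub>R axis i (1::real)) \<bullet> axis i 1)"
      by (simp add: inner_cell_def c inner_axis_axis inner_real_def power2_eq_square)
    also have "\<dots> = (\<Sum>e\<in>cell_faces M T. (axis i 1 \<bullet> outward_normal T e) * (LINT y:e|surface e. c\<^sup>2 * (y $ i)))"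
      by (rule divergence_theorem[OF der continuous_on_const])
    also have "\<dots> = (\<Sum>e\<in>cell_faces M T. (axis i 1 \<bullet> outward_normal T e) * K e)"
    proof (intro sum.cong refl arg_cong2[of _ _ _ _ "(*)"])
      fix e assume e: "e \<in> cell_faces M T"
      show "(LINT y:e|surface e. c\<^sup>2 * (y $ i)) = K e"
        unfolding K_def set_lebesgue_integral_def
        using trace_constant(1)[OF T e] c by (intro Bochner_Integration.integral_cong) (auto simp: indicator_def)
    qed
    finally show ?thesis .
  qed
  have nn: "0 \<le> inner_cell T (fst x T) (fst x T)" if "T \<in> cells M" for T
    using psd_form.nonneg[OF psd_cell[OF that]] weak_space_continuous(1)[OF x_in_weak_space that] by blast
  have "(\<Sum>T\<in>cells M. inner_cell T (fst x T) (fst x T)) =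
      (\<Sum>T\<in>cells M. \<Sum>e\<in>cell_faces M T. (axis i 1 \<bullet> outward_normal T e) * K e)"
    by (intro sum.cong refl id)
  also have "\<dots> = 0"
    by (rule flux_cancellation) (use x in \<open>auto simp: weak_space0_iff K_def\<close>)
  finally have "inner_cell T (fst x T) (fst x T) = 0"
    using T nn by (simp add: sum_nonneg_eq_0_iff)
  then show ?thesis
    using cell_definite[OF T weak_space_polys[OF x_in_weak_space T]] by (simp add: zero_fun_def)
qed

theorem a_form_definite: "x = 0"
proof -
  have "fst x T = 0" for T
    using cell_zero[of T] x_in_weak_space by (cases "T \<in> cells M") (simp_all add: weak_space_iff)
  then have 1: "fst x = 0" by (simp add: fun_eq_iff)
  have 2: "fst (snd x) e = 0 \<and> snd (snd x) e = 0" for e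
  proof (cases "e \<in> faces M")
    case True
    then obtain T where T: "T \<in> cells M" "e \<in> cell_faces M T" using mesh by (auto simp: polyhedral_mesh_def)
    have "fst (snd x) e y = 0 \<and> snd (snd x) e y = 0" for y
    proof (cases "y \<in> e")
      case True
      then show ?thesis using trace_constant[OF T True] cell_zero[OF T(1)] by simp
    next
      case False
      then show ?thesis using x_in_weak_space \<open>e \<in> faces M\<close> by (auto simp: weak_space_iff face_polys_def)
    qed
    then show ?thesis by (simp add: fun_eq_iff)
  next
    case False
    then show ?thesis using x_in_weak_space by (simp add: weak_space_iff)
  qed
  show ?thesis using 1 2 by (simp add: prod_eq_iff fun_eq_iff)
qed

end

end

section \<open>Local problems and the Schur complement\<close>

lemma additive_sum:
  fixes \<Phi> :: "'a::real_vector \<Rightarrow> real"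
  assumes "subspace V" and add: "\<And>x y. \<lbrakk>x \<in> V; y \<in> V\<rbrakk> \<Longrightarrow> \<Phi> (x + y) = \<Phi> x + \<Phi> y"
    and V: "\<And>i. i \<in> I \<Longrightarrow> f i \<in> V"
  shows "\<Phi> (\<Sum>i\<in>I. f i) = (\<Sum>i\<in>I. \<Phi> (f i))"
proof -
  have "\<Phi> 0 = 0" using add[of 0 0] subspace_0[OF assms(1)] by simp
  then show ?thesis
    using V
  proof (induction I rule: infinite_finite_induct)
    case (insert i I)
    then show ?case using add[of "f i" "sum f I"] subspace_sum[OF assms(1), of I f] by simp
  qed simp_all
qed

definition cell_fun :: "(real^'n) set \<Rightarrow> (real^'n \<Rightarrow> real) \<Rightarrow> (real^'n) set \<Rightarrow> real^'n \<Rightarrow> real" where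
  "cell_fun T p = (\<lambda>T'. if T' = T then p else 0)"

lemma linear_cell_fun: "linear (cell_fun T)"
  by (rule linearI) (auto simp: cell_fun_def fun_eq_iff)

context mesh_setting
begin

definition cell_space :: "'n family set" where
  "cell_space = {a. (\<forall>T\<in>cells M. a T \<in> polys k) \<and> (\<forall>T. T \<notin> cells M \<longrightarrow> a T = 0)}"

lemma subspace_cell_space: "subspace cell_space"
  unfolding subspace_def
  by (auto simp: cell_space_def intro: subspace_0 subspace_add subspace_scale subspace_polys)

lemma cell_fun_in_cell_space: "T \<in> cells M \<Longrightarrow> p \<in> polys k \<Longrightarrow> cell_fun T p \<in> cell_space"
  by (auto simp: cell_space_def cell_fun_def intro: subspace_0 subspace_polys)

lemma cell_space_decompose:
  assumes "a \<in> cell_space"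
  shows "a = (\<Sum>T\<in>cells M. cell_fun T (a T))"
proof
  fix T
  have "(\<Sum>T'\<in>cells M. cell_fun T' (a T')) T = (\<Sum>T'\<in>cells M. if T' = T then a T' else 0)"
    unfolding sum_fun_apply by (intro ext sum.cong) (auto simp: cell_fun_def)
  then show "a T = (\<Sum>T'\<in>cells M. cell_fun T' (a T')) T"
    using assms by (auto simp: cell_space_def)
qed

lemma cell_space_eq_span: "cell_space = span (\<Union>T\<in>cells M. cell_fun T ` monomial ` exponents k)"
proof
  show "cell_space \<subseteq> span (\<Union>T\<in>cells M. cell_fun T ` monomial ` exponents k)"
  proof
    fix a assume a: "a \<in> cell_space"
    have "cell_fun T (a T) \<in> span (\<Union>T\<in>cells M. cell_fun T ` monomial ` exponents k)" if T: "T \<in> cells M" for T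
    proof -
      have "a T \<in> span (monomial ` exponents k)" using a T by (simp add: cell_space_def polys_eq_span)
      then have "cell_fun T (a T) \<in> span (cell_fun T ` monomial ` exponents k)"
        using linear_span_image[OF linear_cell_fun] by blast
      then show ?thesis using T by (auto intro: span_mono[THEN subsetD, rotated])
    qed
    then have "(\<Sum>T\<in>cells M. cell_fun T (a T)) \<in> span (\<Union>T\<in>cells M. cell_fun T ` monomial ` exponents k)"
      by (rule span_sum)
    then show "a \<in> span (\<Union>T\<in>cells M. cell_fun T ` monomial ` exponents k)"
      using cell_space_decompose[OF a] by simp
  qed
  show "span (\<Union>T\<in>cells M. cell_fun T ` monomial ` exponents k) \<subseteq> cell_space"
    by (intro span_minimal subspace_cell_space) (auto intro: cell_fun_in_cell_space monomial_in_polys)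
qed

abbreviation A where "A x y \<equiv> a_form k M (weak x) (weak y)"

interpretation A: psd_form weak_space A
  by (rule psd_a_form)

lemma cell_space_weak_space0: "a \<in> cell_space \<Longrightarrow> (a, 0, 0) \<in> weak_space0"
  by (auto simp: weak_space0_iff weak_space_iff cell_space_def intro: subspace_0 subspace_face_polys)

lemma weak_space0_subset: "x \<in> weak_space0 \<Longrightarrow> x \<in> weak_space"
  by (simp add: weak_space0_iff)

lemma cell_space_weak_space: "a \<in> cell_space \<Longrightarrow> (a, 0, 0) \<in> weak_space"
  by (rule weak_space0_subset[OF cell_space_weak_space0])

text \<open>The data are square integrable on the open domain only, whereas the cells are closed; the
  difference is the boundary of the domain, a null set.\<close>

lemma square_integrable_times_continuous:
  assumes f: "square_integrable \<Omega> f" and T: "T \<in> cells M" and p: "continuous_on UNIV p"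
  shows "set_integrable lebesgue T (\<lambda>x. f x * p x)"
proof -
  have dom: "polyhedral_set (int CARD('n)) (closure \<Omega>)" and op: "open \<Omega>"
    using domain by (auto simp: polyhedral_domain_def intro: open_interior) (metis open_interior)
  have cl: "compact (closure \<Omega>)" by (rule polyhedral_set_compact[OF dom])
  have \<Omega>m: "\<Omega> \<in> lmeasurable"
    using cl op by (intro lmeasurable_open) (auto intro: bounded_subset[OF compact_imp_bounded closure_subset])
  have "bounded (p ` closure \<Omega>)"
    by (intro compact_imp_bounded compact_continuous_image cl continuous_on_subset[OF p]) auto
  then obtain B where B: "\<And>x. x \<in> closure \<Omega> \<Longrightarrow> \<bar>p x\<bar> \<le> B" by (auto simp: bounded_iff)
  have pm: "p \<in> borel_measurable lebesgue"
    using p by (intro measurable_completion) (simp add: borel_measurable_continuous_onI)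
  have fm: "(\<lambda>x. indicator \<Omega> x *\<^sub>R f x) \<in> borel_measurable lebesgue"
    using f by (simp add: square_integrable_def set_borel_measurable_def)
  have g: "integrable lebesgue (\<lambda>x. indicator \<Omega> x *\<^sub>R (f x * p x))"
  proof (rule Bochner_Integration.integrable_bound)
    have "integrable lebesgue (\<lambda>x. indicator \<Omega> x *\<^sub>R (f x)\<^sup>2)"
      using f by (simp add: square_integrable_def set_integrable_def)
    moreover have "integrable lebesgue (indicator \<Omega> :: real^'n \<Rightarrow> real)"
      using \<Omega>m by (simp add: lmeasurable_iff_integrable)
    ultimately show "integrable lebesgue (\<lambda>x. \<bar>B\<bar> * (indicator \<Omega> x + indicator \<Omega> x *\<^sub>R (f x)\<^sup>2))"
      by (intro integrable_mult_right Bochner_Integration.integrable_add)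
    have "(\<lambda>x. (indicator \<Omega> x *\<^sub>R f x) * p x) \<in> borel_measurable lebesgue"
      using fm pm by (rule borel_measurable_times)
    then show "(\<lambda>x. indicator \<Omega> x *\<^sub>R (f x * p x)) \<in> borel_measurable lebesgue"
      by (simp add: mult.assoc)
    show "AE x in lebesgue. norm (indicator \<Omega> x *\<^sub>R (f x * p x)) \<le> norm (\<bar>B\<bar> * (indicator \<Omega> x + indicator \<Omega> x *\<^sub>R (f x)\<^sup>2))"
    proof (intro AE_I2)
      fix x
      show "norm (indicator \<Omega> x *\<^sub>R (f x * p x)) \<le> norm (\<bar>B\<bar> * (indicator \<Omega> x + indicator \<Omega> x *\<^sub>R (f x)\<^sup>2))"
      proof (cases "x \<in> \<Omega>")
        case True
        then have "\<bar>p x\<bar> \<le> \<bar>B\<bar>" using B[of x] closure_subset[of \<Omega>] by auto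
        \<comment> \<open>On a domain of finite measure, square integrable functions are integrable.\<close>
        moreover have "\<bar>f x\<bar> \<le> 1 + (f x)\<^sup>2"
        proof -
          have "0 \<le> (\<bar>f x\<bar> - 1)\<^sup>2 + \<bar>f x\<bar>" by simp
          also have "\<dots> = 1 + (f x)\<^sup>2 - \<bar>f x\<bar>" by (simp add: power2_diff)
          finally show ?thesis by simp
        qed
        ultimately have "\<bar>p x\<bar> * \<bar>f x\<bar> \<le> \<bar>B\<bar> * (1 + (f x)\<^sup>2)" by (intro mult_mono) auto
        then show ?thesis using True by (simp add: abs_mult mult.commute)
      qed simp
    qed
  qed
  have Tm: "T \<in> sets lebesgue"
    using compact_imp_closed[OF compact_cell[OF T]] by (simp add: borel_closed)
  have "set_integrable lebesgue T (\<lambda>x. indicator \<Omega> x *\<^sub>R (f x * p x))"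
    unfolding set_integrable_def using integrable_mult_indicator[OF Tm g] .
  moreover have "negligible (frontier (closure \<Omega>))" by (rule negligible_frontier_polyhedral[OF dom])
  moreover have "f x * p x = indicator \<Omega> x *\<^sub>R (f x * p x)" if "x \<in> T - frontier (closure \<Omega>)" for x
  proof -
    have "x \<in> closure \<Omega>" using that T mesh by (auto simp: polyhedral_mesh_def)
    then have "x \<in> \<Omega>" using that domain by (auto simp: frontier_def polyhedral_domain_def)
    then show ?thesis by simp
  qed
  ultimately show ?thesis by (rule absolutely_integrable_spike)
qed

definition load :: "(real^'n \<Rightarrow> real) \<Rightarrow> 'n family \<Rightarrow> real" where
  "load f a = (\<Sum>T\<in>cells M. inner_cell T f (a T))"

lemma load_linear:
  assumes f: "square_integrable \<Omega> f" and a: "a \<in> cell_space"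
  shows "b \<in> cell_space \<Longrightarrow> load f (a + b) = load f a + load f b"
    and "load f (c *\<^sub>R a) = c * load f a"
proof -
  have int: "set_integrable lebesgue T (\<lambda>x. f x * a T x)" if "a \<in> cell_space" "T \<in> cells M" for a T
    using that by (intro square_integrable_times_continuous[OF f]) (auto simp: cell_space_def)
  show "load f (a + b) = load f a + load f b" if b: "b \<in> cell_space"
    unfolding load_def sum.distrib[symmetric]
    by (intro sum.cong refl)
       (simp add: inner_cell_def distrib_left set_integral_add(2) int a b)
  show "load f (c *\<^sub>R a) = c * load f a"
    unfolding load_def sum_distrib_left
    by (intro sum.cong refl) (simp add: inner_cell_def mult.left_commute)
qed

lemma load_zero: "load (\<lambda>_. 0) a = 0"
  by (simp add: load_def inner_cell_def)

lemma square_integrable_zero: "square_integrable \<Omega> (\<lambda>_. 0)"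
  by (simp add: square_integrable_def set_borel_measurable_def set_integrable_def)

text \<open>A piecewise polynomial is the sum of its restrictions to the cells, each of which is an
  admissible local test function.\<close>

lemma local_systems_iff:
  assumes f: "square_integrable \<Omega> f" and w: "w \<in> weak_space"
  shows "(\<forall>T\<in>cells M. \<forall>v0. WF v0 zero_family zero_family \<in> Vh_loc k \<Omega> M T \<longrightarrow>
        a_form k M (weak w) (WF v0 zero_family zero_family) = (\<Sum>T'\<in>cells M. inner_cell T' f (v0 T'))) \<longleftrightarrow>
    (\<forall>a\<in>cell_space. A w (a, 0, 0) = load f a)"
proof -
  have WF: "WF a zero_family zero_family = weak (a, 0, 0)" for a :: "'n family"
    by (simp add: weak_def zero_fun_def)
  have sub: "a \<in> cell_space" if "weak (a, 0, 0) \<in> Vh_loc k \<Omega> M T" for a T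
  proof -
    have "(a, 0, 0) \<in> weak_space" using that by (simp add: Vh_loc_def Vh0_def weak_space_def)
    then show ?thesis by (simp add: weak_space_iff cell_space_def)
  qed
  have single: "weak (cell_fun T p, 0, 0) \<in> Vh_loc k \<Omega> M T" if "T \<in> cells M" "p \<in> polys k" for T p
    using cell_space_weak_space0[OF cell_fun_in_cell_space[OF that]]
    by (auto simp: Vh_loc_def weak_space0_def cell_fun_def)
  have "A w (a, 0, 0) = load f a"
    if *: "\<And>T b. T \<in> cells M \<Longrightarrow> weak (b, 0, 0) \<in> Vh_loc k \<Omega> M T \<Longrightarrow> A w (b, 0, 0) = load f b"
      and a: "a \<in> cell_space" for a
  proof -
    have s: "cell_fun T (a T) \<in> cell_space" if "T \<in> cells M" for T
      using that a by (intro cell_fun_in_cell_space) (auto simp: cell_space_def)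
    have "A w (\<Sum>T\<in>cells M. cell_fun T (a T), 0, 0) = (\<Sum>T\<in>cells M. A w (cell_fun T (a T), 0, 0))"
    proof (rule additive_sum[OF subspace_cell_space, where \<Phi> = "\<lambda>a. A w (a, 0, 0)"])
      show "A w (x + y, 0, 0) = A w (x, 0, 0) + A w (y, 0, 0)" if "x \<in> cell_space" "y \<in> cell_space" for x y
        using A.add_right[OF cell_space_weak_space[OF that(1)] cell_space_weak_space[OF that(2)] w] by simp
    qed (rule s)
    moreover have "load f (\<Sum>T\<in>cells M. cell_fun T (a T)) = (\<Sum>T\<in>cells M. load f (cell_fun T (a T)))"
      by (rule additive_sum[OF subspace_cell_space load_linear(1)[OF f] s])
    moreover have "A w (cell_fun T (a T), 0, 0) = load f (cell_fun T (a T))" if "T \<in> cells M" for T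
      using that a by (intro *[OF that] single) (auto simp: cell_space_def)
    ultimately show ?thesis using cell_space_decompose[OF a] by simp
  qed
  then show ?thesis
    unfolding WF load_def[symmetric] using sub by blast
qed

definition face_space :: "('n family \<times> 'n family) set" where
  "face_space = {l. (0, l) \<in> weak_space}"

text \<open>The homogeneous local problem is positive definite because cell functions have zero skeleton
  components and thus belong to the space on which \<open>a\<close> is definite.\<close>

lemma local_problem_exists:
  assumes f: "square_integrable \<Omega> f" and l: "l \<in> face_space"
  shows "\<exists>!a. a \<in> cell_space \<and> (\<forall>b\<in>cell_space. A (a, l) (b, 0, 0) = load f b)"
proof -
  have l': "(0, l) \<in> weak_space" using l by (simp add: face_space_def)
  have split: "A (a, l) (b, 0, 0) = A (a, 0, 0) (b, 0, 0) + A (0, l) (b, 0, 0)"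
    if "a \<in> cell_space" "b \<in> cell_space" for a b
    using A.add_left[OF cell_space_weak_space[OF that(1)] l' cell_space_weak_space[OF that(2)]]
    by (cases l) (simp add: zero_prod_def)
  have "\<exists>!a. a \<in> cell_space \<and> (\<forall>b\<in>cell_space. A (a, 0, 0) (b, 0, 0) = load f b - A (0, l) (b, 0, 0))"
  proof (rule riesz_unique[OF _ cell_space_eq_span])
    show "psd_form cell_space (\<lambda>a b. A (a, 0, 0) (b, 0, 0))"
      by (rule psd_form_pullback[OF psd_a_form subspace_cell_space cell_space_weak_space]) simp_all
    show "a = 0" if "a \<in> cell_space" "A (a, 0, 0) (a, 0, 0) = 0" for a
      using a_form_definite[OF cell_space_weak_space0[OF that(1)] that(2)] by (simp add: zero_prod_def)
    show "load f (a + b) - A (0, l) (a + b, 0, 0) = load f a - A (0, l) (a, 0, 0) + (load f b - A (0, l) (b, 0, 0))"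
      if "a \<in> cell_space" "b \<in> cell_space" for a b
      using A.add_right[OF cell_space_weak_space[OF that(1)] cell_space_weak_space[OF that(2)] l'] load_linear(1)[OF f that]
      by simp
    show "load f (c *\<^sub>R a) - A (0, l) (c *\<^sub>R a, 0, 0) = c * (load f a - A (0, l) (a, 0, 0))"
      if "a \<in> cell_space" for a c
      using A.scale_right[OF cell_space_weak_space[OF that] l', of c] load_linear(2)[OF f that, of c]
      by (simp add: right_diff_distrib)
  qed auto
  then show ?thesis using split by (simp add: eq_diff_eq cong: conj_cong)
qed

text \<open>The component \<open>w\<^sub>0\<close> of the local solution as a function of the skeleton data.\<close>

definition interior_part :: "('n family \<times> 'n family) \<Rightarrow> (real^'n \<Rightarrow> real) \<Rightarrow> 'n family" where
  "interior_part l f = (THE a. a \<in> cell_space \<and> (\<forall>b\<in>cell_space. A (a, l) (b, 0, 0) = load f b))"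

lemma interior_part:
  assumes "square_integrable \<Omega> f" "l \<in> face_space"
  shows "interior_part l f \<in> cell_space"
    and "b \<in> cell_space \<Longrightarrow> A (interior_part l f, l) (b, 0, 0) = load f b"
  using theI'[OF local_problem_exists[OF assms]] unfolding interior_part_def by blast+

lemma interior_part_unique:
  assumes "square_integrable \<Omega> f" "l \<in> face_space" "a \<in> cell_space"
    "\<And>b. b \<in> cell_space \<Longrightarrow> A (a, l) (b, 0, 0) = load f b"
  shows "interior_part l f = a"
  using local_problem_exists[OF assms(1,2)] interior_part[OF assms(1,2)] assms(3,4) by blast

lemma weak_pair: "a \<in> cell_space \<Longrightarrow> l \<in> face_space \<Longrightarrow> (a, l) \<in> weak_space"
  by (auto simp: face_space_def weak_space_iff cell_space_def)

lemma local_solution_eq: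
  assumes f: "square_integrable \<Omega> f" and l: "l \<in> face_space"
  shows "local_solution k \<Omega> M l f = weak (interior_part l f, l)"
  unfolding local_solution_def
proof (rule the_equality)
  let ?w = "(interior_part l f, l)"
  have w: "?w \<in> weak_space" using weak_pair interior_part(1)[OF f l] l by blast
  have "\<forall>a\<in>cell_space. A ?w (a, 0, 0) = load f a" using interior_part(2)[OF f l] by blast
  then show "weak ?w \<in> Vh k M \<and> (wfb (weak ?w), wfn (weak ?w)) = l \<and>
     (\<forall>T\<in>cells M. \<forall>v0. WF v0 zero_family zero_family \<in> Vh_loc k \<Omega> M T \<longrightarrow>
        a_form k M (weak ?w) (WF v0 zero_family zero_family) = (\<Sum>T'\<in>cells M. inner_cell T' f (v0 T')))"
    using w local_systems_iff[OF f w] by (simp add: weak_space_def)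
next
  fix v
  assume v: "v \<in> Vh k M \<and> (wfb v, wfn v) = l \<and>
     (\<forall>T\<in>cells M. \<forall>v0. WF v0 zero_family zero_family \<in> Vh_loc k \<Omega> M T \<longrightarrow>
        a_form k M v (WF v0 zero_family zero_family) = (\<Sum>T'\<in>cells M. inner_cell T' f (v0 T')))"
  obtain x where x: "v = weak x" using weak_exhaust by blast
  then have xl: "snd x = l" using v by (auto simp: prod_eq_iff)
  have xw: "x \<in> weak_space" using v x by (simp add: weak_space_def)
  then have "fst x \<in> cell_space" by (simp add: weak_space_iff cell_space_def)
  moreover have "\<forall>a\<in>cell_space. A x (a, 0, 0) = load f a"
    using local_systems_iff[OF f xw] v x by blast
  ultimately have "interior_part l f = fst x"
    using xl by (intro interior_part_unique[OF f l]) auto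
  then show "v = weak (interior_part l f, l)" using x xl by (metis prod.collapse)
qed

abbreviation sol where "sol l f \<equiv> (interior_part l f, l)"

lemma sol_weak: "square_integrable \<Omega> f \<Longrightarrow> l \<in> face_space \<Longrightarrow> sol l f \<in> weak_space"
  by (rule weak_pair[OF interior_part(1)])

lemma subspace_face_space: "subspace face_space"
  unfolding subspace_def face_space_def
proof (intro conjI ballI allI CollectI; (elim CollectE)?)
  show "(0, 0) \<in> weak_space" using subspace_0[OF subspace_weak_space] by (simp add: zero_prod_def)
  show "(0, l + m) \<in> weak_space" if "(0, l) \<in> weak_space" "(0, m) \<in> weak_space" for l m
    using subspace_add[OF subspace_weak_space that] by simp
  show "(0, c *\<^sub>R l) \<in> weak_space" if "(0, l) \<in> weak_space" for c l
    using subspace_scale[OF subspace_weak_space that, of c] by simp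
qed

text \<open>Both sides solve the same local problem.\<close>

lemma interior_part_superposition:
  assumes f: "square_integrable \<Omega> f" and l: "l \<in> face_space" and m: "m \<in> face_space"
  shows "interior_part (c *\<^sub>R l + m) f = c *\<^sub>R interior_part l (\<lambda>_. 0) + interior_part m f"
proof (rule interior_part_unique[OF f])
  note z = square_integrable_zero
  show lm: "c *\<^sub>R l + m \<in> face_space"
    using l m by (intro subspace_add subspace_scale subspace_face_space)
  show "c *\<^sub>R interior_part l (\<lambda>_. 0) + interior_part m f \<in> cell_space"
    using interior_part(1)[OF z l] interior_part(1)[OF f m]
    by (intro subspace_add subspace_scale subspace_cell_space)
  fix b assume b: "b \<in> cell_space"
  have "A (c *\<^sub>R sol l (\<lambda>_. 0) + sol m f) (b, 0, 0) = c * A (sol l (\<lambda>_. 0)) (b, 0, 0) + A (sol m f) (b, 0, 0)"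
    using sol_weak[OF z l] sol_weak[OF f m] cell_space_weak_space[OF b] by (simp only: A.add_left A.scale_left A.closed)
  also have "\<dots> = load f b"
    using interior_part(2)[OF z l b] interior_part(2)[OF f m b] by (simp add: load_zero)
  finally show "A (c *\<^sub>R interior_part l (\<lambda>_. 0) + interior_part m f, c *\<^sub>R l + m) (b, 0, 0) = load f b"
    by simp
qed

lemma skeleton_space_eq: "skeleton_space k \<Omega> M = {l. (0, l) \<in> weak_space0}"
  by (auto simp: skeleton_space_def weak_space0_def weak_def zero_fun_def)

lemma skeleton_face: "l \<in> skeleton_space k \<Omega> M \<Longrightarrow> l \<in> face_space"
  by (simp add: skeleton_space_eq face_space_def weak_space0_subset)

lemma skeleton_fun_eq: "skeleton_fun l = weak (0, l)"
  by (simp add: weak_def zero_fun_def)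

lemma lin_comb_eq: "lin_comb c l m = c *\<^sub>R l + m"
  by (simp add: lin_comb_def prod_eq_iff fun_eq_iff)

lemma sol_weak0:
  "square_integrable \<Omega> f \<Longrightarrow> l \<in> skeleton_space k \<Omega> M \<Longrightarrow> sol l f \<in> weak_space0"
  using sol_weak[OF _ skeleton_face, of f l] by (simp add: skeleton_space_eq weak_space0_iff)

text \<open>The local solution is \<open>a\<close>-orthogonal to the cell functions, so the test function
  may be completed to a local solution as well.\<close>

lemma schur_form_eq:
  assumes l: "l \<in> skeleton_space k \<Omega> M" and m: "m \<in> skeleton_space k \<Omega> M"
  shows "schur_form k \<Omega> M l m = A (sol l (\<lambda>_. 0)) (sol m (\<lambda>_. 0))"
proof -
  note z = square_integrable_zero
  have a: "interior_part m (\<lambda>_. 0) \<in> cell_space" by (rule interior_part(1)[OF z skeleton_face[OF m]])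
  have w: "sol l (\<lambda>_. 0) \<in> weak_space" by (rule sol_weak[OF z skeleton_face[OF l]])
  have m0: "(0, m) \<in> weak_space" using skeleton_face[OF m] by (simp add: face_space_def)
  have "A (sol l (\<lambda>_. 0)) (sol m (\<lambda>_. 0)) =
      A (sol l (\<lambda>_. 0)) (interior_part m (\<lambda>_. 0), 0, 0) + A (sol l (\<lambda>_. 0)) (0, m)"
    using A.add_right[OF cell_space_weak_space[OF a] m0 w] by (cases m) (simp add: zero_prod_def)
  also have "A (sol l (\<lambda>_. 0)) (interior_part m (\<lambda>_. 0), 0, 0) = 0"
    using interior_part(2)[OF z skeleton_face[OF l] a] by (simp add: load_zero)
  finally show ?thesis
    using local_solution_eq[OF z skeleton_face[OF l]] by (simp add: schur_form_def skeleton_fun_eq zero_fun_def)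
qed

lemma subspace_skeleton: "subspace (skeleton_space k \<Omega> M)"
  unfolding subspace_def skeleton_space_eq
proof (intro conjI ballI allI CollectI; (elim CollectE)?)
  show "(0, 0) \<in> weak_space0" using subspace_0[OF subspace_weak_space0] by (simp add: zero_prod_def)
  show "(0, l + m) \<in> weak_space0" if "(0, l) \<in> weak_space0" "(0, m) \<in> weak_space0" for l m
    using subspace_add[OF subspace_weak_space0 that] by simp
  show "(0, c *\<^sub>R l) \<in> weak_space0" if "(0, l) \<in> weak_space0" for c l
    using subspace_scale[OF subspace_weak_space0 that, of c] by simp
qed

lemma psd_schur_form: "psd_form (skeleton_space k \<Omega> M) (schur_form k \<Omega> M)"
proof -
  have "psd_form (skeleton_space k \<Omega> M) (\<lambda>l m. A (sol l (\<lambda>_. 0)) (sol m (\<lambda>_. 0)))"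
  proof (rule psd_form_pullback[OF psd_a_form subspace_skeleton])
    note z = square_integrable_zero
    show "sol l (\<lambda>_. 0) \<in> weak_space" if "l \<in> skeleton_space k \<Omega> M" for l
      by (rule sol_weak[OF z skeleton_face[OF that]])
    show "sol (l + m) (\<lambda>_. 0) = sol l (\<lambda>_. 0) + sol m (\<lambda>_. 0)"
      if "l \<in> skeleton_space k \<Omega> M" "m \<in> skeleton_space k \<Omega> M" for l m
      using interior_part_superposition[OF z skeleton_face[OF that(1)] skeleton_face[OF that(2)], of 1] by simp
    show "sol (c *\<^sub>R l) (\<lambda>_. 0) = c *\<^sub>R sol l (\<lambda>_. 0)" if "l \<in> skeleton_space k \<Omega> M" for c l
    proof -
      have 0: "(0::'n family \<times> 'n family) \<in> face_space" by (rule subspace_0[OF subspace_face_space])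
      have "interior_part 0 (\<lambda>_. 0) = 0"
        using interior_part_superposition[OF z 0 0, of 1] by simp
      then show ?thesis
        using interior_part_superposition[OF z skeleton_face[OF that] 0, of c] by simp
    qed
  qed
  then show ?thesis
    by (simp add: psd_form_def schur_form_eq subspace_add[OF subspace_skeleton] subspace_scale[OF subspace_skeleton])
qed

end

theorem lemma4p3:
  fixes \<Omega> :: "(real^'n) set" and M :: "('n::finite) mesh" and k :: nat
    and f :: "real^'n \<Rightarrow> real"
  assumes dim: "CARD('n) = 2 \<or> CARD('n) = 3"
    and "k \<ge> 2"
    and "polyhedral_domain \<Omega>"
    and "polyhedral_mesh \<Omega> M"
    and "shape_regular M"
    and "square_integrable \<Omega> f"
  shows "(\<forall>l\<in>skeleton_space k \<Omega> M.
            (\<forall>m\<in>skeleton_space k \<Omega> M.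
               a_form k M (local_solution k \<Omega> M l f) (skeleton_fun m) = 0) \<longleftrightarrow>
            (\<forall>m\<in>skeleton_space k \<Omega> M.
               a_form k M (local_solution k \<Omega> M l (\<lambda>_. 0)) (skeleton_fun m) =
               - a_form k M (local_solution k \<Omega> M (zero_family, zero_family) f) (skeleton_fun m)))
       \<and> bilinear_form_on (skeleton_space k \<Omega> M) (schur_form k \<Omega> M)
       \<and> (\<forall>l\<in>skeleton_space k \<Omega> M. \<forall>m\<in>skeleton_space k \<Omega> M.
            schur_form k \<Omega> M l m = schur_form k \<Omega> M m l)
       \<and> (\<forall>l\<in>skeleton_space k \<Omega> M. l \<noteq> (zero_family, zero_family) \<longrightarrow> schur_form k \<Omega> M l l > 0)"
proof -
  interpret mesh_setting k \<Omega> M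
    using assms by unfold_locales
  interpret S: psd_form "skeleton_space k \<Omega> M" "schur_form k \<Omega> M"
    by (rule psd_schur_form)
  note f = \<open>square_integrable \<Omega> f\<close>
  have zero: "(zero_family, zero_family) = (0 :: 'n family \<times> 'n family)"
    by (simp add: zero_prod_def zero_fun_def)
  have face0: "0 \<in> face_space" by (rule subspace_0[OF subspace_face_space])
  have superposition: "a_form k M (local_solution k \<Omega> M l f) (skeleton_fun m) =
      a_form k M (local_solution k \<Omega> M l (\<lambda>_. 0)) (skeleton_fun m)
      + a_form k M (local_solution k \<Omega> M (zero_family, zero_family) f) (skeleton_fun m)"
    if l: "l \<in> skeleton_space k \<Omega> M" and m: "m \<in> skeleton_space k \<Omega> M" for l m
  proof -
    have m': "(0, m) \<in> weak_space" using skeleton_face[OF m] by (simp add: face_space_def)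
    have "sol l f = sol l (\<lambda>_. 0) + sol 0 f"
      using interior_part_superposition[OF f skeleton_face[OF l] face0, of 1] by simp
    then show ?thesis
      using psd_form.add_left[OF psd_a_form sol_weak[OF square_integrable_zero skeleton_face[OF l]] sol_weak[OF f face0] m']
      by (simp add: zero skeleton_fun_eq local_solution_eq f face0 square_integrable_zero skeleton_face[OF l])
  qed
  have positive: "schur_form k \<Omega> M l l > 0" if l: "l \<in> skeleton_space k \<Omega> M" and "l \<noteq> 0" for l
  proof -
    have "schur_form k \<Omega> M l l \<noteq> 0"
    proof
      assume "schur_form k \<Omega> M l l = 0"
      then have "sol l (\<lambda>_. 0) = 0"
        using a_form_definite[OF sol_weak0[OF square_integrable_zero l]] schur_form_eq[OF l l] by simp
      then show False using \<open>l \<noteq> 0\<close> by (simp add: zero_prod_def)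
    qed
    then show ?thesis using S.nonneg[OF l] by simp
  qed
  show ?thesis
  proof (intro conjI ballI impI)
    fix l assume l: "l \<in> skeleton_space k \<Omega> M"
    show "(\<forall>m\<in>skeleton_space k \<Omega> M. a_form k M (local_solution k \<Omega> M l f) (skeleton_fun m) = 0) \<longleftrightarrow>
        (\<forall>m\<in>skeleton_space k \<Omega> M. a_form k M (local_solution k \<Omega> M l (\<lambda>_. 0)) (skeleton_fun m) =
           - a_form k M (local_solution k \<Omega> M (zero_family, zero_family) f) (skeleton_fun m))"
    proof (rule ball_cong[OF refl])
      fix m assume "m \<in> skeleton_space k \<Omega> M"
      from superposition[OF l this]
      show "a_form k M (local_solution k \<Omega> M l f) (skeleton_fun m) = 0 \<longleftrightarrow>
          a_form k M (local_solution k \<Omega> M l (\<lambda>_. 0)) (skeleton_fun m) =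
          - a_form k M (local_solution k \<Omega> M (zero_family, zero_family) f) (skeleton_fun m)"
        by linarith
    qed
  next
    show "bilinear_form_on (skeleton_space k \<Omega> M) (schur_form k \<Omega> M)"
      by (simp add: bilinear_form_on_def lin_comb_eq S.add_left S.add_right S.scale_left S.scale_right)
  next
    show "schur_form k \<Omega> M l m = schur_form k \<Omega> M m l"
      if "l \<in> skeleton_space k \<Omega> M" "m \<in> skeleton_space k \<Omega> M" for l m
      using that by (rule S.sym)
  next
    show "0 < schur_form k \<Omega> M l l"
      if "l \<in> skeleton_space k \<Omega> M" "l \<noteq> (zero_family, zero_family)" for l
      using positive[OF that(1)] that(2) unfolding zero by blast
  qed
qed

end
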